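(* Let $n\geq 3$ be odd and put $m:=\frac{n-1}{2}$. Then the Grothendieck ring $r(H_{2n^2})$ is isomorphic (as a ring) to the quotient of the polynomial ring $\mathbb{Z}[y,z]$ modulo the ideal $I$ generated by the three elements $$y^{2n}-1,\qquad zy^{n}-z,$$ and $$z^{m+1}-z^{m}y^{m+1}+\sum_{i=1}^{\lfloor\frac{m+1}{2}\rfloor}(-1)^{i}\binom{m+1-i}{i}y^{i}z^{m+1-2i}-\sum_{i=1}^{\lfloor\frac{m}{2}\rfloor}(-1)^{i}\binom{m-i}{i}y^{m+1+i}z^{m-2i}-y^{n+1}F_m(y,z)+y^{m+n+2}F_{m-1}(y,z).$$
   Context: Let $n>1$ and let $k$ be a field containing a primitive $n$-th root of unity $q$, with $\operatorname{char} k\nmid 2n^2$. The Hopf algebra $H_{2n^2}$ is the associative unital $k$-algebra generated by $x,y,z$ with relations $$x^n=1,\quad y^n=1,\quad xy=yx,\quad zx=yz,\quad zy=xz,\quad z^2=\frac1n\sum_{i,j=0}^{n-1}q^{-ij}x^iy^j,$$ and with $\Delta(x)=x\otimes x$, $\Delta(y)=y\otimes y$, $\Delta(z)=\frac1n\sum_{i,j=0}^{n-1}q^{-ij}x^iz\otimes y^jz$, $\epsilon(x)=\epsilon(y)=\epsilon(z)=1$, $S(x)=x^{-1}$, $S(y)=y^{-1}$, $S(z)=z$. It is semisimple of dimension $2n^2$. The Grothendieck ring (equivalently, Green ring) $r(H_{2n^2})$ is the abelian group generated by isomorphism classes $[M]$ of finite dimensional $H_{2n^2}$-modules modulo the relations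 $[M\oplus N]=[M]+[N]$, with multiplication $[M][N]=[M\otimes N]$ and $H_{2n^2}$ acting on $M\otimes N$ through $\Delta$. The polynomials $F_t(y,z)\in\mathbb{Z}[y,z]$ are defined by $F_0=0$, $F_1=1$, $F_2=z$ and $F_{t+2}=zF_{t+1}-yF_t$ for $t\ge1$. Here $\lfloor\cdot\rfloor$ is the floor function. In the polynomial ring $\mathbb{Z}[y,z]$ the letters $y,z$ are commuting indeterminates (not the generators of $H_{2n^2}$). *)

theory Defs
  imports
    "HOL-Library.Poly_Mapping"
    "HOL-Library.Product_Plus"
    "HOL-Computational_Algebra.Polynomial"
    "HOL-Algebra.QuotRing"
    "HOL-Algebra.Generated_Groups"
    "HOL-Algebra.Algebraic_Closure_Type"
    "Jordan_Normal_Form.Matrix"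
begin

section \<open>The free algebra on three letters and its tensor square\<close>

datatype gen = GenX | GenY | GenZ

text \<open>
  Words under concatenation, written additively because the product of \<^typ>\<open>'a \<Rightarrow>\<^sub>0 'b\<close> is the
  convolution over an additive monoid. So \<open>word \<Rightarrow>\<^sub>0 'k\<close> is the free algebra \<open>F = k\<langle>x, y, z\<rangle>\<close>, and
  \<open>word \<times> word \<Rightarrow>\<^sub>0 'k\<close> is \<open>F \<otimes> F\<close>, the pair \<open>(u, v)\<close> standing for \<open>u \<otimes> v\<close>.
\<close>

datatype word = Word (letters: "gen list")

instantiation word :: monoid_add
begin

definition zero_word :: word where "zero_word = Word []"

definition plus_word :: "word \<Rightarrow> word \<Rightarrow> word" where
  "plus_word u v = Word (letters u @ letters v)"

instance
  by standard (simp_all add: zero_word_def plus_word_def)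

end

type_synonym 'k falg = "word \<Rightarrow>\<^sub>0 'k"
type_synonym 'k falg2 = "word \<times> word \<Rightarrow>\<^sub>0 'k"

definition sc :: "'k::field \<Rightarrow> ('m::monoid_add \<Rightarrow>\<^sub>0 'k)" where
  "sc c = Poly_Mapping.single 0 c"

definition letter :: "gen \<Rightarrow> 'k::field falg" where
  "letter g = Poly_Mapping.single (Word [g]) 1"

abbreviation "gx \<equiv> letter GenX"
abbreviation "gy \<equiv> letter GenY"
abbreviation "gz \<equiv> letter GenZ"

definition tens :: "'k::field falg \<Rightarrow> 'k falg \<Rightarrow> 'k falg2" where
  "tens f g = (\<Sum>u\<in>Poly_Mapping.keys f. \<Sum>v\<in>Poly_Mapping.keys g.
     Poly_Mapping.single (u, v) (Poly_Mapping.lookup f u * Poly_Mapping.lookup g v))"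

text \<open>
  The homomorphism of algebras from \<open>F\<close> to \<open>A\<close> sending each generator \<open>g\<close> to \<open>\<phi> g\<close>, where \<open>\<eta>\<close>
  embeds the scalars in \<open>A\<close>.
\<close>

definition free_hom :: "('k::field \<Rightarrow> 'a::ring_1) \<Rightarrow> (gen \<Rightarrow> 'a) \<Rightarrow> 'k falg \<Rightarrow> 'a" where
  "free_hom \<eta> \<phi> f = (\<Sum>w\<in>Poly_Mapping.keys f.
     \<eta> (Poly_Mapping.lookup f w) * prod_list (map \<phi> (letters w)))"


section \<open>The Hopf algebra\<close>

definition primitive_root_of_unity :: "nat \<Rightarrow> 'k::field \<Rightarrow> bool" where
  "primitive_root_of_unity n q \<longleftrightarrow> q ^ n = 1 \<and> (\<forall>j. 0 < j \<and> j < n \<longrightarrow> q ^ j \<noteq> 1)"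

definition relators :: "nat \<Rightarrow> 'k::field \<Rightarrow> 'k falg set" where
  "relators n q =
    {gx ^ n - 1, gy ^ n - 1, gx * gy - gy * gx, gz * gx - gy * gz, gz * gy - gx * gz,
     gz ^ 2 - sc (1 / of_nat n) * (\<Sum>i<n. \<Sum>j<n. sc (inverse (q ^ (i * j))) * gx ^ i * gy ^ j)}"

definition H_ideal :: "nat \<Rightarrow> 'k::field \<Rightarrow> 'k falg set" where
  "H_ideal n q = Idl\<^bsub>ring_of_type_algebra\<^esub> (relators n q)"

definition H :: "nat \<Rightarrow> 'k::field \<Rightarrow> 'k falg set ring" where
  "H n q = ring_of_type_algebra Quot (H_ideal n q)"

definition H_class :: "nat \<Rightarrow> 'k::field \<Rightarrow> 'k falg \<Rightarrow> 'k falg set" where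
  "H_class n q f = H_ideal n q +>\<^bsub>ring_of_type_algebra\<^esub> f"

definition H_smult :: "nat \<Rightarrow> 'k::field \<Rightarrow> 'k \<Rightarrow> 'k falg set \<Rightarrow> 'k falg set" where
  "H_smult n q c h = H_class n q (sc c) \<otimes>\<^bsub>H n q\<^esub> h"

text \<open>
  With \<open>H = F / I\<close>, the algebra \<open>H \<otimes> H\<close> is \<open>(F \<otimes> F) / (I \<otimes> F + F \<otimes> I)\<close>; the set below is
  \<open>I \<otimes> F + F \<otimes> I\<close>. Elements of \<open>H \<otimes> H\<close> are its cosets.
\<close>

definition H2_ideal :: "nat \<Rightarrow> 'k::field \<Rightarrow> 'k falg2 set" where
  "H2_ideal n q = Idl\<^bsub>ring_of_type_algebra\<^esub>
     ((\<lambda>a. tens a 1) ` H_ideal n q \<union> (\<lambda>a. tens 1 a) ` H_ideal n q)"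

fun comult_gen :: "nat \<Rightarrow> 'k::field \<Rightarrow> gen \<Rightarrow> 'k falg2" where
  "comult_gen n q GenX = tens gx gx"
| "comult_gen n q GenY = tens gy gy"
| "comult_gen n q GenZ = sc (1 / of_nat n) *
     (\<Sum>i<n. \<Sum>j<n. sc (inverse (q ^ (i * j))) * tens (gx ^ i * gz) (gy ^ j * gz))"

text \<open>
  \<open>\<Delta> : H \<rightarrow> H \<otimes> H\<close> and \<open>\<epsilon> : H \<rightarrow> k\<close>, induced on cosets by the homomorphisms on the free algebra
  with the prescribed values on the generators.
\<close>

definition comult :: "nat \<Rightarrow> 'k::field \<Rightarrow> 'k falg set \<Rightarrow> 'k falg2 set" where
  "comult n q h = (\<Union>f\<in>h. H2_ideal n q +>\<^bsub>ring_of_type_algebra\<^esub> free_hom sc (comult_gen n q) f)"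

definition counit :: "'k::field falg set \<Rightarrow> 'k" where
  "counit h = the_elem (free_hom (\<lambda>c. c) (\<lambda>_. 1) ` h)"


section \<open>Finite dimensional modules\<close>

text \<open>
  A pair \<open>(d, \<rho>)\<close> is the module with underlying space \<open>k\<^sup>d\<close> on which \<open>h\<close> acts by the matrix \<open>\<rho> h\<close>.
  Every finite dimensional module is isomorphic to one of this form. The values of \<open>\<rho>\<close> outside the
  carrier of \<open>H\<close> are irrelevant, since isomorphism ignores them.
\<close>

type_synonym 'k hmod = "nat \<times> ('k falg set \<Rightarrow> 'k mat)"

definition is_hmod :: "nat \<Rightarrow> 'k::field \<Rightarrow> 'k hmod \<Rightarrow> bool" where
  "is_hmod n q M \<longleftrightarrow> (case M of (d, \<rho>) \<Rightarrow>
     \<rho> \<in> Ring.ring_hom (H n q) (ring_mat TYPE('k) d ()) \<and>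
     (\<forall>c. \<forall>h\<in>carrier (H n q). \<rho> (H_smult n q c h) = c \<cdot>\<^sub>m \<rho> h))"

definition hmod_iso :: "nat \<Rightarrow> 'k::field \<Rightarrow> 'k hmod \<Rightarrow> 'k hmod \<Rightarrow> bool" where
  "hmod_iso n q M N \<longleftrightarrow> (case M of (d, \<rho>) \<Rightarrow> case N of (e, \<sigma>) \<Rightarrow>
     \<exists>P\<in>carrier_mat e d. \<exists>Q\<in>carrier_mat d e. P * Q = 1\<^sub>m e \<and> Q * P = 1\<^sub>m d \<and>
       (\<forall>h\<in>carrier (H n q). P * \<rho> h = \<sigma> h * P))"

definition iso_class :: "nat \<Rightarrow> 'k::field \<Rightarrow> 'k hmod \<Rightarrow> 'k hmod set" where
  "iso_class n q M = {N. is_hmod n q N \<and> hmod_iso n q M N}"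

definition hmod_sum :: "'k::field hmod \<Rightarrow> 'k hmod \<Rightarrow> 'k hmod" where
  "hmod_sum M N = (case M of (d, \<rho>) \<Rightarrow> case N of (e, \<sigma>) \<Rightarrow>
     (d + e, \<lambda>h. four_block_mat (\<rho> h) (0\<^sub>m d e) (0\<^sub>m e d) (\<sigma> h)))"

definition kronecker :: "'k::field mat \<Rightarrow> 'k mat \<Rightarrow> 'k mat" where
  "kronecker A B = mat (dim_row A * dim_row B) (dim_col A * dim_col B)
     (\<lambda>(r, c). A $$ (r div dim_row B, c div dim_col B) * B $$ (r mod dim_row B, c mod dim_col B))"

text \<open>
  \<open>F \<otimes> F\<close> acts on \<open>M \<otimes> N = k\<^bsup>d e\<^esup>\<close> by letting \<open>u \<otimes> v\<close> act as the Kronecker product of the actions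
  of \<open>u\<close> and \<open>v\<close>; the sum over the support is taken entrywise. This induces the action of \<open>H \<otimes> H\<close>,
  and \<open>H\<close> acts on \<open>M \<otimes> N\<close> through \<open>\<Delta>\<close>.
\<close>

definition act2_free :: "nat \<Rightarrow> 'k::field \<Rightarrow> 'k hmod \<Rightarrow> 'k hmod \<Rightarrow> 'k falg2 \<Rightarrow> 'k mat" where
  "act2_free n q M N g = (case M of (d, \<rho>) \<Rightarrow> case N of (e, \<sigma>) \<Rightarrow>
     mat (d * e) (d * e) (\<lambda>rc. \<Sum>(u, v)\<in>Poly_Mapping.keys g. Poly_Mapping.lookup g (u, v) *
       kronecker (\<rho> (H_class n q (Poly_Mapping.single u 1)))
                 (\<sigma> (H_class n q (Poly_Mapping.single v 1))) $$ rc))"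

definition act2 :: "nat \<Rightarrow> 'k::field \<Rightarrow> 'k hmod \<Rightarrow> 'k hmod \<Rightarrow> 'k falg2 set \<Rightarrow> 'k mat" where
  "act2 n q M N t = the_elem (act2_free n q M N ` t)"

definition hmod_tensor :: "nat \<Rightarrow> 'k::field \<Rightarrow> 'k hmod \<Rightarrow> 'k hmod \<Rightarrow> 'k hmod" where
  "hmod_tensor n q M N = (fst M * fst N, \<lambda>h. act2 n q M N (comult n q h))"

definition hmod_unit :: "'k::field hmod" where
  "hmod_unit = (1, \<lambda>h. counit h \<cdot>\<^sub>m 1\<^sub>m 1)"


section \<open>The Green ring\<close>

definition iso_classes :: "nat \<Rightarrow> 'k::field \<Rightarrow> 'k hmod set set" where
  "iso_classes n q = iso_class n q ` {M. is_hmod n q M}"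

definition class_tensor :: "nat \<Rightarrow> 'k::field \<Rightarrow> 'k hmod set \<Rightarrow> 'k hmod set \<Rightarrow> 'k hmod set" where
  "class_tensor n q C D = (\<Union>M\<in>C. \<Union>N\<in>D. iso_class n q (hmod_tensor n q M N))"

text \<open>
  The free abelian group on the isomorphism classes, with the biadditive extension of \<open>\<otimes>\<close>.
\<close>

definition free_green_ring :: "nat \<Rightarrow> 'k::field \<Rightarrow> ('k hmod set \<Rightarrow>\<^sub>0 int) ring" where
  "free_green_ring n q =
     \<lparr>carrier = {a. Poly_Mapping.keys a \<subseteq> iso_classes n q},
      monoid.mult = (\<lambda>a b. frag_extend (\<lambda>C. frag_extend (\<lambda>D. frag_of (class_tensor n q C D)) b) a),
      monoid.one = frag_of (iso_class n q hmod_unit),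
      ring.zero = 0,
      ring.add = (+)\<rparr>"

definition sum_relations :: "nat \<Rightarrow> 'k::field \<Rightarrow> ('k hmod set \<Rightarrow>\<^sub>0 int) set" where
  "sum_relations n q =
     {frag_of (iso_class n q (hmod_sum M N)) - (frag_of (iso_class n q M) + frag_of (iso_class n q N))
      | M N. is_hmod n q M \<and> is_hmod n q N}"

text \<open>
  The additive subgroup generated by the relations \<open>[M \<oplus> N] = [M] + [N]\<close> is factored out.
\<close>

definition green_ring :: "nat \<Rightarrow> 'k::field \<Rightarrow> ('k hmod set \<Rightarrow>\<^sub>0 int) set ring" where
  "green_ring n q =
     free_green_ring n q Quot generate (add_monoid (free_green_ring n q)) (sum_relations n q)"


section \<open>Polynomials in two variables\<close>

text \<open>
  \<open>\<int>[y, z]\<close> is rendered as \<open>\<int>[y][z]\<close>. The recursion below is \<open>F\<^sub>t\<^sub>+\<^sub>2 = z F\<^sub>t\<^sub>+\<^sub>1 - y F\<^sub>t\<close>; its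
  instance \<open>t = 0\<close> yields the prescribed value \<open>F\<^sub>2 = z\<close>.
\<close>

definition varY :: "int poly poly" where "varY = [:[:0, 1:]:]"
definition varZ :: "int poly poly" where "varZ = [:0, 1:]"

fun F :: "nat \<Rightarrow> int poly poly" where
  "F 0 = 0"
| "F (Suc 0) = 1"
| "F (Suc (Suc t)) = varZ * F (Suc t) - varY * F t"

end

theory Submission
  imports Defs "HOL-Library.Function_Algebras" "Jordan_Normal_Form.Char_Poly"
begin

text \<open>
  Why the theorem holds. On a finite dimensional module the commuting elements \<open>x\<close>, \<open>y\<close> are
  diagonalisable, so the module is the direct sum of its weight spaces, the space of weight \<open>(a, b)\<close>
  being the one on which \<open>x\<close> acts as \<open>q^a\<close> and \<open>y\<close> as \<open>q^b\<close>. The relations say that \<open>z\<close> carries weight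
  \<open>(a, b)\<close> to weight \<open>(b, a)\<close>, and a Gauss sum (\<open>gauss_sum\<close>) shows that \<open>z\<^sup>2\<close> acts on both as \<open>q^(a b)\<close>.
  Hence the simple modules are of two kinds. For \<open>a\<close> and \<open>b\<close> distinct modulo \<open>n\<close> there is one of
  dimension two, with weights \<open>(a, b)\<close> and \<open>(b, a)\<close>. For each \<open>a\<close> modulo \<open>n\<close> there are two of dimension
  one, on which \<open>z\<close> acts as one of the square roots of \<open>q^(a\<^sup>2)\<close>; they exist in \<open>k\<close> because \<open>q\<close> is a
  square, \<open>n\<close> being odd. With \<open>s\<^sup>2 = q\<close> and \<open>s^n = 1\<close>, the eigenvalues \<open>(-1)^j s^(j\<^sup>2)\<close>, for \<open>j\<close> modulo
  \<open>2 n\<close>, list all of these roots, and the one-dimensional modules \<open>dim1 j\<close> so numbered satisfy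
  \<open>dim1 i \<otimes> dim1 j = dim1 (i + j)\<close>.

  On weight vectors \<open>v\<close> of weight \<open>(a, b)\<close> and \<open>w\<close> of weight \<open>(c, d)\<close> the comultiplication becomes
  \<open>z (v \<otimes> w) = q^(b c) z v \<otimes> z w\<close>, by the same Gauss sum. So tensor products of simple modules can be
  read off from the weights: \<open>dim1 i \<otimes> dim2 a b\<close> is \<open>dim2 (i + a) (i + b)\<close>, and \<open>dim2 a b \<otimes> dim2 c d\<close> is
  the sum of \<open>dim2 (a + c) (b + d)\<close> and \<open>dim2 (a + d) (b + c)\<close>, where \<open>dim2 a a\<close> stands for the sum of
  the two one-dimensional modules of weight \<open>(a, a)\<close>.

  Both rings of the theorem are compared with a ring of complex functions. The character of a
  module evaluates the generating function of its weights at pairs of \<open>n\<close>-th roots of unity, and at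
  single \<open>n\<close>-th roots of unity the generating function that counts each \<open>dim1 j\<close> with sign \<open>(-1)^j\<close>;
  two-dimensional simple modules do not contribute to the latter. Characters are additive and
  multiplicative (\<open>all_tensor_ok\<close>), and those of the simple modules are linearly independent
  (\<open>simple_char_independent\<close>). As every module is a sum of simple ones (\<open>rep_induct\<close>), the kernel of the
  character on the free group on isomorphism classes is the group generated by the relations
  \<open>[M \<oplus> N] = [M] + [N]\<close>.

  On the other side, send \<open>y\<close> to the character of \<open>dim1 1\<close> and \<open>z\<close> to that of \<open>dim2 0 1\<close>. The recursion
  of the \<open>F\<^sub>t\<close> is the rule for tensoring with \<open>dim2 0 1\<close>, and \<open>F\<^sub>t\<^sub>+\<^sub>2 - y^(n+1) F\<^sub>t\<close> represents
  \<open>dim2 0 (t + 1)\<close>. In these terms the three generators of the ideal say that \<open>dim1\<close> has period \<open>2 n\<close>,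
  that \<open>dim1 n\<close> fixes \<open>dim2 0 1\<close>, and that \<open>dim1 (m + 1) \<otimes> dim2 0 m = dim2 0 (m + 1)\<close>, which is true
  because \<open>2 m + 1 = n\<close> and \<open>dim2\<close> is symmetric. Modulo these relations every polynomial is an integral
  combination of one monomial or product per simple module (\<open>spanned_all\<close>), and the images of these
  are the independent simple characters. So the ideal is the whole kernel and the two quotients are
  isomorphic to the same ring of functions.

  The algebra is presented by generators, so modules are handled as matrices for \<open>x\<close>, \<open>y\<close>, \<open>z\<close> that
  satisfy the relations. That the matrices on \<open>M \<otimes> N\<close> satisfy them is checked for simple \<open>M\<close> and \<open>N\<close>,
  where the product is a known module, and then carried over to all modules along direct sums and
  isomorphisms.
\<close>

section \<open>Linear extension of matrix representations of a monoid\<close>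

lemma poly_mapping_single_induct [case_names zero single add]:
  fixes f :: "'m \<Rightarrow>\<^sub>0 'b::ab_group_add"
  assumes "P 0" and "\<And>u c. P (Poly_Mapping.single u c)"
    and "\<And>f g. P f \<Longrightarrow> P g \<Longrightarrow> P (f + g)"
  shows "P f"
proof (induction f rule: update_induct)
  case const
  show ?case by fact
next
  case (update f a b)
  have "Poly_Mapping.update a b f = f + Poly_Mapping.single a b"
    using update(1) by (intro poly_mapping_eqI) (auto simp: lookup_update lookup_add lookup_single in_keys_iff when_def)
  then show ?case using assms update by simp
qed

text \<open>
  The value is built entry by entry, because matrices of a fixed size form no type in which a sum
  over the support could be written.
\<close>

definition lin_ext :: "nat \<Rightarrow> ('m \<Rightarrow> 'k::field mat) \<Rightarrow> ('m \<Rightarrow>\<^sub>0 'k) \<Rightarrow> 'k mat" where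
  "lin_ext d G f = mat d d (\<lambda>rc. \<Sum>u\<in>Poly_Mapping.keys f. Poly_Mapping.lookup f u * G u $$ rc)"

lemma lin_ext_carrier [simp]: "lin_ext d G f \<in> carrier_mat d d"
  by (simp add: lin_ext_def)

lemma lin_ext_dim [simp]: "dim_row (lin_ext d G f) = d" "dim_col (lin_ext d G f) = d"
  by (simp_all add: lin_ext_def)

lemma lin_ext_entry_superset:
  assumes "finite A" "Poly_Mapping.keys f \<subseteq> A" "r < d" "c < d"
  shows "lin_ext d G f $$ (r, c) = (\<Sum>u\<in>A. Poly_Mapping.lookup f u * G u $$ (r, c))"
proof -
  have "(\<Sum>u\<in>Poly_Mapping.keys f. Poly_Mapping.lookup f u * G u $$ (r, c))
      = (\<Sum>u\<in>A. Poly_Mapping.lookup f u * G u $$ (r, c))"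
    by (rule sum.mono_neutral_left) (use assms in \<open>auto simp: in_keys_iff\<close>)
  then show ?thesis using assms by (simp add: lin_ext_def)
qed

lemma lin_ext_zero [simp]: "lin_ext d G 0 = 0\<^sub>m d d"
  by (rule eq_matI) (simp_all add: lin_ext_def)

lemma lin_ext_add: "lin_ext d G (f + g) = lin_ext d G f + lin_ext d G g"
proof (rule eq_matI)
  fix r c assume "r < dim_row (lin_ext d G f + lin_ext d G g)" "c < dim_col (lin_ext d G f + lin_ext d G g)"
  then have rc: "r < d" "c < d" by simp_all
  let ?A = "Poly_Mapping.keys f \<union> Poly_Mapping.keys g"
  have A: "finite ?A" by simp
  have "Poly_Mapping.keys (f + g) \<subseteq> ?A" by (rule Poly_Mapping.keys_add)
  then show "lin_ext d G (f + g) $$ (r, c) = (lin_ext d G f + lin_ext d G g) $$ (r, c)"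
    using rc by (simp add: lin_ext_entry_superset[OF A] lookup_add sum.distrib algebra_simps)
qed simp_all

lemma lin_ext_single:
  assumes "G u \<in> carrier_mat d d"
  shows "lin_ext d G (Poly_Mapping.single u c) = c \<cdot>\<^sub>m G u"
  by (rule eq_matI) (use assms in \<open>auto simp: lin_ext_def\<close>)

lemma lin_ext_sum_entry:
  assumes "r < d" "c < d"
  shows "lin_ext d G (\<Sum>i\<in>A. f i) $$ (r, c) = (\<Sum>i\<in>A. lin_ext d G (f i) $$ (r, c))"
  using assms by (induction A rule: infinite_finite_induct) (simp_all add: lin_ext_add)

definition monoid_rep :: "nat \<Rightarrow> ('m::monoid_add \<Rightarrow> 'k::field mat) \<Rightarrow> bool" where
  "monoid_rep d G \<longleftrightarrow> (\<forall>u. G u \<in> carrier_mat d d) \<and> G 0 = 1\<^sub>m d \<and> (\<forall>u v. G (u + v) = G u * G v)"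

lemma lin_ext_mult:
  assumes "monoid_rep d G"
  shows "lin_ext d G (f * g) = lin_ext d G f * lin_ext d G g"
proof (induction f rule: poly_mapping_single_induct)
  case (single u c)
  have G: "G u \<in> carrier_mat d d" "G (u + v) = G u * G v" for u v
    using assms by (auto simp: monoid_rep_def)
  show ?case
  proof (induction g rule: poly_mapping_single_induct)
    case (single v e)
    have "(c \<cdot>\<^sub>m G u) * (e \<cdot>\<^sub>m G v) = (c * e) \<cdot>\<^sub>m (G u * G v)"
      by (rule eq_matI) (use G(1)[of u] G(1)[of v] in auto)
    then show ?case
      by (simp add: mult_single lin_ext_single G(1)) (simp add: G(2))
  next
    case (add g h)
    then show ?case
      by (simp add: distrib_left lin_ext_add mult_add_distrib_mat[of _ d d _ d])
  qed (simp add: right_mult_zero_mat[of _ d d])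
next
  case (add f h)
  then show ?case
    by (simp add: distrib_right lin_ext_add add_mult_distrib_mat[of _ d d _ _ d])
qed simp

lemma smult_one_mat [simp]: "1 \<cdot>\<^sub>m (A :: 'k::field mat) = A"
  by (rule eq_matI) simp_all

lemma lin_ext_sc:
  assumes "monoid_rep d G"
  shows "lin_ext d G (sc c) = c \<cdot>\<^sub>m 1\<^sub>m d"
  using assms by (simp add: sc_def lin_ext_single monoid_rep_def)

lemma sc_one [simp]: "sc 1 = 1"
  by (simp add: sc_def)

lemma lin_ext_one:
  assumes "monoid_rep d G"
  shows "lin_ext d G 1 = 1\<^sub>m d"
  using lin_ext_sc[OF assms, of 1] by (auto simp: sc_one)

text \<open>
  Both sides are linear in \<open>f\<close>, so an identity for the matrices of the monoid
  elements extends. All comparisons of actions below (isomorphisms, direct sums, tensor products)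
  are instances of this principle or of \<open>lin_ext_block_sum\<close>.
\<close>

lemma lin_ext_intertwine:
  assumes P: "P \<in> carrier_mat e d"
    and G: "\<And>u. G u \<in> carrier_mat d d" "\<And>u. G' u \<in> carrier_mat e e"
    and PG: "\<And>u. P * G u = G' u * P"
  shows "P * lin_ext d G f = lin_ext e G' f * P"
proof (induction f rule: poly_mapping_single_induct)
  case zero
  show ?case using P by simp
next
  case (single u c)
  have "P * (c \<cdot>\<^sub>m G u) = c \<cdot>\<^sub>m (G' u * P)"
    using mult_smult_distrib[OF P G(1)] PG by simp
  also have "\<dots> = (c \<cdot>\<^sub>m G' u) * P" using mult_smult_assoc_mat[OF G(2) P] by simp
  finally show ?case using G by (simp add: lin_ext_single)
next
  case (add f g)
  show ?case
    unfolding lin_ext_add using P add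
    by (simp add: mult_add_distrib_mat[of _ e d _ d] add_mult_distrib_mat[of _ e e _ _ d])
qed

definition block_sum :: "'k::field mat \<Rightarrow> 'k mat \<Rightarrow> 'k mat" where
  "block_sum A B = four_block_mat A (0\<^sub>m (dim_row A) (dim_col B)) (0\<^sub>m (dim_row B) (dim_col A)) B"

lemma block_sum_dim [simp]:
  "dim_row (block_sum A B) = dim_row A + dim_row B" "dim_col (block_sum A B) = dim_col A + dim_col B"
  by (simp_all add: block_sum_def)

lemma block_sum_carrier [simp]:
  "A \<in> carrier_mat a b \<Longrightarrow> B \<in> carrier_mat c d \<Longrightarrow> block_sum A B \<in> carrier_mat (a + c) (b + d)"
  by (auto simp: block_sum_def)

lemma block_sum_mult:
  assumes "A \<in> carrier_mat a b" "B \<in> carrier_mat c d" "A' \<in> carrier_mat b a'" "B' \<in> carrier_mat d c'"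
  shows "block_sum A B * block_sum A' B' = block_sum (A * A') (B * B')"
  unfolding block_sum_def
  by (subst mult_four_block_mat) (use assms in auto)

lemma lin_ext_block_sum:
  assumes "\<And>u. G u \<in> carrier_mat d d" "\<And>u. G' u \<in> carrier_mat e e"
  shows "lin_ext (d + e) (\<lambda>u. block_sum (G u) (G' u)) f = block_sum (lin_ext d G f) (lin_ext e G' f)"
proof -
  have "dim_row (G u) = d" "dim_col (G u) = d" "dim_row (G' u) = e" "dim_col (G' u) = e" for u
    using assms[of u] by auto
  then show ?thesis
    by (intro eq_matI) (auto simp: lin_ext_def block_sum_def)
qed

section \<open>Representations of the free algebra\<close>

definition wmat :: "nat \<Rightarrow> (gen \<Rightarrow> 'k::field mat) \<Rightarrow> word \<Rightarrow> 'k mat" where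
  "wmat d \<phi> w = foldr (\<lambda>g M. \<phi> g * M) (letters w) (1\<^sub>m d)"

definition ev :: "nat \<Rightarrow> (gen \<Rightarrow> 'k::field mat) \<Rightarrow> 'k falg \<Rightarrow> 'k mat" where
  "ev d \<phi> = lin_ext d (wmat d \<phi>)"

definition gens_in :: "nat \<Rightarrow> (gen \<Rightarrow> 'k::field mat) \<Rightarrow> bool" where
  "gens_in d \<phi> \<longleftrightarrow> (\<forall>g. \<phi> g \<in> carrier_mat d d)"

lemma gens_inD: "gens_in d \<phi> \<Longrightarrow> \<phi> g \<in> carrier_mat d d"
  by (simp add: gens_in_def)

lemma foldr_carrier:
  "gens_in d \<phi> \<Longrightarrow> foldr (\<lambda>g M. \<phi> g * M) gs (1\<^sub>m d) \<in> carrier_mat d d"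
  by (induction gs) (auto simp: gens_in_def intro: mult_carrier_mat)

lemma wmat_carrier: "gens_in d \<phi> \<Longrightarrow> wmat d \<phi> w \<in> carrier_mat d d"
  unfolding wmat_def by (rule foldr_carrier)

lemma monoid_rep_wmat:
  assumes "gens_in d \<phi>"
  shows "monoid_rep d (wmat d \<phi>)"
proof -
  have "foldr (\<lambda>g M. \<phi> g * M) (gs @ hs) (1\<^sub>m d)
      = foldr (\<lambda>g M. \<phi> g * M) gs (1\<^sub>m d) * foldr (\<lambda>g M. \<phi> g * M) hs (1\<^sub>m d)" for gs hs
  proof (induction gs)
    case Nil
    then show ?case using foldr_carrier[OF assms, of hs] by simp
  next
    case (Cons g gs)
    then show ?case
      using foldr_carrier[OF assms, of hs] foldr_carrier[OF assms, of gs] gens_inD[OF assms, of g]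
      by (simp add: assoc_mult_mat[of _ d d _ d _ d])
  qed
  then show ?thesis
    by (auto simp: monoid_rep_def wmat_carrier[OF assms] plus_word_def) (auto simp: wmat_def zero_word_def)
qed

lemma ev_carrier [simp]: "ev d \<phi> f \<in> carrier_mat d d"
  by (simp add: ev_def)

lemma ev_dim [simp]: "dim_row (ev d \<phi> f) = d" "dim_col (ev d \<phi> f) = d"
  by (simp_all add: ev_def)

lemma ev_zero [simp]: "ev d \<phi> 0 = 0\<^sub>m d d"
  by (simp add: ev_def)

lemma ev_add: "ev d \<phi> (f + g) = ev d \<phi> f + ev d \<phi> g"
  by (simp add: ev_def lin_ext_add)

lemma ev_mult: "gens_in d \<phi> \<Longrightarrow> ev d \<phi> (f * g) = ev d \<phi> f * ev d \<phi> g"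
  by (simp add: ev_def lin_ext_mult[OF monoid_rep_wmat])

lemma ev_sc: "gens_in d \<phi> \<Longrightarrow> ev d \<phi> (sc c) = c \<cdot>\<^sub>m 1\<^sub>m d"
  by (simp add: ev_def lin_ext_sc[OF monoid_rep_wmat])

lemma ev_one: "gens_in d \<phi> \<Longrightarrow> ev d \<phi> 1 = 1\<^sub>m d"
  by (simp add: ev_def lin_ext_one[OF monoid_rep_wmat])

lemma ev_letter: "gens_in d \<phi> \<Longrightarrow> ev d \<phi> (letter g) = \<phi> g"
  using gens_inD[of d \<phi> g] by (simp add: ev_def letter_def lin_ext_single wmat_def)

lemma ev_sc_mult: "gens_in d \<phi> \<Longrightarrow> ev d \<phi> (sc c * f) = c \<cdot>\<^sub>m ev d \<phi> f"
  by (simp add: ev_mult ev_sc mult_smult_assoc_mat[of "1\<^sub>m d" d d _ d] left_mult_one_mat[of _ d d])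

lemma ev_sum_entry:
  "r < d \<Longrightarrow> c < d \<Longrightarrow> ev d \<phi> (\<Sum>i\<in>A. f i) $$ (r, c) = (\<Sum>i\<in>A. ev d \<phi> (f i) $$ (r, c))"
  by (simp add: ev_def lin_ext_sum_entry)

lemma ev_uminus: "gens_in d \<phi> \<Longrightarrow> ev d \<phi> (- f) = - ev d \<phi> f"
proof -
  assume g: "gens_in d \<phi>"
  have "ev d \<phi> (- f) + ev d \<phi> f = 0\<^sub>m d d"
    using ev_add[of d \<phi> "- f" f] by simp
  then have "(ev d \<phi> (- f) + ev d \<phi> f) $$ (r, c) = 0" if "r < d" "c < d" for r c
    using that by simp
  then show ?thesis by (intro eq_matI) (auto simp: eq_neg_iff_add_eq_0)
qed

lemma ev_diff: "gens_in d \<phi> \<Longrightarrow> ev d \<phi> (f - g) = ev d \<phi> f - ev d \<phi> g"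
  using ev_add[of d \<phi> f "- g"] by (simp add: ev_uminus add_uminus_minus_mat[of _ d d])

lemma ev_eq_iff: "gens_in d \<phi> \<Longrightarrow> ev d \<phi> f = ev d \<phi> g \<longleftrightarrow> ev d \<phi> (f - g) = 0\<^sub>m d d"
proof
  assume "gens_in d \<phi>" "ev d \<phi> (f - g) = 0\<^sub>m d d"
  then have "ev d \<phi> f - ev d \<phi> g = 0\<^sub>m d d" by (simp add: ev_diff)
  then have "(ev d \<phi> f - ev d \<phi> g) $$ (r, c) = 0" if "r < d" "c < d" for r c using that by simp
  then show "ev d \<phi> f = ev d \<phi> g" by (intro eq_matI) auto
qed (auto simp: ev_diff)

definition alg_hom :: "nat \<Rightarrow> ('k::field falg \<Rightarrow> 'k mat) \<Rightarrow> bool" where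
  "alg_hom d \<psi> \<longleftrightarrow> (\<forall>f. \<psi> f \<in> carrier_mat d d) \<and> (\<forall>f g. \<psi> (f + g) = \<psi> f + \<psi> g)
     \<and> (\<forall>f g. \<psi> (f * g) = \<psi> f * \<psi> g) \<and> (\<forall>c. \<psi> (sc c) = c \<cdot>\<^sub>m 1\<^sub>m d)"

lemma single_Word: "Poly_Mapping.single (Word gs) c = sc c * prod_list (map letter gs)"
proof (induction gs arbitrary: c)
  case Nil
  then show ?case by (simp add: sc_def zero_word_def)
next
  case (Cons g gs)
  have "Poly_Mapping.single (Word (g # gs)) c = letter g * Poly_Mapping.single (Word gs) c"
    by (simp add: letter_def mult_single plus_word_def)
  also have "letter g * sc c = sc c * letter g"
    by (simp add: letter_def sc_def mult_single)
  ultimately show ?case using Cons by (simp add: mult.assoc[symmetric])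
qed

text \<open>
  The universal property of the free algebra, with values in matrices. It identifies an action
  that is given abstractly, through cosets or through the comultiplication, with evaluation at the
  images of the three letters.
\<close>

lemma alg_hom_unique:
  assumes "alg_hom d \<psi>"
  shows "gens_in d (\<lambda>g. \<psi> (letter g))" and "\<psi> f = ev d (\<lambda>g. \<psi> (letter g)) f"
proof -
  let ?\<phi> = "\<lambda>g. \<psi> (letter g)"
  show g: "gens_in d ?\<phi>" using assms by (simp add: alg_hom_def gens_in_def)
  have one: "\<psi> 1 = 1\<^sub>m d"
  proof -
    have "\<psi> (sc 1) = 1 \<cdot>\<^sub>m 1\<^sub>m d" using assms by (simp add: alg_hom_def del: sc_one)
    then show ?thesis by simp
  qed
  have zeroD: "\<psi> 0 = 0\<^sub>m d d"
  proof -
    have "sc 0 = (0 :: 'a falg)" by (simp add: sc_def)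
    then have "\<psi> 0 = 0 \<cdot>\<^sub>m 1\<^sub>m d" using assms unfolding alg_hom_def by metis
    then show ?thesis by (intro eq_matI) auto
  qed
  have w: "\<psi> (prod_list (map letter gs)) = ev d ?\<phi> (prod_list (map letter gs))" for gs
    by (induction gs) (use assms in \<open>simp_all add: one ev_one[OF g] ev_mult[OF g] ev_letter[OF g] alg_hom_def\<close>)
  show "\<psi> f = ev d ?\<phi> f"
  proof (induction f rule: poly_mapping_single_induct)
    case zero
    show ?case by (simp add: zeroD)
  next
    case (single u c)
    obtain gs where u: "u = Word gs" by (cases u)
    show ?case using assms by (simp add: u single_Word w ev_mult[OF g] ev_sc[OF g] alg_hom_def)
  next
    case (add f g)
    then show ?case using assms by (simp add: alg_hom_def ev_add)
  qed
qed

lemma wmat_intertwine: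
  assumes "gens_in d \<phi>" "gens_in e \<phi>'" "P \<in> carrier_mat e d" "\<And>g. P * \<phi> g = \<phi>' g * P"
  shows "P * wmat d \<phi> w = wmat e \<phi>' w * P"
proof -
  have "P * foldr (\<lambda>g M. \<phi> g * M) gs (1\<^sub>m d) = foldr (\<lambda>g M. \<phi>' g * M) gs (1\<^sub>m e) * P" for gs
  proof (induction gs)
    case Nil
    then show ?case using assms by simp
  next
    case (Cons g gs)
    let ?M = "foldr (\<lambda>g M. \<phi> g * M) gs (1\<^sub>m d)" and ?M' = "foldr (\<lambda>g M. \<phi>' g * M) gs (1\<^sub>m e)"
    have c: "\<phi> g \<in> carrier_mat d d" "\<phi>' g \<in> carrier_mat e e" "?M \<in> carrier_mat d d" "?M' \<in> carrier_mat e e"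
      using assms foldr_carrier gens_inD by blast+
    have "P * (\<phi> g * ?M) = (P * \<phi> g) * ?M"
      using assoc_mult_mat[OF assms(3) c(1) c(3)] by simp
    also have "\<dots> = \<phi>' g * (P * ?M)"
      using assoc_mult_mat[OF c(2) assms(3) c(3)] assms(4) by simp
    also have "\<dots> = (\<phi>' g * ?M') * P"
      using assoc_mult_mat[OF c(2) c(4) assms(3)] Cons by simp
    finally show ?case by simp
  qed
  then show ?thesis by (simp add: wmat_def)
qed

lemma ev_intertwine:
  assumes "gens_in d \<phi>" "gens_in e \<phi>'" "P \<in> carrier_mat e d" "\<And>g. P * \<phi> g = \<phi>' g * P"
  shows "P * ev d \<phi> f = ev e \<phi>' f * P"
  unfolding ev_def by (rule lin_ext_intertwine) (use assms wmat_carrier wmat_intertwine in blast)+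

lemma wmat_block_sum:
  assumes "gens_in d \<phi>" "gens_in e \<phi>'"
  shows "wmat (d + e) (\<lambda>g. block_sum (\<phi> g) (\<phi>' g)) w = block_sum (wmat d \<phi> w) (wmat e \<phi>' w)"
proof -
  have "foldr (\<lambda>g M. block_sum (\<phi> g) (\<phi>' g) * M) gs (1\<^sub>m (d + e))
     = block_sum (foldr (\<lambda>g M. \<phi> g * M) gs (1\<^sub>m d)) (foldr (\<lambda>g M. \<phi>' g * M) gs (1\<^sub>m e))" for gs
  proof (induction gs)
    case Nil
    show ?case by (simp add: block_sum_def)
  next
    case (Cons g gs)
    then show ?case
      by (simp add: block_sum_mult[OF gens_inD[OF assms(1)] gens_inD[OF assms(2)]
            foldr_carrier[OF assms(1)] foldr_carrier[OF assms(2)]])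
  qed
  then show ?thesis by (simp add: wmat_def)
qed

lemma ev_block_sum:
  assumes "gens_in d \<phi>" "gens_in e \<phi>'"
  shows "ev (d + e) (\<lambda>g. block_sum (\<phi> g) (\<phi>' g)) f = block_sum (ev d \<phi> f) (ev e \<phi>' f)"
  unfolding ev_def wmat_block_sum[OF assms, abs_def]
  by (rule lin_ext_block_sum) (use assms wmat_carrier in blast)+

section \<open>Kronecker products\<close>

lemma kronecker_dim [simp]:
  "dim_row (kronecker A B) = dim_row A * dim_row B" "dim_col (kronecker A B) = dim_col A * dim_col B"
  by (simp_all add: kronecker_def)

lemma kronecker_carrier:
  "A \<in> carrier_mat a b \<Longrightarrow> B \<in> carrier_mat c d \<Longrightarrow> kronecker A B \<in> carrier_mat (a * c) (b * d)"
  by (auto simp: kronecker_def)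

lemma kronecker_index:
  "r < dim_row A * dim_row B \<Longrightarrow> c < dim_col A * dim_col B \<Longrightarrow> kronecker A B $$ (r, c)
     = A $$ (r div dim_row B, c div dim_col B) * B $$ (r mod dim_row B, c mod dim_col B)"
  by (simp add: kronecker_def)

lemma div_mod_less:
  fixes r a b :: nat
  assumes "r < a * b"
  shows "r div b < a" "r mod b < b"
proof -
  have "b > 0" using assms by (cases b) auto
  then show "r mod b < b" by simp
  show "r div b < a" using assms by (simp add: less_mult_imp_div_less)
qed

text \<open>
  The index of a Kronecker product is the pair of its quotient and its remainder.
\<close>

lemma sum_div_mod:
  fixes f :: "nat \<Rightarrow> nat \<Rightarrow> 'a::comm_monoid_add"
  shows "(\<Sum>r<a * b. f (r div b) (r mod b)) = (\<Sum>i<a. \<Sum>j<b. f i j)"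
proof -
  have "(\<Sum>i<a. \<Sum>j<b. f i j) = (\<Sum>(i, j)\<in>{..<a} \<times> {..<b}. f i j)"
    by (simp add: sum.cartesian_product)
  also have "\<dots> = (\<Sum>r<a * b. f (r div b) (r mod b))"
  proof (rule sum.reindex_bij_witness[where i = "\<lambda>r. (r div b, r mod b)" and j = "\<lambda>(i, j). i * b + j"])
    fix x assume x: "x \<in> {..<a} \<times> {..<b}"
    obtain i j where ij: "x = (i, j)" "i < a" "j < b" using x by auto
    then have "i * b + j < (i + 1) * b" by simp
    also have "\<dots> \<le> a * b" using ij by (intro mult_right_mono) auto
    finally show "(case x of (i, j) \<Rightarrow> i * b + j) \<in> {..<a * b}" using ij by simp
  qed (auto dest: div_mod_less simp: less_mult_imp_div_less)
  finally show ?thesis by simp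
qed

lemma kronecker_mult:
  assumes "A \<in> carrier_mat a b" "B \<in> carrier_mat b c" "A' \<in> carrier_mat a' b'" "B' \<in> carrier_mat b' c'"
  shows "kronecker (A * B) (A' * B') = kronecker A A' * kronecker B B'"
proof (rule eq_matI)
  fix i j assume "i < dim_row (kronecker A A' * kronecker B B')" "j < dim_col (kronecker A A' * kronecker B B')"
  then have ij: "i < a * a'" "j < c * c'" using assms by auto
  note bd = div_mod_less[OF ij(1)] div_mod_less[OF ij(2)]
  have "(kronecker A A' * kronecker B B') $$ (i, j)
      = (\<Sum>r<b * b'. kronecker A A' $$ (i, r) * kronecker B B' $$ (r, j))"
    using assms ij by (simp add: scalar_prod_def lessThan_atLeast0)
  also have "\<dots> = (\<Sum>r<b * b'. A $$ (i div a', r div b') * A' $$ (i mod a', r mod b')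
      * (B $$ (r div b', j div c') * B' $$ (r mod b', j mod c')))"
    by (rule sum.cong) (use assms ij in \<open>auto simp: kronecker_index\<close>)
  also have "\<dots> = (\<Sum>r<b. \<Sum>s<b'. A $$ (i div a', r) * A' $$ (i mod a', s)
      * (B $$ (r, j div c') * B' $$ (s, j mod c')))"
    by (rule sum_div_mod)
  also have "\<dots> = (\<Sum>r<b. A $$ (i div a', r) * B $$ (r, j div c'))
      * (\<Sum>s<b'. A' $$ (i mod a', s) * B' $$ (s, j mod c'))"
    unfolding sum_product by (intro sum.cong refl) (simp add: mult_ac)
  also have "\<dots> = kronecker (A * B) (A' * B') $$ (i, j)"
    using assms ij bd by (simp add: kronecker_index scalar_prod_def lessThan_atLeast0)
  finally show "kronecker (A * B) (A' * B') $$ (i, j) = (kronecker A A' * kronecker B B') $$ (i, j)" by simp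
qed (use assms in auto)

lemma kronecker_one: "kronecker (1\<^sub>m a) (1\<^sub>m b) = 1\<^sub>m (a * b)"
proof (rule eq_matI)
  fix i j assume "i < dim_row (1\<^sub>m (a * b) :: 'a mat)" "j < dim_col (1\<^sub>m (a * b) :: 'a mat)"
  then have ij: "i < a * b" "j < a * b" by auto
  have "i = j" if "i div b = j div b" "i mod b = j mod b"
    using that by (metis div_mult_mod_eq)
  then show "kronecker (1\<^sub>m a) (1\<^sub>m b) $$ (i, j) = 1\<^sub>m (a * b) $$ (i, j)"
    using ij div_mod_less[OF ij(1)] div_mod_less[OF ij(2)] by (auto simp: kronecker_index)
qed auto

lemma monoid_rep_kronecker:
  assumes "monoid_rep d G" "monoid_rep e G'"
  shows "monoid_rep (d * e) (\<lambda>(u, v). kronecker (G u) (G' v))"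
  using assms unfolding monoid_rep_def
  by (auto simp: kronecker_carrier zero_prod_def kronecker_one kronecker_mult[of _ d d _ d _ e e _ e])

section \<open>Homomorphisms on free algebras\<close>

lemma sc_mult: "sc c * sc d = (sc (c * d) :: 'm::monoid_add \<Rightarrow>\<^sub>0 'k::field)"
  by (simp add: sc_def mult_single)

lemma sc_add: "sc (c + d) = (sc c + sc d :: 'm::monoid_add \<Rightarrow>\<^sub>0 'k::field)"
  by (simp add: sc_def single_add)

lemma sc_zero [simp]: "sc 0 = (0 :: 'm::monoid_add \<Rightarrow>\<^sub>0 'k::field)"
  by (simp add: sc_def)

lemma sc_commute: "sc c * f = f * (sc c :: 'm::monoid_add \<Rightarrow>\<^sub>0 'k::field)"
  by (induction f rule: poly_mapping_single_induct)
     (simp_all add: sc_def mult_single algebra_simps mult.commute)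

text \<open>
  The homomorphism property needs the scalars to be central in the target, which may be
  noncommutative.
\<close>

context
  fixes \<eta> :: "'k::field \<Rightarrow> 'a::ring_1" and \<phi> :: "gen \<Rightarrow> 'a"
  assumes \<eta>_add: "\<And>c d. \<eta> (c + d) = \<eta> c + \<eta> d" and \<eta>_mult: "\<And>c d. \<eta> (c * d) = \<eta> c * \<eta> d"
    and \<eta>_one: "\<eta> 1 = 1" and \<eta>_central: "\<And>c x. \<eta> c * x = x * \<eta> c"
begin

lemma \<eta>_zero: "\<eta> 0 = 0"
  using \<eta>_add[of 0 0] by simp

lemma free_hom_superset:
  assumes "finite A" "Poly_Mapping.keys f \<subseteq> A"
  shows "free_hom \<eta> \<phi> f = (\<Sum>w\<in>A. \<eta> (Poly_Mapping.lookup f w) * prod_list (map \<phi> (letters w)))"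
  unfolding free_hom_def
  by (rule sum.mono_neutral_left) (use assms in \<open>auto simp: in_keys_iff \<eta>_zero\<close>)

lemma free_hom_zero: "free_hom \<eta> \<phi> 0 = 0"
  by (simp add: free_hom_def)

lemma free_hom_add: "free_hom \<eta> \<phi> (f + g) = free_hom \<eta> \<phi> f + free_hom \<eta> \<phi> g"
proof -
  let ?A = "Poly_Mapping.keys f \<union> Poly_Mapping.keys g"
  have A: "finite ?A" by simp
  have "Poly_Mapping.keys (f + g) \<subseteq> ?A" by (rule Poly_Mapping.keys_add)
  then show ?thesis
    by (simp add: free_hom_superset[OF A] lookup_add sum.distrib \<eta>_add algebra_simps)
qed

lemma free_hom_single: "free_hom \<eta> \<phi> (Poly_Mapping.single u c) = \<eta> c * prod_list (map \<phi> (letters u))"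
  by (simp add: free_hom_def \<eta>_zero)

lemma free_hom_mult: "free_hom \<eta> \<phi> (f * g) = free_hom \<eta> \<phi> f * free_hom \<eta> \<phi> g"
proof (induction f rule: poly_mapping_single_induct)
  case (single u c)
  show ?case
  proof (induction g rule: poly_mapping_single_induct)
    case (single v d)
    let ?p = "\<lambda>u. prod_list (map \<phi> (letters u))"
    have "\<eta> c * ?p u * (\<eta> d * ?p v) = \<eta> c * (?p u * \<eta> d) * ?p v" by (simp add: mult.assoc)
    also have "\<dots> = \<eta> c * (\<eta> d * ?p u) * ?p v" by (simp add: \<eta>_central)
    finally show ?case by (simp add: mult_single free_hom_single \<eta>_mult plus_word_def mult.assoc)
  qed (simp_all add: free_hom_zero free_hom_add distrib_left)
qed (simp_all add: free_hom_zero free_hom_add distrib_right)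

lemma free_hom_sc: "free_hom \<eta> \<phi> (sc c) = \<eta> c"
  by (simp add: sc_def free_hom_single zero_word_def)

lemma free_hom_letter: "free_hom \<eta> \<phi> (letter g) = \<phi> g"
  by (simp add: letter_def free_hom_single \<eta>_one)

end

section \<open>The algebra as a quotient of the free algebra\<close>

lemma ring_type_algebra_simps [simp]:
  "carrier ring_of_type_algebra = UNIV" "monoid.mult ring_of_type_algebra = (*)"
  "monoid.one ring_of_type_algebra = 1" "ring.zero ring_of_type_algebra = 0"
  "ring.add ring_of_type_algebra = (+)"
  by (simp_all add: ring_of_type_algebra_def fun_eq_iff)

lemma ring_type_algebra: "ring (ring_of_type_algebra :: 'a::ring_1 ring)"
proof -
  have "\<exists>y. y + x = 0 \<and> x + y = 0" for x :: 'a
    by (rule exI[of _ "- x"]) simp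
  then show ?thesis
    by unfold_locales (auto simp: algebra_simps Units_def)
qed

lemma a_inv_type_algebra: "a_inv ring_of_type_algebra x = - (x :: 'a::ring_1)"
proof -
  interpret ring "ring_of_type_algebra :: 'a ring" by (rule ring_type_algebra)
  show ?thesis by (rule minus_equality) simp_all
qed

lemma ideal_type_algebraI:
  fixes I :: "'a::ring_1 set"
  assumes "0 \<in> I" "\<And>a b. a \<in> I \<Longrightarrow> b \<in> I \<Longrightarrow> a + b \<in> I" "\<And>a b. a \<in> I \<Longrightarrow> b * a \<in> I"
    "\<And>a b. a \<in> I \<Longrightarrow> a * b \<in> I"
  shows "ideal I ring_of_type_algebra"
proof (rule idealI)
  show "ring (ring_of_type_algebra :: 'a ring)" by (rule ring_type_algebra)
  show "subgroup I (add_monoid ring_of_type_algebra)"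
  proof
    fix x assume "x \<in> I"
    then have "- 1 * x \<in> I" by (rule assms(3))
    then show "inv\<^bsub>add_monoid ring_of_type_algebra\<^esub> x \<in> I"
      using a_inv_type_algebra[of x] by (simp add: a_inv_def)
  qed (use assms in auto)
qed (use assms in auto)

lemma ideal_type_algebraD:
  fixes I :: "'a::ring_1 set"
  assumes "ideal I ring_of_type_algebra"
  shows "0 \<in> I" "a \<in> I \<Longrightarrow> b \<in> I \<Longrightarrow> a + b \<in> I" "a \<in> I \<Longrightarrow> b * a \<in> I"
    "a \<in> I \<Longrightarrow> a * b \<in> I" "a \<in> I \<Longrightarrow> - a \<in> I" "a \<in> I \<Longrightarrow> b \<in> I \<Longrightarrow> a - b \<in> I"
proof -
  interpret ideal I ring_of_type_algebra by fact
  show z: "0 \<in> I" using additive_subgroup.zero_closed[OF is_additive_subgroup] by simp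
  show add: "a \<in> I \<Longrightarrow> b \<in> I \<Longrightarrow> a + b \<in> I" for a b using additive_subgroup.a_closed[OF is_additive_subgroup, of a b] by simp
  show l: "a \<in> I \<Longrightarrow> b * a \<in> I" for a b using I_l_closed[of a b] by simp
  show "a \<in> I \<Longrightarrow> a * b \<in> I" using I_r_closed[of a b] by simp
  show m: "a \<in> I \<Longrightarrow> - a \<in> I" for a using l[of a "- 1"] by simp
  show "a \<in> I \<Longrightarrow> b \<in> I \<Longrightarrow> a - b \<in> I" using add[of a "- b"] m[of b] by simp
qed

lemma coset_type_algebra: "g \<in> I +>\<^bsub>ring_of_type_algebra\<^esub> f \<longleftrightarrow> g - f \<in> I" for f :: "'a::ring_1"
  by (force simp: a_r_coset_def r_coset_def)

lemma ideal_genideal_type_algebra: "ideal (Idl\<^bsub>ring_of_type_algebra\<^esub> S) (ring_of_type_algebra :: 'a::ring_1 ring)"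
  by (rule ring.genideal_ideal[OF ring_type_algebra]) simp

lemma genideal_type_algebra_minimal:
  "ideal I ring_of_type_algebra \<Longrightarrow> S \<subseteq> I \<Longrightarrow> Idl\<^bsub>ring_of_type_algebra\<^esub> S \<subseteq> (I :: 'a::ring_1 set)"
  by (rule ring.genideal_minimal[OF ring_type_algebra])

lemma genideal_type_algebra_self: "s \<in> S \<Longrightarrow> (s :: 'a::ring_1) \<in> Idl\<^bsub>ring_of_type_algebra\<^esub> S"
  using ring.genideal_self[OF ring_type_algebra, of S] by auto

lemma ideal_H: "ideal (H_ideal n q) ring_of_type_algebra"
  unfolding H_ideal_def by (rule ideal_genideal_type_algebra)

lemma H_class_iff: "g \<in> H_class n q f \<longleftrightarrow> g - f \<in> H_ideal n q"
  unfolding H_class_def by (rule coset_type_algebra)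

lemma H_class_self: "f \<in> H_class n q f"
  by (simp add: H_class_iff ideal_type_algebraD(1)[OF ideal_H])

lemma H_class_eq_iff: "H_class n q f = H_class n q g \<longleftrightarrow> f - g \<in> H_ideal n q"
proof
  assume "H_class n q f = H_class n q g"
  then have "f \<in> H_class n q g" using H_class_self[of f n q] by simp
  then show "f - g \<in> H_ideal n q" by (simp add: H_class_iff)
next
  assume fg: "f - g \<in> H_ideal n q"
  have "h - f \<in> H_ideal n q \<longleftrightarrow> h - g \<in> H_ideal n q" for h
    using ideal_type_algebraD(2)[OF ideal_H, of "h - f" n q "f - g"]
      ideal_type_algebraD(6)[OF ideal_H, of "h - g" n q "f - g"] fg by auto
  then show "H_class n q f = H_class n q g"
    by (auto simp: H_class_iff)
qed

lemma carrier_H: "carrier (H n q) = range (H_class n q)"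
  by (auto simp: H_def FactRing_def A_RCOSETS_def RCOSETS_def H_class_def a_r_coset_def)

lemma H_class_hom: "H_class n q \<in> Ring.ring_hom ring_of_type_algebra (H n q)"
  unfolding H_class_def H_def by (rule ideal.rcos_ring_hom[OF ideal_H])

lemma H_class_mult: "H_class n q f \<otimes>\<^bsub>H n q\<^esub> H_class n q g = H_class n q (f * g)"
  using ring_hom_mult[OF H_class_hom, of f g n q] by simp

lemma H_class_add: "H_class n q f \<oplus>\<^bsub>H n q\<^esub> H_class n q g = H_class n q (f + g)"
  using ring_hom_add[OF H_class_hom, of f g n q] by simp

lemma H_class_one: "\<one>\<^bsub>H n q\<^esub> = H_class n q 1"
  using ring_hom_one[OF H_class_hom, of n q] by simp

lemma H_smult_class: "H_smult n q c (H_class n q f) = H_class n q (sc c * f)"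
  by (simp add: H_smult_def H_class_mult)

section \<open>Representations by generators\<close>

lemma mult_assoc_dim:
  "dim_col A = dim_row B \<Longrightarrow> dim_col B = dim_row C \<Longrightarrow> (A * B) * C = A * (B * C :: 'a::semiring_0 mat)"
  by (rule assoc_mult_mat[of _ "dim_row A" "dim_col A" _ "dim_col B" _ "dim_col C"]) auto

lemma one_mult_dim [simp]: "dim_row A = d \<Longrightarrow> 1\<^sub>m d * A = (A :: 'a::semiring_1 mat)"
  by (rule left_mult_one_mat[of _ d "dim_col A"]) auto

lemma mult_one_dim [simp]: "dim_col A = d \<Longrightarrow> A * 1\<^sub>m d = (A :: 'a::semiring_1 mat)"
  by (rule right_mult_one_mat[of _ "dim_row A" d]) auto

type_synonym 'k rep = "nat \<times> (gen \<Rightarrow> 'k mat)"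

definition act :: "'k::field rep \<Rightarrow> 'k falg \<Rightarrow> 'k mat" where
  "act R = ev (fst R) (snd R)"

definition is_rep :: "nat \<Rightarrow> 'k::field \<Rightarrow> 'k rep \<Rightarrow> bool" where
  "is_rep n q R \<longleftrightarrow> gens_in (fst R) (snd R) \<and> (\<forall>r\<in>relators n q. act R r = 0\<^sub>m (fst R) (fst R))"

definition rep_iso :: "'k::field rep \<Rightarrow> 'k rep \<Rightarrow> bool" where
  "rep_iso R S \<longleftrightarrow> (\<exists>P\<in>carrier_mat (fst S) (fst R). \<exists>Q\<in>carrier_mat (fst R) (fst S).
     P * Q = 1\<^sub>m (fst S) \<and> Q * P = 1\<^sub>m (fst R) \<and> (\<forall>g. P * snd R g = snd S g * P))"

definition rep_sum :: "'k::field rep \<Rightarrow> 'k rep \<Rightarrow> 'k rep" where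
  "rep_sum R S = (fst R + fst S, \<lambda>g. block_sum (snd R g) (snd S g))"

definition word_kron :: "'k::field rep \<Rightarrow> 'k rep \<Rightarrow> word \<times> word \<Rightarrow> 'k mat" where
  "word_kron R S = (\<lambda>(u, v). kronecker (wmat (fst R) (snd R) u) (wmat (fst S) (snd S) v))"

definition act2_rep :: "'k::field rep \<Rightarrow> 'k rep \<Rightarrow> 'k falg2 \<Rightarrow> 'k mat" where
  "act2_rep R S = lin_ext (fst R * fst S) (word_kron R S)"

text \<open>
  The letters act through their comultiplications, taken in the tensor square of the free algebra.
  Thus the tensor product is defined before it is known that the relations hold on it.
\<close>

definition rep_tensor :: "nat \<Rightarrow> 'k::field \<Rightarrow> 'k rep \<Rightarrow> 'k rep \<Rightarrow> 'k rep" where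
  "rep_tensor n q R S = (fst R * fst S, \<lambda>g. act2_rep R S (comult_gen n q g))"

definition rep_of :: "nat \<Rightarrow> 'k::field \<Rightarrow> 'k hmod \<Rightarrow> 'k rep" where
  "rep_of n q M = (fst M, \<lambda>g. snd M (H_class n q (letter g)))"

definition hmod_of :: "'k::field rep \<Rightarrow> 'k hmod" where
  "hmod_of R = (fst R, \<lambda>h. act R (SOME f. f \<in> h))"

abbreviation gens_ok :: "'k::field rep \<Rightarrow> bool" where
  "gens_ok R \<equiv> gens_in (fst R) (snd R)"

lemma is_rep_gens: "is_rep n q R \<Longrightarrow> gens_ok R"
  by (simp add: is_rep_def)

lemma act_carrier [simp]: "act R f \<in> carrier_mat (fst R) (fst R)"
  by (simp add: act_def)

lemma act_dim [simp]: "dim_row (act R f) = fst R" "dim_col (act R f) = fst R"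
  by (simp_all add: act_def)

text \<open>
  The elements acting as zero form a two-sided ideal, so it suffices that the six relators do.
\<close>

lemma is_rep_act_ideal:
  assumes "is_rep n q R" "f \<in> H_ideal n q"
  shows "act R f = 0\<^sub>m (fst R) (fst R)"
proof -
  let ?d = "fst R" and ?I = "{f. act R f = 0\<^sub>m (fst R) (fst R)}"
  have g: "gens_ok R" using assms(1) by (rule is_rep_gens)
  have "ideal ?I ring_of_type_algebra"
    by (rule ideal_type_algebraI)
       (simp_all add: act_def ev_add ev_mult[OF g] right_mult_zero_mat[of _ ?d ?d] left_mult_zero_mat[of _ ?d ?d])
  moreover have "relators n q \<subseteq> ?I" using assms(1) by (auto simp: is_rep_def)
  ultimately have "H_ideal n q \<subseteq> ?I" unfolding H_ideal_def by (rule genideal_type_algebra_minimal)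
  then show ?thesis using assms(2) by auto
qed

lemma is_rep_act_class:
  assumes "is_rep n q R" "g \<in> H_class n q f"
  shows "act R g = act R f"
proof -
  have "act R (g - f) = 0\<^sub>m (fst R) (fst R)"
    using is_rep_act_ideal[OF assms(1)] assms(2) by (simp add: H_class_iff)
  then show ?thesis using ev_eq_iff[OF is_rep_gens[OF assms(1)]] by (simp add: act_def)
qed

text \<open>
  A module pulls back along \<open>F \<rightarrow> H\<close> to an algebra homomorphism on the
  free algebra; by \<open>alg_hom_unique\<close> it is determined by three matrices.
\<close>

lemma is_hmod_alg_hom:
  assumes "is_hmod n q M"
  shows "alg_hom (fst M) (\<lambda>f. snd M (H_class n q f))"
proof -
  obtain d \<rho> where M: "M = (d, \<rho>)" by (cases M)
  have hom: "\<rho> \<in> Ring.ring_hom (H n q) (ring_mat TYPE('a) d ())"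
    and sm: "\<And>c h. h \<in> carrier (H n q) \<Longrightarrow> \<rho> (H_smult n q c h) = c \<cdot>\<^sub>m \<rho> h"
    using assms by (auto simp: is_hmod_def M)
  have c: "H_class n q f \<in> carrier (H n q)" for f by (simp add: carrier_H)
  have one: "\<rho> (H_class n q 1) = 1\<^sub>m d"
    using ring_hom_one[OF hom] by (simp add: H_class_one ring_mat_simps)
  have "\<rho> (H_class n q (sc a)) = a \<cdot>\<^sub>m 1\<^sub>m d" for a
    using sm[OF c[of 1], of a] by (simp add: H_smult_class one)
  then show ?thesis
    using ring_hom_closed[OF hom c] ring_hom_add[OF hom c c] ring_hom_mult[OF hom c c]
    by (simp add: alg_hom_def M ring_mat_simps H_class_add H_class_mult)
qed

lemma hmod_act:
  assumes "is_hmod n q M"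
  shows "snd M (H_class n q f) = act (rep_of n q M) f"
  using alg_hom_unique(2)[OF is_hmod_alg_hom[OF assms], of f] by (simp add: act_def rep_of_def)

lemma is_rep_rep_of:
  assumes "is_hmod n q M"
  shows "is_rep n q (rep_of n q M)"
proof -
  have "act (rep_of n q M) r = 0\<^sub>m (fst M) (fst M)" if "r \<in> relators n q" for r
  proof -
    have "r \<in> H_ideal n q" unfolding H_ideal_def using that by (rule genideal_type_algebra_self)
    then have "H_class n q r = H_class n q 0" by (simp add: H_class_eq_iff)
    then have "act (rep_of n q M) r = act (rep_of n q M) 0"
      using hmod_act[OF assms, of r] hmod_act[OF assms, of 0] by simp
    then show ?thesis by (simp add: act_def) (simp add: rep_of_def)
  qed
  then show ?thesis
    using alg_hom_unique(1)[OF is_hmod_alg_hom[OF assms]] by (simp add: is_rep_def rep_of_def)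
qed

lemma is_hmodI:
  assumes "gens_ok R" "fst M = fst R" "\<And>f. snd M (H_class n q f) = act R f"
  shows "is_hmod n q M" and "rep_of n q M = R"
proof -
  obtain d \<rho> where M: "M = (d, \<rho>)" by (cases M)
  have act: "\<rho> (H_class n q f) = ev d (snd R) f" for f using assms by (simp add: M act_def)
  have g: "gens_in d (snd R)" using assms by (simp add: M)
  have "\<rho> \<in> Ring.ring_hom (H n q) (ring_mat TYPE('a) d ())"
    by (rule ring_hom_memI)
       (auto simp: carrier_H H_class_mult H_class_add H_class_one act ring_mat_simps ev_add ev_mult[OF g] ev_one[OF g])
  then show "is_hmod n q M"
    by (auto simp: is_hmod_def M carrier_H H_smult_class act ev_sc_mult[OF g])
  show "rep_of n q M = R"
    using g by (simp add: rep_of_def prod_eq_iff M act ev_letter[OF g]) (use assms in \<open>simp add: M\<close>)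
qed

lemma hmod_of_act:
  assumes "is_rep n q R"
  shows "snd (hmod_of R) (H_class n q f) = act R f"
proof -
  have "(SOME g. g \<in> H_class n q f) \<in> H_class n q f" by (rule someI, rule H_class_self)
  then show ?thesis by (simp add: hmod_of_def is_rep_act_class[OF assms])
qed

lemma is_hmod_hmod_of:
  assumes "is_rep n q R"
  shows "is_hmod n q (hmod_of R)" "rep_of n q (hmod_of R) = R"
  by (rule is_hmodI[OF is_rep_gens[OF assms] _ hmod_of_act[OF assms]], simp add: hmod_of_def)+

lemma act_intertwine:
  assumes "gens_ok R" "gens_ok S" "P \<in> carrier_mat (fst S) (fst R)" "\<And>g. P * snd R g = snd S g * P"
  shows "P * act R f = act S f * P"
  unfolding act_def by (rule ev_intertwine) (use assms in auto)

lemma fst_rep_of [simp]: "fst (rep_of n q M) = fst M"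
  by (simp add: rep_of_def)

text \<open>
  An intertwiner of the generators intertwines every element, so isomorphism can be tested on
  three matrices.
\<close>

lemma hmod_iso_iff:
  assumes "is_hmod n q M" "is_hmod n q N"
  shows "hmod_iso n q M N \<longleftrightarrow> rep_iso (rep_of n q M) (rep_of n q N)"
proof -
  let ?R = "rep_of n q M" and ?S = "rep_of n q N"
  have g: "gens_ok ?R" "gens_ok ?S" using assms by (blast intro: is_rep_gens is_rep_rep_of)+
  have "(\<forall>h\<in>carrier (H n q). P * snd M h = snd N h * P) \<longleftrightarrow> (\<forall>g. P * snd ?R g = snd ?S g * P)"
    if "P \<in> carrier_mat (fst N) (fst M)" for P
  proof
    assume "\<forall>h\<in>carrier (H n q). P * snd M h = snd N h * P"
    then show "\<forall>g. P * snd ?R g = snd ?S g * P" by (simp add: rep_of_def carrier_H)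
  next
    assume "\<forall>g. P * snd ?R g = snd ?S g * P"
    then show "\<forall>h\<in>carrier (H n q). P * snd M h = snd N h * P"
      using act_intertwine[OF g] that by (auto simp: carrier_H hmod_act[OF assms(1)] hmod_act[OF assms(2)])
  qed
  then show ?thesis by (simp add: hmod_iso_def rep_iso_def case_prod_beta cong: bex_cong)
qed

lemma rep_iso_refl: "gens_ok R \<Longrightarrow> rep_iso R R"
  unfolding rep_iso_def
  by (intro bexI[of _ "1\<^sub>m (fst R)"])
     (auto simp: carrier_matD(1)[OF gens_inD] carrier_matD(2)[OF gens_inD])

lemma rep_iso_sym:
  assumes "gens_ok R" "gens_ok S" "rep_iso R S"
  shows "rep_iso S R"
proof -
  obtain P Q where PQ: "P \<in> carrier_mat (fst S) (fst R)" "Q \<in> carrier_mat (fst R) (fst S)"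
    "P * Q = 1\<^sub>m (fst S)" "Q * P = 1\<^sub>m (fst R)" "\<And>g. P * snd R g = snd S g * P"
    using assms(3) by (auto simp: rep_iso_def)
  have "Q * snd S g = snd R g * Q" for g
  proof -
    note c = gens_inD[OF assms(1), of g] gens_inD[OF assms(2), of g]
    have "Q * snd S g = Q * snd S g * (P * Q)" using PQ c by simp
    also have "\<dots> = Q * (snd S g * P) * Q" using PQ(1,2) c unfolding carrier_mat_def by (simp add: mult_assoc_dim)
    also have "\<dots> = Q * (P * snd R g) * Q" by (simp add: PQ)
    also have "\<dots> = (Q * P) * snd R g * Q" using PQ(1,2) c unfolding carrier_mat_def by (simp add: mult_assoc_dim)
    also have "\<dots> = snd R g * Q" using PQ(4) c by simp
    finally show ?thesis .
  qed
  then show ?thesis using PQ unfolding rep_iso_def by blast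
qed

lemma rep_iso_trans:
  assumes "gens_ok R" "gens_ok S" "gens_ok T" "rep_iso R S" "rep_iso S T"
  shows "rep_iso R T"
proof -
  obtain P Q where PQ: "P \<in> carrier_mat (fst S) (fst R)" "Q \<in> carrier_mat (fst R) (fst S)"
    "P * Q = 1\<^sub>m (fst S)" "Q * P = 1\<^sub>m (fst R)" "\<And>g. P * snd R g = snd S g * P"
    using assms(4) by (auto simp: rep_iso_def)
  obtain P' Q' where PQ': "P' \<in> carrier_mat (fst T) (fst S)" "Q' \<in> carrier_mat (fst S) (fst T)"
    "P' * Q' = 1\<^sub>m (fst T)" "Q' * P' = 1\<^sub>m (fst S)" "\<And>g. P' * snd S g = snd T g * P'"
    using assms(5) by (auto simp: rep_iso_def)
  have "P' * P * (Q * Q') = P' * (P * Q) * Q'"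
    using PQ(1,2) PQ'(1,2) unfolding carrier_mat_def by (simp add: mult_assoc_dim)
  then have 1: "P' * P * (Q * Q') = 1\<^sub>m (fst T)" using PQ PQ' by simp
  have "Q * Q' * (P' * P) = Q * (Q' * P') * P"
    using PQ(1,2) PQ'(1,2) unfolding carrier_mat_def by (simp add: mult_assoc_dim)
  then have 2: "Q * Q' * (P' * P) = 1\<^sub>m (fst R)" using PQ PQ' by simp
  have 3: "P' * P * snd R g = snd T g * (P' * P)" for g
  proof -
    note c = gens_inD[OF assms(1), of g] gens_inD[OF assms(2), of g] gens_inD[OF assms(3), of g]
    have "P' * P * snd R g = P' * (P * snd R g)" using PQ PQ' c unfolding carrier_mat_def by (simp add: mult_assoc_dim)
    also have "\<dots> = (P' * snd S g) * P" using PQ(1) PQ'(1) c PQ(5) unfolding carrier_mat_def by (simp add: mult_assoc_dim)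
    also have "\<dots> = snd T g * (P' * P)" using PQ(1) PQ'(1) c PQ'(5) unfolding carrier_mat_def by (simp add: mult_assoc_dim)
    finally show ?thesis .
  qed
  show ?thesis unfolding rep_iso_def
    using 1 2 3 PQ(1,2) PQ'(1,2) by (intro bexI[of _ "P' * P"] bexI[of _ "Q * Q'"]) auto
qed

lemma is_rep_iso:
  assumes "is_rep n q R" "gens_ok S" "rep_iso R S"
  shows "is_rep n q S"
proof -
  obtain P Q where PQ: "P \<in> carrier_mat (fst S) (fst R)" "Q \<in> carrier_mat (fst R) (fst S)"
    "P * Q = 1\<^sub>m (fst S)" "Q * P = 1\<^sub>m (fst R)" "\<And>g. P * snd R g = snd S g * P"
    using assms(3) by (auto simp: rep_iso_def)
  have "act S r = 0\<^sub>m (fst S) (fst S)" if r: "r \<in> relators n q" for r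
  proof -
    have "act S r = act S r * (P * Q)" using PQ(3) by simp
    also have "\<dots> = (act S r * P) * Q" using PQ(1,2) unfolding carrier_mat_def by (simp add: mult_assoc_dim)
    also have "act S r * P = P * act R r"
      using act_intertwine[OF is_rep_gens[OF assms(1)] assms(2) PQ(1) PQ(5)] by simp
    also have "act R r = 0\<^sub>m (fst R) (fst R)" using assms(1) r by (simp add: is_rep_def)
    finally show ?thesis using PQ(1,2) by simp
  qed
  then show ?thesis using assms(2) by (simp add: is_rep_def)
qed

lemma gens_ok_sum: "gens_ok R \<Longrightarrow> gens_ok S \<Longrightarrow> gens_ok (rep_sum R S)"
  by (auto simp: gens_in_def rep_sum_def)

lemma fst_rep_sum [simp]: "fst (rep_sum R S) = fst R + fst S"
  by (simp add: rep_sum_def)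

lemma act_sum: "gens_ok R \<Longrightarrow> gens_ok S \<Longrightarrow> act (rep_sum R S) f = block_sum (act R f) (act S f)"
  unfolding act_def rep_sum_def by (simp add: ev_block_sum)

lemma block_sum_zero: "block_sum (0\<^sub>m a b) (0\<^sub>m c d) = 0\<^sub>m (a + c) (b + d)"
  by (simp add: block_sum_def)

lemma block_sum_one: "block_sum (1\<^sub>m a) (1\<^sub>m b) = 1\<^sub>m (a + b)"
  by (simp add: block_sum_def)

lemma is_rep_sum: "is_rep n q R \<Longrightarrow> is_rep n q S \<Longrightarrow> is_rep n q (rep_sum R S)"
  using gens_ok_sum[of R S] by (auto simp: is_rep_def act_sum block_sum_zero)

lemma rep_iso_sum:
  assumes "gens_ok R" "gens_ok S" "gens_ok R'" "gens_ok S'" "rep_iso R S" "rep_iso R' S'"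
  shows "rep_iso (rep_sum R R') (rep_sum S S')"
proof -
  obtain P Q where PQ: "P \<in> carrier_mat (fst S) (fst R)" "Q \<in> carrier_mat (fst R) (fst S)"
    "P * Q = 1\<^sub>m (fst S)" "Q * P = 1\<^sub>m (fst R)" "\<And>g. P * snd R g = snd S g * P"
    using assms(5) by (auto simp: rep_iso_def)
  obtain P' Q' where PQ': "P' \<in> carrier_mat (fst S') (fst R')" "Q' \<in> carrier_mat (fst R') (fst S')"
    "P' * Q' = 1\<^sub>m (fst S')" "Q' * P' = 1\<^sub>m (fst R')" "\<And>g. P' * snd R' g = snd S' g * P'"
    using assms(6) by (auto simp: rep_iso_def)
  show ?thesis unfolding rep_iso_def
    by (rule bexI[of _ "block_sum P P'"], rule bexI[of _ "block_sum Q Q'"])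
       (use PQ(1,2) PQ'(1,2) in \<open>auto simp: block_sum_mult[OF PQ(1) PQ'(1) PQ(2) PQ'(2)]
         block_sum_mult[OF PQ(2) PQ'(2) PQ(1) PQ'(1)] PQ(3,4) PQ'(3,4) block_sum_one rep_sum_def
         block_sum_mult[OF PQ(1) PQ'(1) gens_inD[OF assms(1)] gens_inD[OF assms(3)]]
         block_sum_mult[OF gens_inD[OF assms(2)] gens_inD[OF assms(4)] PQ(1) PQ'(1)] PQ(5) PQ'(5)\<close>)
qed

lemma hmod_sum_rep:
  assumes "is_hmod n q M" "is_hmod n q N"
  shows "is_hmod n q (hmod_sum M N)" "rep_of n q (hmod_sum M N) = rep_sum (rep_of n q M) (rep_of n q N)"
proof -
  let ?R = "rep_of n q M" and ?S = "rep_of n q N"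
  have g: "gens_ok ?R" "gens_ok ?S" using assms by (blast intro: is_rep_gens is_rep_rep_of)+
  have dims: "dim_row (act ?R f) = fst M" "dim_col (act ?R f) = fst M"
    "dim_row (act ?S f) = fst N" "dim_col (act ?S f) = fst N" for f
    using act_carrier[of ?R f] act_carrier[of ?S f] by auto
  have "snd (hmod_sum M N) (H_class n q f) = act (rep_sum ?R ?S) f" for f
    by (simp add: act_sum[OF g] hmod_sum_def case_prod_beta hmod_act[OF assms(1)] hmod_act[OF assms(2)]
        block_sum_def dims)
  note * = is_hmodI[OF gens_ok_sum[OF g] _ this]
  show "is_hmod n q (hmod_sum M N)" by (rule *) (simp add: hmod_sum_def case_prod_beta)
  show "rep_of n q (hmod_sum M N) = rep_sum ?R ?S" by (rule *) (simp add: hmod_sum_def case_prod_beta)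
qed

section \<open>Tensor products\<close>

lemma word_kron_carrier:
  "gens_ok R \<Longrightarrow> gens_ok S \<Longrightarrow> word_kron R S w \<in> carrier_mat (fst R * fst S) (fst R * fst S)"
  by (auto simp: word_kron_def intro!: kronecker_carrier wmat_carrier split: prod.split)

lemma act2_rep_carrier [simp]: "act2_rep R S f \<in> carrier_mat (fst R * fst S) (fst R * fst S)"
  by (simp add: act2_rep_def)

lemma fst_rep_tensor [simp]: "fst (rep_tensor n q R S) = fst R * fst S"
  by (simp add: rep_tensor_def)

lemma gens_ok_tensor [simp]: "gens_ok (rep_tensor n q R S)"
  by (simp add: gens_in_def rep_tensor_def)

lemma monoid_rep_word_kron:
  "gens_ok R \<Longrightarrow> gens_ok S \<Longrightarrow> monoid_rep (fst R * fst S) (word_kron R S)"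
  unfolding word_kron_def by (intro monoid_rep_kronecker monoid_rep_wmat)

lemma act2_rep_tens:
  assumes "gens_ok R" "gens_ok S"
  shows "act2_rep R S (tens f g) = kronecker (act R f) (act S g)"
proof (rule eq_matI)
  let ?d = "fst R" and ?e = "fst S"
  fix r c assume "r < dim_row (kronecker (act R f) (act S g))" "c < dim_col (kronecker (act R f) (act S g))"
  then have rc: "r < ?d * ?e" "c < ?d * ?e" by (auto simp: act_def)
  note bd = div_mod_less[OF rc(1)] div_mod_less[OF rc(2)]
  note dims = carrier_matD[OF wmat_carrier[OF assms(1)]] carrier_matD[OF wmat_carrier[OF assms(2)]]
  have "act2_rep R S (tens f g) $$ (r, c) = (\<Sum>u\<in>Poly_Mapping.keys f. \<Sum>v\<in>Poly_Mapping.keys g.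
      Poly_Mapping.lookup f u * Poly_Mapping.lookup g v * word_kron R S (u, v) $$ (r, c))"
    unfolding act2_rep_def tens_def using rc carrier_matD[OF word_kron_carrier[OF assms]]
    by (simp add: lin_ext_sum_entry lin_ext_single[where G = "word_kron R S", OF word_kron_carrier[OF assms]])
  also have "\<dots> = (\<Sum>u\<in>Poly_Mapping.keys f. Poly_Mapping.lookup f u * wmat ?d (snd R) u $$ (r div ?e, c div ?e))
     * (\<Sum>v\<in>Poly_Mapping.keys g. Poly_Mapping.lookup g v * wmat ?e (snd S) v $$ (r mod ?e, c mod ?e))"
    unfolding sum_product word_kron_def using rc
    by (intro sum.cong refl) (simp add: kronecker_index dims mult_ac)
  also have "\<dots> = kronecker (act R f) (act S g) $$ (r, c)"
    using rc bd by (simp add: kronecker_index act_def) (simp add: ev_def lin_ext_def)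
  finally show "act2_rep R S (tens f g) $$ (r, c) = kronecker (act R f) (act S g) $$ (r, c)" .
qed (simp_all add: act2_rep_def act_def)

lemma act2_H2_ideal:
  assumes "is_rep n q R" "is_rep n q S" "t \<in> H2_ideal n q"
  shows "act2_rep R S t = 0\<^sub>m (fst R * fst S) (fst R * fst S)"
proof -
  let ?de = "fst R * fst S"
  note g = is_rep_gens[OF assms(1)] is_rep_gens[OF assms(2)]
  let ?I = "{t. act2_rep R S t = 0\<^sub>m ?de ?de}"
  have "ideal ?I ring_of_type_algebra"
    by (rule ideal_type_algebraI)
       (simp_all add: act2_rep_def lin_ext_add lin_ext_mult[OF monoid_rep_word_kron[OF g]]
         right_mult_zero_mat[of _ ?de ?de] left_mult_zero_mat[of _ ?de ?de])
  moreover have "kronecker (0\<^sub>m a b) A = 0\<^sub>m (a * dim_row A) (b * dim_col A)"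
    "kronecker A (0\<^sub>m a b) = 0\<^sub>m (dim_row A * a) (dim_col A * b)" for a b and A :: "'a mat"
    by (rule eq_matI; simp add: kronecker_index div_mod_less)+
  then have "(\<lambda>a. tens a 1) ` H_ideal n q \<union> (\<lambda>a. tens 1 a) ` H_ideal n q \<subseteq> ?I"
    using is_rep_act_ideal[OF assms(1)] is_rep_act_ideal[OF assms(2)]
    by (auto simp: act2_rep_tens[OF g] carrier_matD[OF act_carrier])
  ultimately have "H2_ideal n q \<subseteq> ?I" unfolding H2_ideal_def by (rule genideal_type_algebra_minimal)
  then show ?thesis using assms(3) by auto
qed

text \<open>
  Both sides are algebra homomorphisms on the free algebra that agree on the letters.
\<close>

lemma act2_rep_comult:
  assumes "gens_ok R" "gens_ok S"
  shows "act2_rep R S (free_hom sc (comult_gen n q) f) = act (rep_tensor n q R S) f"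
proof -
  note mr = monoid_rep_word_kron[OF assms]
  note fh = free_hom_add[OF sc_add sc_mult[symmetric] sc_one sc_commute]
    free_hom_mult[OF sc_add sc_mult[symmetric] sc_one sc_commute]
    free_hom_sc[OF sc_add sc_mult[symmetric] sc_one sc_commute]
    free_hom_letter[OF sc_add sc_mult[symmetric] sc_one sc_commute]
  have "alg_hom (fst R * fst S) (\<lambda>f. act2_rep R S (free_hom sc (comult_gen n q) f))"
    by (simp add: alg_hom_def act2_rep_def fh lin_ext_add lin_ext_mult[OF mr] lin_ext_sc[OF mr])
  from alg_hom_unique(2)[OF this, of f] show ?thesis
    by (simp add: fh act_def rep_tensor_def)
qed

lemma the_elem_image_const:
  assumes "x \<in> A" "\<And>y. y \<in> A \<Longrightarrow> f y = c"
  shows "the_elem (f ` A) = c"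
proof -
  have "f ` A = {c}" using assms by auto
  then show ?thesis by simp
qed

text \<open>
  The set \<open>comult n q h\<close> is a union of cosets over all representatives of
  \<open>h\<close>. It is enough that \<open>F \<otimes> F\<close> acts by the same matrix on all
  of its elements: representatives differ by elements of the ideal, which act as zero on the
  tensor product by assumption, and elements of \<open>I \<otimes> F + F \<otimes> I\<close> act
  as zero because \<open>M\<close> and \<open>N\<close> are modules.
\<close>

lemma hmod_tensor_rep:
  assumes "is_hmod n q M" "is_hmod n q N"
    and T: "is_rep n q (rep_tensor n q (rep_of n q M) (rep_of n q N))"
  shows "is_hmod n q (hmod_tensor n q M N)"
    and "rep_of n q (hmod_tensor n q M N) = rep_tensor n q (rep_of n q M) (rep_of n q N)"
proof -
  let ?R = "rep_of n q M" and ?S = "rep_of n q N" and ?T = "rep_tensor n q (rep_of n q M) (rep_of n q N)"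
  note r = is_rep_rep_of[OF assms(1)] is_rep_rep_of[OF assms(2)]
  note g = is_rep_gens[OF r(1)] is_rep_gens[OF r(2)]
  have single: "act R (Poly_Mapping.single u 1) = wmat (fst R) (snd R) u" if "gens_ok R" for R :: "'a rep" and u
    using that by (simp add: act_def ev_def lin_ext_single wmat_carrier)
  have a2: "act2_free n q M N t = act2_rep ?R ?S t" for t
    unfolding act2_free_def act2_rep_def lin_ext_def word_kron_def case_prod_beta
    by (simp add: hmod_act[OF assms(1)] hmod_act[OF assms(2)] single[OF g(1)] single[OF g(2)])
  have "snd (hmod_tensor n q M N) (H_class n q x) = act ?T x" for x
  proof -
    let ?h = "H_class n q x" and ?D = "free_hom sc (comult_gen n q)"
    have val: "act2_free n q M N t = act ?T x" if t: "t \<in> comult n q ?h" for t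
    proof -
      obtain y where y: "y \<in> ?h" "t \<in> H2_ideal n q +>\<^bsub>ring_of_type_algebra\<^esub> ?D y"
        using t unfolding comult_def by blast
      then have "t - ?D y \<in> H2_ideal n q" by (simp add: coset_type_algebra)
      moreover have "t = (t - ?D y) + ?D y" by simp
      ultimately have "act2_rep ?R ?S t = 0\<^sub>m (fst ?R * fst ?S) (fst ?R * fst ?S) + act2_rep ?R ?S (?D y)"
        using act2_H2_ideal[OF r] unfolding act2_rep_def by (metis lin_ext_add)
      also have "\<dots> = act ?T y" using left_add_zero_mat[OF act_carrier[of ?T y]] by (simp add: act2_rep_comult[OF g])
      also have "\<dots> = act ?T x" using is_rep_act_class[OF T y(1)] .
      finally show ?thesis by (simp add: a2)
    qed
    have "?D x \<in> H2_ideal n q +>\<^bsub>ring_of_type_algebra\<^esub> ?D x"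
      using ideal_type_algebraD(1)[OF ideal_genideal_type_algebra] by (simp add: coset_type_algebra H2_ideal_def)
    then have "?D x \<in> comult n q ?h" using H_class_self[of x n q] by (auto simp: comult_def)
    from the_elem_image_const[OF this val] show ?thesis
      by (simp add: hmod_tensor_def act2_def)
  qed
  note * = is_hmodI[OF gens_ok_tensor _ this]
  show "is_hmod n q (hmod_tensor n q M N)" by (rule *) (simp add: hmod_tensor_def rep_of_def)
  show "rep_of n q (hmod_tensor n q M N) = ?T" by (rule *) (simp add: hmod_tensor_def rep_of_def)
qed

definition rep_unit :: "'k::field rep" where
  "rep_unit = (1, \<lambda>_. 1\<^sub>m 1)"

lemma hmod_unit_rep:
  assumes U: "is_rep n q rep_unit"
  shows "is_hmod n q hmod_unit" "rep_of n q hmod_unit = rep_unit"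
proof -
  have fh: "free_hom (\<lambda>c. c) (\<lambda>_. 1) (f + g) = free_hom (\<lambda>c. c) (\<lambda>_. 1) f + free_hom (\<lambda>c. c) (\<lambda>_. 1) g"
    "free_hom (\<lambda>c. c) (\<lambda>_. 1) (f * g) = free_hom (\<lambda>c. c) (\<lambda>_. 1) f * free_hom (\<lambda>c. c) (\<lambda>_. 1) g"
    "free_hom (\<lambda>c. c) (\<lambda>_. 1) (sc c) = c"
    "free_hom (\<lambda>c. c) (\<lambda>_. 1) (letter a) = 1" for f g :: "'a falg" and c a
    by (rule free_hom_add free_hom_mult free_hom_sc free_hom_letter; simp add: mult.commute)+
  have "alg_hom 1 (\<lambda>f::'a falg. free_hom (\<lambda>c. c) (\<lambda>_. 1) f \<cdot>\<^sub>m 1\<^sub>m 1)"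
    unfolding alg_hom_def fh
    by (auto intro!: eq_matI simp: scalar_prod_def)
  from alg_hom_unique(2)[OF this] have act: "free_hom (\<lambda>c. c) (\<lambda>_. 1) f \<cdot>\<^sub>m 1\<^sub>m 1 = act rep_unit f" for f :: "'a falg"
    by (simp add: act_def rep_unit_def fh)
  have "snd hmod_unit (H_class n q x) = act rep_unit x" for x
  proof -
    have "free_hom (\<lambda>c. c) (\<lambda>_. 1) y = free_hom (\<lambda>c. c) (\<lambda>_. 1) x" if "y \<in> H_class n q x" for y
    proof -
      have "free_hom (\<lambda>c. c) (\<lambda>_. 1) y \<cdot>\<^sub>m 1\<^sub>m 1 = free_hom (\<lambda>c. c) (\<lambda>_. 1) x \<cdot>\<^sub>m (1\<^sub>m 1 :: 'a mat)"
        using is_rep_act_class[OF U that] by (simp only: act)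
      then have "(free_hom (\<lambda>c. c) (\<lambda>_. 1) y \<cdot>\<^sub>m 1\<^sub>m 1) $$ (0, 0) = (free_hom (\<lambda>c. c) (\<lambda>_. 1) x \<cdot>\<^sub>m (1\<^sub>m 1 :: 'a mat)) $$ (0, 0)"
        by (rule arg_cong)
      then show ?thesis by simp
    qed
    from the_elem_image_const[where f = "free_hom (\<lambda>c. c) (\<lambda>_. 1)", OF H_class_self this] show ?thesis
      by (simp only: hmod_unit_def counit_def snd_conv act)
  qed
  moreover have "gens_ok (rep_unit :: 'a rep)" using U by (rule is_rep_gens)
  ultimately show "is_hmod n q hmod_unit" "rep_of n q hmod_unit = rep_unit"
    by (intro is_hmodI; simp add: hmod_unit_def rep_unit_def)+
qed

section \<open>Splitting off direct summands\<close>

lemma mat_times_index: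
  "i < dim_row A \<Longrightarrow> j < dim_col B \<Longrightarrow> dim_col A = dim_row B \<Longrightarrow>
    (A * B) $$ (i, j) = (\<Sum>k<dim_row B. A $$ (i, k) * B $$ (k, j))"
  by (simp add: scalar_prod_def lessThan_atLeast0)

lemma minus_zero_dim [simp]: "dim_row A = d \<Longrightarrow> dim_col A = e \<Longrightarrow> A - 0\<^sub>m d e = (A :: 'a::group_add mat)"
  by (rule eq_matI) auto

text \<open>
  The increasing enumeration of the natural numbers other than \<open>r\<close>.
\<close>

definition skip :: "nat \<Rightarrow> nat \<Rightarrow> nat" where
  "skip r j = (if j < r then j else Suc j)"

lemma skip_neq [simp]: "skip r j \<noteq> r" "r \<noteq> skip r j"
  by (auto simp: skip_def)

lemma skip_eq_iff [simp]: "skip r i = skip r j \<longleftrightarrow> i = j"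
  by (auto simp: skip_def split: if_splits)

lemma skip_less: "r < d \<Longrightarrow> j < d - 1 \<Longrightarrow> skip r j < d"
  by (auto simp: skip_def)

lemma sum_skip:
  fixes F :: "nat \<Rightarrow> 'a::comm_monoid_add"
  assumes "r < d"
  shows "(\<Sum>k<d. F k) = F r + (\<Sum>k<d - 1. F (skip r k))"
proof -
  have "(\<Sum>k<d - 1. F (skip r k)) = (\<Sum>k\<in>{..<d} - {r}. F k)"
    by (rule sum.reindex_bij_witness[where i = "\<lambda>k. if k < r then k else k - 1" and j = "skip r"])
       (use assms in \<open>auto simp: skip_def split: if_splits\<close>)
  then show ?thesis using assms by (simp add: sum.remove[of _ r])
qed

text \<open>
  A vector and a functional with \<open>\<phi> v = 1\<close> split the space as the line of
  \<open>v\<close> plus the kernel of \<open>\<phi>\<close>. As some coordinate \<open>x r\<close>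
  of \<open>v\<close> is nonzero, the projections along \<open>v\<close> of the other unit vectors
  form a basis of the kernel; they are the columns of \<open>C\<close>.
\<close>

lemma vector_complement:
  fixes v :: "'k::field mat"
  assumes v: "v \<in> carrier_mat d 1" and \<phi>: "\<phi> \<in> carrier_mat 1 d" and one: "\<phi> * v = 1\<^sub>m 1"
  obtains C D where "C \<in> carrier_mat d (d - 1)" "D \<in> carrier_mat (d - 1) d"
    "D * C = 1\<^sub>m (d - 1)" "C * D = 1\<^sub>m d - v * \<phi>"
proof -
  define x where "x i = v $$ (i, 0)" for i
  define f where "f i = \<phi> $$ (0, i)" for i
  have fx: "(\<Sum>i<d. f i * x i) = 1"
  proof -
    have "(\<phi> * v) $$ (0, 0) = (\<Sum>i<d. f i * x i)"
      using v \<phi> by (subst mat_times_index) (auto simp: x_def f_def)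
    then show ?thesis by (simp add: one)
  qed
  obtain r where r: "r < d" "x r \<noteq> 0"
  proof (rule ccontr)
    assume "\<not> thesis"
    then have "\<And>i. i < d \<Longrightarrow> x i = 0" using that by blast
    then show False using fx by simp
  qed
  define C where "C = mat d (d - 1) (\<lambda>(i, k). (if i = skip r k then 1 else 0) - f (skip r k) * x i)"
  define D where "D = mat (d - 1) d (\<lambda>(j, i). (if i = skip r j then 1 else 0)
    - (if i = r then x (skip r j) / x r else 0))"
  show thesis
  proof
    show "C \<in> carrier_mat d (d - 1)" "D \<in> carrier_mat (d - 1) d" by (simp_all add: C_def D_def)
    show "D * C = 1\<^sub>m (d - 1)"
    proof (rule eq_matI)
      fix j k assume "j < dim_row (1\<^sub>m (d - 1) :: 'k mat)" "k < dim_col (1\<^sub>m (d - 1) :: 'k mat)"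
      then have jk: "j < d - 1" "k < d - 1" by simp_all
      note sl = skip_less[OF r(1) jk(1)] skip_less[OF r(1) jk(2)]
      have "(D * C) $$ (j, k) = (\<Sum>i<d. D $$ (j, i) * C $$ (i, k))"
        using jk by (subst mat_times_index) (auto simp: C_def D_def)
      also have "\<dots> = (\<Sum>i<d. (if i = skip r j then C $$ (i, k) else 0)
          - (if i = r then x (skip r j) / x r * C $$ (i, k) else 0))"
        by (rule sum.cong) (use jk in \<open>auto simp: D_def\<close>)
      also have "\<dots> = C $$ (skip r j, k) - x (skip r j) / x r * C $$ (r, k)"
        using r sl by (simp add: sum_subtractf)
      also have "\<dots> = 1\<^sub>m (d - 1) $$ (j, k)"
        using r sl jk by (simp add: C_def field_simps)
      finally show "(D * C) $$ (j, k) = 1\<^sub>m (d - 1) $$ (j, k)" .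
    qed (simp_all add: C_def D_def)
    show "C * D = 1\<^sub>m d - v * \<phi>"
    proof (rule eq_matI)
      fix i l assume "i < dim_row (1\<^sub>m d - v * \<phi>)" "l < dim_col (1\<^sub>m d - v * \<phi>)"
      then have il: "i < d" "l < d" using v \<phi> by auto
      define G where "G p = ((if i = p then 1 else 0) - f p * x i)
        * ((if l = p then 1 else 0) - (if l = r then x p / x r else 0))" for p
      have last: "(\<Sum>p<d. if l = r then x i / x r * (f p * x p) else 0) = (if l = r then x i / x r else 0)"
      proof (cases "l = r")
        case True
        have "(\<Sum>p<d. x i / x r * (f p * x p)) = x i / x r * (\<Sum>p<d. f p * x p)"
          by (simp only: sum_distrib_left)
        then show ?thesis using True by (simp only: fx) simp
      qed simp
      have "(C * D) $$ (i, l) = (\<Sum>k<d - 1. C $$ (i, k) * D $$ (k, l))"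
        using il by (subst mat_times_index) (auto simp: C_def D_def)
      also have "\<dots> = (\<Sum>k<d - 1. G (skip r k))"
        by (rule sum.cong) (use il in \<open>auto simp: G_def C_def D_def\<close>)
      also have "\<dots> = (\<Sum>p<d. G p)" using r by (simp add: sum_skip[OF r(1)]) (simp add: G_def)
      also have "\<dots> = (\<Sum>p<d. (if i = p then (if l = p then 1 else 0) else 0)
          - (if i = p then (if l = r then x p / x r else 0) else 0)
          - (if l = p then f p * x i else 0) + (if l = r then x i / x r * (f p * x p) else 0))"
        by (rule sum.cong) (auto simp: G_def algebra_simps)
      also have "\<dots> = (if l = i then 1 else 0) - (if l = r then x i / x r else 0)
          - f l * x i + (if l = r then x i / x r else 0)"
        using il by (simp only: sum.distrib sum_subtractf last) simp
      also have "\<dots> = (1\<^sub>m d - v * \<phi>) $$ (i, l)"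
      proof -
        have "(v * \<phi>) $$ (i, l) = (\<Sum>k<1. v $$ (i, k) * \<phi> $$ (k, l))"
          using il v \<phi> by (subst mat_times_index) auto
        then show ?thesis using il v \<phi> by (simp add: x_def f_def)
      qed
      finally show "(C * D) $$ (i, l) = (1\<^sub>m d - v * \<phi>) $$ (i, l)" .
    qed (use v \<phi> in \<open>auto simp: C_def D_def\<close>)
  qed
qed

text \<open>
  Every idempotent is the projection onto a direct summand. If \<open>E\<close> is not the
  identity, then \<open>G = 1 - E\<close> has a nonzero entry, and the column and (rescaled) row
  of \<open>G\<close> through it are a vector and a functional as in
  \<open>vector_complement\<close> that \<open>E\<close> annihilates. So \<open>E\<close>
  restricts to an idempotent of a space of dimension one less.
\<close>

lemma idempotent_splits:
  fixes E :: "'k::field mat"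
  assumes "E \<in> carrier_mat d d" "E * E = E"
  obtains r C D where "C \<in> carrier_mat d r" "D \<in> carrier_mat r d" "D * C = 1\<^sub>m r" "C * D = E"
proof -
  have "\<exists>r. \<exists>C\<in>carrier_mat d r. \<exists>D\<in>carrier_mat r d. D * C = 1\<^sub>m r \<and> C * D = E"
    using assms
  proof (induction d arbitrary: E rule: less_induct)
    case (less d)
    note E = less.prems(1) and EE = less.prems(2)
    show ?case
    proof (cases "E = 1\<^sub>m d")
      case True
      show ?thesis by (rule exI[of _ d], rule bexI[of _ "1\<^sub>m d"], rule bexI[of _ "1\<^sub>m d"]) (simp_all add: True)
    next
      case False
      define G where "G = 1\<^sub>m d - E"
      have G: "G \<in> carrier_mat d d" unfolding G_def by (rule minus_carrier_mat[OF E])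
      have EG: "E * G = 0\<^sub>m d d" using E EE by (simp add: G_def mult_minus_distrib_mat[of _ d d _ d])
      have GE: "G * E = 0\<^sub>m d d" using E EE by (simp add: G_def minus_mult_distrib_mat[of _ d d _ _ d])
      have GG: "G * G = G"
      proof -
        have "G * G = G * 1\<^sub>m d - G * E" unfolding G_def[of ] using E
          by (intro mult_minus_distrib_mat[of _ d d _ d]) auto
        then show ?thesis using G by (simp add: GE)
      qed
      obtain i j where ij: "i < d" "j < d" "G $$ (i, j) \<noteq> 0"
      proof (rule ccontr)
        assume "\<not> thesis"
        then have z: "\<And>i j. i < d \<Longrightarrow> j < d \<Longrightarrow> G $$ (i, j) = 0" using that by blast
        have "E $$ (i, j) = 1\<^sub>m d $$ (i, j)" if "i < d" "j < d" for i j
          using z[OF that] that E by (simp add: G_def split: if_splits)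
        then have "E = 1\<^sub>m d" using E by (intro eq_matI) auto
        then show False using False by simp
      qed
      let ?c = "mat d 1 (\<lambda>(a, _). if a = j then 1 else 0) :: 'k mat"
      let ?r = "mat 1 d (\<lambda>(_, b). if b = i then inverse (G $$ (i, j)) else 0)"
      define v where "v = G * ?c"
      define \<phi> where "\<phi> = ?r * G"
      have v: "v \<in> carrier_mat d 1" and \<phi>: "\<phi> \<in> carrier_mat 1 d" using G by (auto simp: v_def \<phi>_def)
      have v_index: "v $$ (a, 0) = G $$ (a, j)" if "a < d" for a
        using that ij G by (simp add: v_def mat_times_index if_distrib[of "\<lambda>x. _ * x"] cong: if_cong del: index_mult_mat(1))
      have \<phi>v: "\<phi> * v = 1\<^sub>m 1"
      proof -
        have "\<phi> * v = ?r * ((G * G) * ?c)"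
          using G unfolding v_def \<phi>_def carrier_mat_def by (simp add: mult_assoc_dim)
        also have "\<dots> = ?r * v" by (simp add: GG v_def)
        also have "\<dots> = 1\<^sub>m 1"
        proof (rule eq_matI)
          fix a b assume "a < dim_row (1\<^sub>m 1 :: 'k mat)" "b < dim_col (1\<^sub>m 1 :: 'k mat)"
          then have ab: "a = 0" "b = 0" by simp_all
          have "(?r * v) $$ (0, 0) = (\<Sum>k<d. ?r $$ (0, k) * v $$ (k, 0))"
            using v by (subst mat_times_index) auto
          also have "\<dots> = (\<Sum>k<d. if k = i then inverse (G $$ (i, j)) * v $$ (i, 0) else 0)"
            by (rule sum.cong) auto
          finally have "(?r * v) $$ (0, 0) = (\<Sum>k<d. if k = i then inverse (G $$ (i, j)) * v $$ (i, 0) else 0)" .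
          then show "(?r * v) $$ (a, b) = 1\<^sub>m 1 $$ (a, b)" using ij by (simp add: ab v_index)
        qed (use v in auto)
        finally show ?thesis .
      qed
      have "E * v = (E * G) * ?c" using E G unfolding v_def carrier_mat_def by (simp add: mult_assoc_dim)
      then have Ev: "E * v = 0\<^sub>m d 1" by (simp add: EG)
      have "\<phi> * E = ?r * (G * E)" using E G unfolding \<phi>_def carrier_mat_def by (simp add: mult_assoc_dim)
      then have \<phi>E: "\<phi> * E = 0\<^sub>m 1 d" by (simp add: GE)
      obtain C D where CD: "C \<in> carrier_mat d (d - 1)" "D \<in> carrier_mat (d - 1) d"
        "D * C = 1\<^sub>m (d - 1)" "C * D = 1\<^sub>m d - v * \<phi>"
        using vector_complement[OF v \<phi> \<phi>v] .
      have E1: "E * (C * D) = E"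
      proof -
        have "E * (C * D) = E * 1\<^sub>m d - E * (v * \<phi>)"
          unfolding CD(4) using E v \<phi> by (intro mult_minus_distrib_mat[of _ d d _ d]) auto
        also have "E * (v * \<phi>) = (E * v) * \<phi>" using E v \<phi> by (simp add: assoc_mult_mat[of _ d d _ 1 _ d])
        finally show ?thesis using E \<phi> by (simp add: Ev)
      qed
      have E2: "(C * D) * E = E"
      proof -
        have "(C * D) * E = 1\<^sub>m d * E - (v * \<phi>) * E"
          unfolding CD(4) using E v \<phi> by (intro minus_mult_distrib_mat[of _ d d _ _ d]) auto
        also have "(v * \<phi>) * E = v * (\<phi> * E)" using E v \<phi> by (simp add: assoc_mult_mat[of _ d 1 _ d _ d])
        finally show ?thesis using E v by (simp add: \<phi>E)
      qed
      define E' where "E' = D * E * C"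
      have E': "E' \<in> carrier_mat (d - 1) (d - 1)" using CD E by (simp add: E'_def)
      have "E' * E' = D * (E * (C * D)) * E * C"
        unfolding E'_def using CD(1,2) E unfolding carrier_mat_def by (simp add: mult_assoc_dim)
      also have "\<dots> = D * (E * E) * C"
        using CD(1,2) E unfolding E1 unfolding carrier_mat_def by (simp add: mult_assoc_dim)
      finally have "E' * E' = E'" by (simp add: EE E'_def)
      moreover have "d - 1 < d" using ij by simp
      ultimately obtain r C' D' where CD': "C' \<in> carrier_mat (d - 1) r" "D' \<in> carrier_mat r (d - 1)"
        "D' * C' = 1\<^sub>m r" "C' * D' = E'"
        using less.IH[OF _ E'] by blast
      have "(D' * D) * (C * C') = D' * (D * C) * C'"
        using CD(1,2) CD'(1,2) unfolding carrier_mat_def by (simp add: mult_assoc_dim)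
      then have 1: "(D' * D) * (C * C') = 1\<^sub>m r" using CD CD' by simp
      have "(C * C') * (D' * D) = C * (C' * D') * D"
        using CD(1,2) CD'(1,2) unfolding carrier_mat_def by (simp add: mult_assoc_dim)
      also have "\<dots> = ((C * D) * E) * (C * D)" unfolding CD'(4) E'_def
        using CD(1,2) E unfolding carrier_mat_def by (simp add: mult_assoc_dim)
      finally have 2: "(C * C') * (D' * D) = E" by (simp add: E1 E2)
      show ?thesis
        by (rule exI[of _ r], rule bexI[of _ "C * C'"], rule bexI[of _ "D' * D"])
           (use 1 2 CD CD' in auto)
    qed
  qed
  then show thesis using that by blast
qed

lemma block_sum_eq_zero:
  assumes "A \<in> carrier_mat d d" "B \<in> carrier_mat e e" "block_sum A B = 0\<^sub>m (d + e) (d + e)"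
  shows "A = 0\<^sub>m d d" "B = 0\<^sub>m e e"
proof -
  have "block_sum A B $$ (i, j) = 0" if "i < d + e" "j < d + e" for i j using assms that by simp
  note * = this[unfolded block_sum_def]
  show "A = 0\<^sub>m d d"
  proof (rule eq_matI)
    fix i j assume "i < dim_row (0\<^sub>m d d :: 'a mat)" "j < dim_col (0\<^sub>m d d :: 'a mat)"
    then show "A $$ (i, j) = 0\<^sub>m d d $$ (i, j)" using *[of i j] assms(1,2) by simp
  qed (use assms in auto)
  show "B = 0\<^sub>m e e"
  proof (rule eq_matI)
    fix i j assume "i < dim_row (0\<^sub>m e e :: 'a mat)" "j < dim_col (0\<^sub>m e e :: 'a mat)"
    then show "B $$ (i, j) = 0\<^sub>m e e $$ (i, j)" using *[of "d + i" "d + j"] assms(1,2) by simp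
  qed (use assms in auto)
qed

text \<open>
  Module maps \<open>B : S \<rightarrow> R\<close> and \<open>A : R \<rightarrow> S\<close> with
  \<open>A B = 1\<close> make \<open>S\<close> a direct summand of \<open>R\<close>; the
  complement is the image of the idempotent \<open>1 - B A\<close>, with the action compressed to
  it.
\<close>

lemma split_off:
  assumes R: "is_rep n q R" and S: "gens_ok S"
    and B: "B \<in> carrier_mat (fst R) (fst S)" and A: "A \<in> carrier_mat (fst S) (fst R)"
    and AB: "A * B = 1\<^sub>m (fst S)"
    and RB: "\<And>g. snd R g * B = B * snd S g" and AR: "\<And>g. A * snd R g = snd S g * A"
  obtains R' where "is_rep n q R'" "rep_iso R (rep_sum S R')"
proof -
  let ?d = "fst R" and ?s = "fst S"
  define E where "E = 1\<^sub>m ?d - B * A"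
  have E: "E \<in> carrier_mat ?d ?d" unfolding E_def by (rule minus_carrier_mat[OF mult_carrier_mat[OF B A]])
  have AE: "A * E = 0\<^sub>m ?s ?d"
  proof -
    have "A * E = A * 1\<^sub>m ?d - A * (B * A)"
      unfolding E_def using A B by (intro mult_minus_distrib_mat[of _ ?s ?d _ ?d]) auto
    also have "A * (B * A) = (A * B) * A" using A B by (simp add: assoc_mult_mat[of _ ?s ?d _ ?s _ ?d])
    finally show ?thesis using A by (simp add: AB)
  qed
  have EB: "E * B = 0\<^sub>m ?d ?s"
  proof -
    have "E * B = 1\<^sub>m ?d * B - (B * A) * B"
      unfolding E_def using A B by (intro minus_mult_distrib_mat[of _ ?d ?d _ _ ?s]) auto
    also have "(B * A) * B = B * (A * B)" using A B by (simp add: assoc_mult_mat[of _ ?d ?s _ ?d _ ?s])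
    finally show ?thesis using B by (simp add: AB)
  qed
  have "E * E = E * 1\<^sub>m ?d - E * (B * A)"
  proof -
    have "E * (1\<^sub>m ?d - B * A) = E * 1\<^sub>m ?d - E * (B * A)"
      using A B E by (intro mult_minus_distrib_mat[of _ ?d ?d _ ?d]) auto
    then show ?thesis by (simp add: E_def)
  qed
  also have "E * (B * A) = (E * B) * A" using A B E by (simp add: assoc_mult_mat[of _ ?d ?d _ ?s _ ?d])
  finally have "E * E = E" using A E by (simp add: EB)
  then obtain r C D where CD: "C \<in> carrier_mat ?d r" "D \<in> carrier_mat r ?d" "D * C = 1\<^sub>m r" "C * D = E"
    using idempotent_splits[OF E] by metis
  have AC: "A * C = 0\<^sub>m ?s r"
  proof -
    have "A * C = A * (C * (D * C))" using CD by simp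
    also have "\<dots> = (A * (C * D)) * C" using A CD(1,2) unfolding carrier_mat_def by (simp add: mult_assoc_dim)
    finally show ?thesis using CD by (simp add: CD(4) AE)
  qed
  have DB: "D * B = 0\<^sub>m r ?s"
  proof -
    have "D * B = ((D * C) * D) * B" using CD by simp
    also have "\<dots> = D * ((C * D) * B)" using B CD(1,2) unfolding carrier_mat_def by (simp add: mult_assoc_dim)
    finally show ?thesis using CD by (simp add: CD(4) EB)
  qed
  define R' where "R' = (r, \<lambda>g. D * snd R g * C)"
  note \<phi> = gens_inD[OF is_rep_gens[OF R]] and \<sigma> = gens_inD[OF S]
  have g': "gens_ok R'" using CD \<phi> by (auto simp: gens_in_def R'_def intro!: mult_carrier_mat)
  have D\<phi>: "snd R' g * D = D * snd R g" for g
  proof -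
    have "snd R' g * D = (D * snd R g) * E"
      using CD(1,2) \<phi>[of g] unfolding R'_def CD(4)[symmetric] carrier_mat_def by (simp add: mult_assoc_dim)
    also have "\<dots> = (D * snd R g) * 1\<^sub>m ?d - (D * snd R g) * (B * A)"
      unfolding E_def using A B CD(2) \<phi>[of g] by (intro mult_minus_distrib_mat[of _ r ?d _ ?d]) auto
    also have "(D * snd R g) * (B * A) = D * (snd R g * B) * A"
      using A B CD(2) \<phi>[of g] unfolding carrier_mat_def by (simp add: mult_assoc_dim)
    also have "\<dots> = (D * B) * snd S g * A"
      using A B CD(2) \<sigma>[of g] unfolding RB carrier_mat_def by (simp add: mult_assoc_dim)
    also have "\<dots> = 0\<^sub>m r ?d"
      using A \<sigma>[of g] by (simp add: DB)
    finally show ?thesis using CD(2) \<phi>[of g] by simp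
  qed
  (* A is put on top of D, and B to the left of C; the blocks without rows or columns fill up the notation. *)
  define P where "P = four_block_mat A (0\<^sub>m ?s 0) D (0\<^sub>m r 0)"
  define Q where "Q = four_block_mat B C (0\<^sub>m 0 ?s) (0\<^sub>m 0 r)"
  have P: "P \<in> carrier_mat (?s + r) ?d"
    using four_block_carrier_mat[OF A, of "0\<^sub>m r 0" r 0 "0\<^sub>m ?s 0" D] by (simp add: P_def)
  have Q: "Q \<in> carrier_mat ?d (?s + r)"
    using four_block_carrier_mat[OF B, of "0\<^sub>m 0 r" 0 r C "0\<^sub>m 0 ?s"] by (simp add: Q_def)
  have PQ: "P * Q = 1\<^sub>m (?s + r)"
    unfolding P_def Q_def
    by (subst mult_four_block_mat[of _ ?s ?d _ 0 _ r _ _ ?s _ r]) (use A B CD in \<open>auto simp: AB AC DB\<close>)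
  have QP: "Q * P = 1\<^sub>m ?d"
  proof -
    have "Q * P = four_block_mat (B * A + C * D) (0\<^sub>m ?d 0) (0\<^sub>m 0 ?d) (0\<^sub>m 0 0)"
      unfolding P_def Q_def
      by (subst mult_four_block_mat[of _ ?d ?s _ r _ 0 _ _ ?d _ 0]) (use A B CD in auto)
    also have "\<dots> = B * A + C * D"
      by (rule eq_matI) (use A B CD in auto)
    also have "\<dots> = 1\<^sub>m ?d"
      unfolding CD(4) E_def by (rule eq_matI) (use A B in auto)
    finally show ?thesis .
  qed
  have PR: "P * snd R g = block_sum (snd S g) (snd R' g) * P" for g
  proof -
    have bs: "block_sum (snd S g) (snd R' g) = four_block_mat (snd S g) (0\<^sub>m ?s r) (0\<^sub>m r ?s) (snd R' g)"
      using \<sigma>[of g] gens_inD[OF g', of g] CD(1,2) by (simp add: block_sum_def R'_def)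
    have "block_sum (snd S g) (snd R' g) * P = four_block_mat (snd S g * A) (0\<^sub>m ?s 0) (snd R' g * D) (0\<^sub>m r 0)"
      unfolding P_def bs
      by (subst mult_four_block_mat[of _ ?s ?s _ r _ r _ _ ?d _ 0])
         (use A CD \<sigma>[of g] gens_inD[OF g', of g] in \<open>auto simp: R'_def\<close>)
    moreover have "P * snd R g = P * four_block_mat (snd R g) (0\<^sub>m ?d 0) (0\<^sub>m 0 ?d) (0\<^sub>m 0 0)"
      by (rule arg_cong[of _ _ "(*) P"], rule eq_matI) (use \<phi>[of g] in auto)
    moreover have "\<dots> = four_block_mat (A * snd R g) (0\<^sub>m ?s 0) (D * snd R g) (0\<^sub>m r 0)"
      unfolding P_def
      by (subst mult_four_block_mat[of _ ?s ?d _ 0 _ r _ _ ?d _ 0]) (use A CD \<phi>[of g] in auto)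
    ultimately show ?thesis by (simp add: AR D\<phi>)
  qed
  have f: "fst (rep_sum S R') = ?s + r" by (simp add: R'_def)
  have iso: "rep_iso R (rep_sum S R')"
    unfolding rep_iso_def f
    by (rule bexI[OF _ P], rule bexI[OF _ Q]) (simp add: PQ QP PR, simp add: rep_sum_def)
  have sum: "is_rep n q (rep_sum S R')"
    by (rule is_rep_iso[OF R gens_ok_sum[OF S g'] iso])
  have "is_rep n q R'"
  proof -
    have "act R' x = 0\<^sub>m (fst R') (fst R')" if "x \<in> relators n q" for x
    proof -
      have "block_sum (act S x) (act R' x) = 0\<^sub>m (?s + fst R') (?s + fst R')"
        using sum that by (simp add: is_rep_def act_sum[OF S g', symmetric])
      then show ?thesis using block_sum_eq_zero(2) act_carrier by blast
    qed
    then show ?thesis using g' by (simp add: is_rep_def)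
  qed
  then show thesis using iso by (rule that)
qed

text \<open>
  A way to produce the two maps from elements of the algebra. Think of \<open>u k\<close> and
  \<open>w k\<close> as the first column and the first row of a system of matrix units with corner
  \<open>e\<close>. If \<open>e\<close> has the nonzero entry \<open>(r, c)\<close> on
  \<open>R\<close>, the columns with index \<open>c\<close> of the \<open>u k\<close> and the rows
  with index \<open>r\<close> of the \<open>w k\<close>, divided by that entry, are inverse to
  each other on one side.
\<close>

lemma split_off_units:
  assumes R: "is_rep n q R" and S: "gens_ok S"
    and e: "act R e \<noteq> 0\<^sub>m (fst R) (fst R)"
    and wu: "\<And>k l. k < fst S \<Longrightarrow> l < fst S \<Longrightarrow> act R (w k * u l) = (if k = l then act R e else 0\<^sub>m (fst R) (fst R))"
    and gu: "\<And>g l. l < fst S \<Longrightarrow> act R (letter g * u l) = act R (\<Sum>k<fst S. sc (snd S g $$ (k, l)) * u k)"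
    and wg: "\<And>g k. k < fst S \<Longrightarrow> act R (w k * letter g) = act R (\<Sum>l<fst S. sc (snd S g $$ (k, l)) * w l)"
  obtains R' where "is_rep n q R'" "rep_iso R (rep_sum S R')"
proof -
  let ?d = "fst R" and ?s = "fst S"
  note gR = is_rep_gens[OF R]
  note \<phi> = gens_inD[OF gR] and \<sigma> = gens_inD[OF S]
  obtain r c where rc: "r < ?d" "c < ?d" "act R e $$ (r, c) \<noteq> 0"
  proof (rule ccontr)
    assume "\<not> thesis"
    then have "\<And>i j. i < ?d \<Longrightarrow> j < ?d \<Longrightarrow> act R e $$ (i, j) = 0" using that by blast
    then have "act R e = 0\<^sub>m ?d ?d" by (intro eq_matI) auto
    then show False using e by simp
  qed
  define B where "B = mat ?d ?s (\<lambda>(i, k). act R (u k) $$ (i, c))"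
  define A where "A = mat ?s ?d (\<lambda>(k, l). act R (w k) $$ (r, l) / act R e $$ (r, c))"
  have prod: "act R (f * g) $$ (i, j) = (\<Sum>k<?d. act R f $$ (i, k) * act R g $$ (k, j))"
    if "i < ?d" "j < ?d" for f g i j
  proof -
    have "act R (f * g) = act R f * act R g" by (simp add: act_def ev_mult[OF gR])
    then show ?thesis using that by (simp add: mat_times_index del: index_mult_mat)
  qed
  have letter: "act R (letter g) = snd R g" for g by (simp add: act_def ev_letter[OF gR])
  have lin: "act R (\<Sum>k<?s. sc (x k) * f k) $$ (i, j) = (\<Sum>k<?s. x k * act R (f k) $$ (i, j))"
    if "i < ?d" "j < ?d" for x f i j
    using that ev_dim[of ?d "snd R"] by (simp add: act_def ev_sum_entry ev_sc_mult[OF gR])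
  show thesis
  proof (rule split_off[OF R S])
    show "B \<in> carrier_mat ?d ?s" "A \<in> carrier_mat ?s ?d" by (simp_all add: A_def B_def)
    show "A * B = 1\<^sub>m ?s"
    proof (rule eq_matI)
      fix k l assume "k < dim_row (1\<^sub>m ?s :: 'a mat)" "l < dim_col (1\<^sub>m ?s :: 'a mat)"
      then have kl: "k < ?s" "l < ?s" by simp_all
      have "(A * B) $$ (k, l) = (\<Sum>i<?d. act R (w k) $$ (r, i) * act R (u l) $$ (i, c)) / act R e $$ (r, c)"
        using kl by (subst mat_times_index) (auto simp: A_def B_def sum_divide_distrib)
      also have "\<dots> = act R (w k * u l) $$ (r, c) / act R e $$ (r, c)"
        using rc by (simp add: prod)
      finally show "(A * B) $$ (k, l) = 1\<^sub>m ?s $$ (k, l)" using kl rc by (simp add: wu)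
    qed (simp_all add: A_def B_def)
    fix g
    show "snd R g * B = B * snd S g"
    proof (rule eq_matI)
      fix i l assume "i < dim_row (B * snd S g)" "l < dim_col (B * snd S g)"
      then have il: "i < ?d" "l < ?s" using \<sigma>[of g] by (auto simp: B_def)
      have "(snd R g * B) $$ (i, l) = (\<Sum>k<?d. act R (letter g) $$ (i, k) * act R (u l) $$ (k, c))"
        using il \<phi>[of g] unfolding letter by (subst mat_times_index) (auto simp: B_def)
      also have "\<dots> = act R (letter g * u l) $$ (i, c)" using il rc by (simp add: prod)
      also have "\<dots> = (\<Sum>k<?s. snd S g $$ (k, l) * act R (u k) $$ (i, c))"
        using il rc by (simp add: gu lin)
      also have "\<dots> = (B * snd S g) $$ (i, l)"
        using il \<sigma>[of g] by (subst mat_times_index) (auto simp: B_def mult.commute)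
      finally show "(snd R g * B) $$ (i, l) = (B * snd S g) $$ (i, l)" .
    qed (use \<sigma>[of g] \<phi>[of g] in \<open>auto simp: B_def\<close>)
    show "A * snd R g = snd S g * A"
    proof (rule eq_matI)
      fix k j assume "k < dim_row (snd S g * A)" "j < dim_col (snd S g * A)"
      then have kj: "k < ?s" "j < ?d" using \<sigma>[of g] by (auto simp: A_def)
      have "(A * snd R g) $$ (k, j)
          = (\<Sum>i<?d. act R (w k) $$ (r, i) * act R (letter g) $$ (i, j)) / act R e $$ (r, c)"
        using kj \<phi>[of g] unfolding letter by (subst mat_times_index) (auto simp: A_def sum_divide_distrib)
      also have "\<dots> = act R (w k * letter g) $$ (r, j) / act R e $$ (r, c)" using kj rc by (simp add: prod)
      also have "\<dots> = (\<Sum>l<?s. snd S g $$ (k, l) * act R (w l) $$ (r, j)) / act R e $$ (r, c)"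
        using kj rc by (simp add: wg lin)
      also have "\<dots> = (snd S g * A) $$ (k, j)"
        using kj \<sigma>[of g] by (subst mat_times_index) (auto simp: A_def sum_divide_distrib)
      finally show "(A * snd R g) $$ (k, j) = (snd S g * A) $$ (k, j)" .
    qed (use \<sigma>[of g] \<phi>[of g] in \<open>auto simp: A_def\<close>)
  qed (rule that)
qed

section \<open>Multiplicities\<close>

text \<open>
  For an idempotent this is its rank. Defining it through the characteristic polynomial makes
  invariance under similarity and additivity on block sums immediate, and it counts correctly in
  positive characteristic, unlike the trace.
\<close>

definition idrank :: "'k::field mat \<Rightarrow> nat" where
  "idrank A = order 1 (char_poly A)"

lemma char_poly_block_sum:
  fixes A :: "'k::field mat"
  assumes A: "A \<in> carrier_mat d d" and B: "B \<in> carrier_mat e e"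
  shows "char_poly (block_sum A B) = char_poly A * char_poly B"
proof -
  have "char_poly_matrix (block_sum A B)
      = four_block_mat (char_poly_matrix A) (0\<^sub>m d e) (0\<^sub>m e d) (char_poly_matrix B)"
    by (rule eq_matI) (use A B in \<open>auto simp: char_poly_matrix_def block_sum_def one_poly_def\<close>)
  then show ?thesis unfolding char_poly_def
    by (simp add: det_four_block_mat_lower_left_zero[OF char_poly_matrix_closed[OF A] _ refl char_poly_matrix_closed[OF B]])
qed

lemma idrank_block_sum:
  assumes A: "A \<in> carrier_mat d d" and B: "B \<in> carrier_mat e e"
  shows "idrank (block_sum A B) = idrank A + idrank (B :: 'k::field mat)"
proof -
  have "char_poly A \<noteq> 0" "char_poly B \<noteq> 0"
    using degree_monic_char_poly[OF A] degree_monic_char_poly[OF B] by auto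
  then show ?thesis unfolding idrank_def char_poly_block_sum[OF A B] by (intro order_mult) simp
qed

lemma idrank_diag: "idrank (mat_diag d f) = card {i. i < d \<and> f i = (1 :: 'k::field)}"
proof -
  have "char_poly (mat_diag d f) = (\<Prod>a\<leftarrow>diag_mat (mat_diag d f). [:- a, 1:])"
    by (rule char_poly_upper_triangular[of _ d]) (auto simp: mat_diag_def)
  also have "diag_mat (mat_diag d f) = map f [0..<d]"
    by (auto simp: diag_mat_def mat_diag_def)
  finally have cp: "char_poly (mat_diag d f) = (\<Prod>i\<leftarrow>[0..<d]. [:- f i, 1:])" by (simp add: o_def)
  have "order 1 (\<Prod>i\<leftarrow>[0..<d]. [:- f i, 1:]) = card {i. i < d \<and> f i = 1}" for d
  proof (induction d)
    case (Suc d)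
    have nz: "(\<Prod>i\<leftarrow>[0..<d]. [:- f i, 1:]) \<noteq> 0" by (auto simp: prod_list_zero_iff)
    have o: "order 1 [:- f d, 1:] = (if f d = 1 then 1 else 0)"
      using order_linear_power[of "1::'k" "f d" 1] by (auto simp: order_0I)
    have "{i. i < Suc d \<and> f i = 1} = (if f d = 1 then insert d {i. i < d \<and> f i = 1} else {i. i < d \<and> f i = 1})"
      by (auto simp: less_Suc_eq)
    moreover have "(\<Prod>i\<leftarrow>[0..<Suc d]. [:- f i, 1:]) = (\<Prod>i\<leftarrow>[0..<d]. [:- f i, 1:]) * [:- f d, 1:]"
      by (simp add: mult.commute)
    moreover have "(\<Prod>i\<leftarrow>[0..<d]. [:- f i, 1:]) * [:- f d, 1:] \<noteq> 0" using nz by (simp only: mult_eq_0_iff) simp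
    then have "Polynomial.order 1 ((\<Prod>i\<leftarrow>[0..<d]. [:- f i, 1:]) * [:- f d, 1:])
        = card {i. i < d \<and> f i = 1} + (if f d = 1 then 1 else 0)"
      unfolding o[symmetric] Suc.IH[symmetric] by (rule order_mult)
    ultimately show ?case by (simp del: upt_Suc)
  qed simp
  then show ?thesis by (simp add: idrank_def cp)
qed

text \<open>
  Padding \<open>P\<close> and \<open>Q\<close> with zeros to square matrices would otherwise give
  a one-sided inverse that is not two-sided.
\<close>

lemma inverse_dim_le:
  fixes P :: "'k::field mat"
  assumes P: "P \<in> carrier_mat e d" and Q: "Q \<in> carrier_mat d e" and PQ: "P * Q = 1\<^sub>m e"
  shows "e \<le> d"
proof (rule ccontr)
  assume "\<not> e \<le> d"
  then have de: "d < e" by simp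
  define P' where "P' = mat e e (\<lambda>(i, j). if j < d then P $$ (i, j) else 0)"
  define Q' where "Q' = mat e e (\<lambda>(i, j). if i < d then Q $$ (i, j) else 0)"
  have "P' * Q' = 1\<^sub>m e"
  proof (rule eq_matI)
    fix i j assume "i < dim_row (1\<^sub>m e :: 'k mat)" "j < dim_col (1\<^sub>m e :: 'k mat)"
    then have ij: "i < e" "j < e" by simp_all
    have "(P' * Q') $$ (i, j) = (\<Sum>k<e. P' $$ (i, k) * Q' $$ (k, j))"
      using ij by (subst mat_times_index) (auto simp: P'_def Q'_def)
    also have "\<dots> = (\<Sum>k<d. P $$ (i, k) * Q $$ (k, j))"
      by (rule sum.mono_neutral_cong_right) (use ij de in \<open>auto simp: P'_def Q'_def\<close>)
    also have "\<dots> = (P * Q) $$ (i, j)" using ij P Q by (subst mat_times_index) auto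
    finally show "(P' * Q') $$ (i, j) = 1\<^sub>m e $$ (i, j)" by (simp add: PQ)
  qed (simp_all add: P'_def Q'_def)
  then have "Q' * P' = 1\<^sub>m e"
    by (rule mat_mult_left_right_inverse[rotated 2]) (simp_all add: P'_def Q'_def)
  then have "(Q' * P') $$ (d, d) = 1" using de by simp
  moreover have "(Q' * P') $$ (d, d) = (\<Sum>k<e. Q' $$ (d, k) * P' $$ (k, d))"
    using de by (subst mat_times_index) (auto simp: P'_def Q'_def)
  ultimately show False using de by (simp add: Q'_def)
qed

lemma rep_iso_dim: "rep_iso R S \<Longrightarrow> fst R = fst S"
  unfolding rep_iso_def by (meson inverse_dim_le order_antisym)

lemma idrank_iso:
  assumes "gens_ok R" "gens_ok S" "rep_iso R S"
  shows "idrank (act R f) = idrank (act S f)"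
proof -
  obtain P Q where PQ: "P \<in> carrier_mat (fst S) (fst R)" "Q \<in> carrier_mat (fst R) (fst S)"
    "P * Q = 1\<^sub>m (fst S)" "Q * P = 1\<^sub>m (fst R)" "\<And>g. P * snd R g = snd S g * P"
    using assms(3) by (auto simp: rep_iso_def)
  have d: "fst R = fst S" using assms(3) by (rule rep_iso_dim)
  have "P * act R f * Q = act S f * P * Q" using act_intertwine[OF assms(1,2) PQ(1,5)] by simp
  also have "\<dots> = act S f * (P * Q)"
    using PQ(1,2) unfolding carrier_mat_def by (simp add: mult_assoc_dim)
  finally have "act S f = P * act R f * Q" by (simp add: PQ(3))
  then have "similar_mat (act S f) (act R f)"
    by (intro similar_matI[of _ _ P Q "fst S"]) (use PQ(1-4) d act_carrier[of R f] in auto)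
  then show ?thesis by (simp add: idrank_def char_poly_similar)
qed

lemma idrank_zero_dim: "A \<in> carrier_mat 0 0 \<Longrightarrow> idrank (A :: 'k::field mat) = 0"
  using idrank_diag[of 0 "\<lambda>_. 0 :: 'k"] by (metis (no_types, lifting) Collect_empty_eq card.empty carrier_matD eq_matI mat_diag_dim not_less_zero)

section \<open>Roots of unity\<close>

lemma sum_powers_root_of_unity:
  fixes r :: "'a::field"
  assumes "r ^ n = 1"
  shows "(\<Sum>i<n. r ^ i) = (if r = 1 then of_nat n else 0)"
proof (cases "r = 1")
  case False
  have "(r - 1) * (\<Sum>i<n. r ^ i) = r ^ n - 1" by (simp add: power_diff_1_eq)
  then show ?thesis using False assms by simp
qed simp

lemma primitive_root_power_eq_iff:
  fixes w :: "'a::field"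
  assumes w: "primitive_root_of_unity n w" and n: "n > 0"
  shows "w ^ a = w ^ b \<longleftrightarrow> a mod n = b mod n"
proof -
  have w1: "w ^ n = 1" using w by (simp add: primitive_root_of_unity_def)
  have w0: "w \<noteq> 0" using w1 n by (metis power_0_left zero_neq_one less_not_refl)
  have red: "w ^ a = w ^ (a mod n)" for a
  proof -
    have "w ^ a = w ^ (n * (a div n) + a mod n)" by simp
    also have "\<dots> = w ^ (a mod n)" by (simp only: power_add power_mult w1) simp
    finally show ?thesis .
  qed
  have inj: "i = j" if "i \<le> j" "j < n" "w ^ i = w ^ j" for i j
  proof (rule ccontr)
    assume "i \<noteq> j"
    have "w ^ j = w ^ i * w ^ (j - i)" using that by (metis le_add_diff_inverse power_add)
    then have "w ^ (j - i) = 1" using that w0 by simp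
    moreover have "0 < j - i" "j - i < n" using that \<open>i \<noteq> j\<close> by auto
    ultimately show False using w by (auto simp: primitive_root_of_unity_def)
  qed
  have "a mod n = b mod n" if "w ^ (a mod n) = w ^ (b mod n)"
  proof (cases "a mod n \<le> b mod n")
    case True
    then show ?thesis using inj[OF _ _ that] n by simp
  next
    case False
    then show ?thesis using inj[OF _ _ that[symmetric]] n by simp
  qed
  then show ?thesis using red by metis
qed

lemma sc_left_commute: "f * (sc c * g) = sc c * (f * g :: 'm::monoid_add \<Rightarrow>\<^sub>0 'k::field)"
  by (metis mult.assoc sc_commute)

lemma sc_sc_mult: "sc c * (sc d * f) = sc (c * d) * (f :: 'm::monoid_add \<Rightarrow>\<^sub>0 'k::field)"
  by (simp add: sc_mult flip: mult.assoc)

lemma sc_sum: "sc (\<Sum>i\<in>A. f i) = (\<Sum>i\<in>A. sc (f i) :: 'm::monoid_add \<Rightarrow>\<^sub>0 'k::field)"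
  by (induction A rule: infinite_finite_induct) (simp_all add: sc_add)

locale H_alg =
  fixes n m :: nat and q :: "'k::field"
  assumes n3: "n \<ge> 3" and odd_n: "odd n" and m_eq: "m = (n - 1) div 2"
    and prim: "primitive_root_of_unity n q" and char: "\<not> CHAR('k) dvd 2 * n ^ 2"
begin

lemma n_eq: "n = 2 * m + 1" and m_pos: "m \<ge> 1"
  using n3 odd_n m_eq by (auto elim!: oddE)

lemma of_nat_n_neq_0 [simp]: "(of_nat n :: 'k) \<noteq> 0"
  and two_neq_0 [simp]: "(2 :: 'k) \<noteq> 0"
proof -
  show "(of_nat n :: 'k) \<noteq> 0"
    unfolding of_nat_eq_0_iff_char_dvd using char by (auto simp: power2_eq_square)
  have "(of_nat 2 :: 'k) \<noteq> 0"
    unfolding of_nat_eq_0_iff_char_dvd using char by (auto simp: power2_eq_square)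
  then show "(2 :: 'k) \<noteq> 0" by simp
qed

lemma q_n [simp]: "q ^ n = 1"
  using prim by (simp add: primitive_root_of_unity_def)

lemma q_neq_0 [simp]: "q \<noteq> 0"
  using q_n n3 by (metis power_0_left zero_neq_one not_numeral_le_zero)

lemma q_pow_eq_iff: "q ^ a = q ^ b \<longleftrightarrow> a mod n = b mod n"
  using primitive_root_power_eq_iff[OF prim] n3 by simp

lemma q_pow_mult_n [simp]: "q ^ (a * n) = 1" "q ^ (n * a) = 1"
  by (simp_all add: power_mult mult.commute[of a n])

lemma sum_char:
  "(\<Sum>i<n. inverse (q ^ (a * i)) * q ^ (b * i)) = (if q ^ a = q ^ b then of_nat n else 0)"
proof -
  have "(\<Sum>i<n. inverse (q ^ (a * i)) * q ^ (b * i)) = (\<Sum>i<n. (q ^ b / q ^ a) ^ i)"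
    by (intro sum.cong refl) (simp only: power_divide power_mult, simp add: divide_inverse mult.commute)
  also have "(q ^ b / q ^ a) ^ n = 1"
    by (simp add: power_divide flip: power_mult)
  from sum_powers_root_of_unity[OF this]
  have "(\<Sum>i<n. (q ^ b / q ^ a) ^ i) = (if q ^ a = q ^ b then of_nat n else 0)"
    by (auto simp: field_simps)
  finally show ?thesis .
qed

text \<open>
  The element \<open>z\<^sup>2\<close> acts as \<open>q^(a b)\<close> on a vector of weight
  \<open>(a, b)\<close>: the sum over \<open>i\<close> vanishes unless \<open>j\<close> is
  congruent to \<open>a\<close>, which leaves the term \<open>(q^b)^a\<close>. The factor of the
  comultiplication of \<open>z\<close> is the same sum.
\<close>

lemma gauss_sum:
  "1 / of_nat n * (\<Sum>i<n. \<Sum>j<n. inverse (q ^ (i * j)) * ((q ^ a) ^ i * (q ^ b) ^ j)) = q ^ (a * b)"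
proof -
  define a' where "a' = a mod n"
  have a': "a' < n" "q ^ a = q ^ a'" using n3 by (simp_all add: a'_def q_pow_eq_iff)
  have "(\<Sum>i<n. \<Sum>j<n. inverse (q ^ (i * j)) * ((q ^ a) ^ i * (q ^ b) ^ j))
      = (\<Sum>j<n. (q ^ b) ^ j * (\<Sum>i<n. inverse (q ^ (j * i)) * q ^ (a' * i)))"
    unfolding sum_distrib_left by (subst sum.swap) (intro sum.cong refl, simp only: a'(2), simp add: mult_ac flip: power_mult)
  also have "\<dots> = (\<Sum>j<n. if j = a' then (q ^ b) ^ j * of_nat n else 0)"
    by (intro sum.cong refl) (use a' in \<open>auto simp: sum_char q_pow_eq_iff\<close>)
  also have "\<dots> = (q ^ b) ^ a' * of_nat n" using a' by simp
  also have "(q ^ b) ^ a' = q ^ (a * b)"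
    by (metis a'(2) mult.commute power_mult)
  finally show ?thesis by simp
qed

section \<open>Computations in the quotient algebra\<close>

text \<open>
  Equality in \<open>H\<close>, tested on representatives, so that the ring operations of the free
  algebra remain available.
\<close>

definition eqH :: "'k falg \<Rightarrow> 'k falg \<Rightarrow> bool" (infix "\<approx>" 50) where
  "f \<approx> g \<longleftrightarrow> f - g \<in> H_ideal n q"

lemma eqH_refl [simp]: "f \<approx> f"
  by (simp add: eqH_def ideal_type_algebraD(1)[OF ideal_H])

lemma eqH_sym: "f \<approx> g \<Longrightarrow> g \<approx> f"
  unfolding eqH_def using ideal_type_algebraD(5)[OF ideal_H, of "f - g"] by simp

lemma eqH_trans [trans]: "f \<approx> g \<Longrightarrow> g \<approx> h \<Longrightarrow> f \<approx> h"
  unfolding eqH_def using ideal_type_algebraD(2)[OF ideal_H, of "f - g" n q "g - h"] by simp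

lemma eqH_add: "f \<approx> g \<Longrightarrow> f' \<approx> g' \<Longrightarrow> f + f' \<approx> g + g'"
  unfolding eqH_def using ideal_type_algebraD(2)[OF ideal_H, of "f - g" n q "f' - g'"] by (simp add: algebra_simps)

lemma eqH_left: "f \<approx> g \<Longrightarrow> h * f \<approx> h * g"
  unfolding eqH_def using ideal_type_algebraD(3)[OF ideal_H, of "f - g" n q h] by (simp add: algebra_simps)

lemma eqH_right: "f \<approx> g \<Longrightarrow> f * h \<approx> g * h"
  unfolding eqH_def using ideal_type_algebraD(4)[OF ideal_H, of "f - g" n q h] by (simp add: algebra_simps)

lemma eqH_sum: "(\<And>i. i \<in> A \<Longrightarrow> f i \<approx> g i) \<Longrightarrow> (\<Sum>i\<in>A. f i) \<approx> (\<Sum>i\<in>A. g i)"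
  by (induction A rule: infinite_finite_induct) (auto intro: eqH_add)

lemma act_eqH: "is_rep n q R \<Longrightarrow> f \<approx> g \<Longrightarrow> act R f = act R g"
  by (rule is_rep_act_class) (simp_all add: H_class_iff eqH_def)

lemma relator_eqH: "f - g \<in> relators n q \<Longrightarrow> f \<approx> g"
  unfolding eqH_def H_ideal_def by (rule genideal_type_algebra_self)

lemma rel_x: "gx ^ n \<approx> 1" and rel_y: "gy ^ n \<approx> 1" and rel_xy: "gx * gy \<approx> gy * gx"
  and rel_zx: "gz * gx \<approx> gy * gz" and rel_zy: "gz * gy \<approx> gx * gz"
  and rel_zz: "gz * gz \<approx> sc (1 / of_nat n) *
    (\<Sum>i<n. \<Sum>j<n. sc (inverse (q ^ (i * j))) * gx ^ i * gy ^ j)"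
  by (rule relator_eqH; simp add: relators_def power2_eq_square)+

text \<open>
  The projection onto the eigenspace of \<open>g\<close> for \<open>q^a\<close>, for an element
  with \<open>g^n = 1\<close>.
\<close>

definition proj :: "'k falg \<Rightarrow> nat \<Rightarrow> 'k falg" where
  "proj g a = sc (1 / of_nat n) * (\<Sum>i<n. sc (inverse (q ^ (a * i))) * g ^ i)"

lemma power_intertwine: "h * g \<approx> g' * h \<Longrightarrow> h * g ^ i \<approx> g' ^ i * h"
proof (induction i)
  case (Suc i)
  have "h * g ^ Suc i = (h * g) * g ^ i" by (simp add: mult.assoc)
  also have "\<dots> \<approx> (g' * h) * g ^ i" using Suc.prems by (rule eqH_right)
  also have "\<dots> = g' * (h * g ^ i)" by (simp add: mult.assoc)
  also have "\<dots> \<approx> g' * (g' ^ i * h)" using Suc by (intro eqH_left) simp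
  finally show ?case by (simp add: mult.assoc)
qed simp

lemma proj_intertwine:
  assumes "h * g \<approx> g' * h"
  shows "h * proj g a \<approx> proj g' a * h"
proof -
  have "h * proj g a = sc (1 / of_nat n) * (\<Sum>i<n. sc (inverse (q ^ (a * i))) * (h * g ^ i))"
    by (simp only: proj_def sum_distrib_left sc_left_commute[of h])
  also have "\<dots> \<approx> sc (1 / of_nat n) * (\<Sum>i<n. sc (inverse (q ^ (a * i))) * (g' ^ i * h))"
    by (intro eqH_left eqH_sum power_intertwine assms)
  also have "\<dots> = proj g' a * h"
    by (simp add: proj_def sum_distrib_left sum_distrib_right mult.assoc)
  finally show ?thesis .
qed

text \<open>
  Multiplication by \<open>g\<close> shifts the summation index; the boundary terms cancel because
  \<open>g^n = 1\<close>.
\<close>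

lemma proj_eigen:
  assumes "g ^ n \<approx> 1"
  shows "g * proj g a \<approx> sc (q ^ a) * proj g a"
proof -
  define t where "t i = sc (inverse (q ^ (a * i))) * g ^ i" for i
  have gt: "g * t i = sc (q ^ a) * t (Suc i)" for i
  proof -
    have "q ^ a * inverse (q ^ (a * Suc i)) = inverse (q ^ (a * i))" by (simp add: power_add field_simps)
    then show ?thesis by (simp add: t_def sc_left_commute[of g] sc_sc_mult del: mult_Suc_right)
  qed
  have "(\<Sum>i<n. t (Suc i)) + t 0 = (\<Sum>i<Suc n. t i)" by (subst sum.lessThan_Suc_shift) simp
  then have shift: "(\<Sum>i<n. t (Suc i)) = (\<Sum>i<n. t i) + t n - t 0" by (simp add: algebra_simps)
  have "g * proj g a = sc (1 / of_nat n) * (\<Sum>i<n. g * t i)"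
    by (simp only: proj_def t_def sum_distrib_left sc_left_commute[of g])
  also have "\<dots> = sc (1 / of_nat n) * (sc (q ^ a) * (\<Sum>i<n. t (Suc i)))"
    by (simp add: gt sum_distrib_left)
  also have "\<dots> = sc (1 / of_nat n) * (sc (q ^ a) * ((\<Sum>i<n. t i) + (g ^ n - 1)))"
    unfolding shift by (simp add: t_def add_diff_eq)
  also have "\<dots> \<approx> sc (1 / of_nat n) * (sc (q ^ a) * ((\<Sum>i<n. t i) + 0))"
    by (intro eqH_left eqH_add eqH_refl) (use assms in \<open>simp add: eqH_def\<close>)
  also have "\<dots> = sc (q ^ a) * proj g a"
    by (simp add: proj_def t_def sc_sc_mult mult.commute)
  finally show ?thesis .
qed

lemma proj_commute: "g * proj g a \<approx> proj g a * g"
  by (rule proj_intertwine) simp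

lemma power_on_eigen: "g * f \<approx> sc c * f \<Longrightarrow> g ^ i * f \<approx> sc (c ^ i) * f"
proof (induction i)
  case (Suc i)
  have "g ^ Suc i * f = g * (g ^ i * f)" by (simp add: mult.assoc)
  also have "\<dots> \<approx> g * (sc (c ^ i) * f)" using Suc by (intro eqH_left) simp
  also have "\<dots> = sc (c ^ i) * (g * f)" by (rule sc_left_commute)
  also have "\<dots> \<approx> sc (c ^ i) * (sc c * f)" using Suc.prems by (rule eqH_left)
  finally show ?case by (simp add: sc_sc_mult mult.commute)
qed simp

lemma proj_on_eigen:
  assumes "g * f \<approx> sc (q ^ b) * f"
  shows "proj g a * f \<approx> (if q ^ a = q ^ b then f else 0)"
proof -
  have "proj g a * f = sc (1 / of_nat n) * (\<Sum>i<n. sc (inverse (q ^ (a * i))) * (g ^ i * f))"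
    by (simp add: proj_def sum_distrib_left sum_distrib_right mult.assoc)
  also have "\<dots> \<approx> sc (1 / of_nat n) * (\<Sum>i<n. sc (inverse (q ^ (a * i))) * (sc ((q ^ b) ^ i) * f))"
    by (intro eqH_left eqH_sum power_on_eigen assms)
  also have "\<dots> = sc (1 / of_nat n * (\<Sum>i<n. inverse (q ^ (a * i)) * q ^ (b * i))) * f"
    by (simp only: sc_mult[symmetric] sc_sum sum_distrib_right mult.assoc power_mult)
  also have "\<dots> = (if q ^ a = q ^ b then f else 0)"
    by (simp add: sum_char)
  finally show ?thesis .
qed

lemma sum_proj: "(\<Sum>a<n. proj g a) = 1"
proof -
  have "(\<Sum>a<n. proj g a) = sc (1 / of_nat n) * (\<Sum>i<n. sc (\<Sum>a<n. inverse (q ^ (i * a)) * q ^ (0 * a)) * g ^ i)"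
    unfolding proj_def sum_distrib_left[symmetric]
    by (subst sum.swap) (simp add: sc_sum sum_distrib_right mult.commute)
  also have "\<dots> = sc (1 / of_nat n) * (\<Sum>i<n. if i = 0 then sc (of_nat n) else 0)"
    unfolding sum_char using n3 by (intro arg_cong2[of _ _ _ _ "(*)"] refl sum.cong) (auto simp: q_pow_eq_iff[of _ 0, simplified])
  also have "\<dots> = 1" using n3 by (simp add: sc_mult)
  finally show ?thesis .
qed

text \<open>
  The projection onto the weight space \<open>(a, b)\<close>.
\<close>

definition idem_wt :: "nat \<Rightarrow> nat \<Rightarrow> 'k falg" where
  "idem_wt a b = proj gx a * proj gy b"

lemma x_idem_wt: "gx * idem_wt a b \<approx> sc (q ^ a) * idem_wt a b"
  using eqH_right[OF proj_eigen[OF rel_x], of a "proj gy b"] by (simp add: idem_wt_def mult.assoc)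

lemma y_idem_wt: "gy * idem_wt a b \<approx> sc (q ^ b) * idem_wt a b"
proof -
  have "gy * idem_wt a b = (gy * proj gx a) * proj gy b" by (simp add: idem_wt_def mult.assoc)
  also have "\<dots> \<approx> (proj gx a * gy) * proj gy b"
    by (intro eqH_right proj_intertwine eqH_sym[OF rel_xy])
  also have "\<dots> = proj gx a * (gy * proj gy b)" by (simp add: mult.assoc)
  also have "\<dots> \<approx> proj gx a * (sc (q ^ b) * proj gy b)" by (intro eqH_left proj_eigen rel_y)
  finally show ?thesis by (simp only: idem_wt_def sc_left_commute[of "proj gx a"])
qed

lemma idem_wt_y: "idem_wt a b * gy \<approx> sc (q ^ b) * idem_wt a b"
proof -
  have "idem_wt a b * gy = proj gx a * (proj gy b * gy)" by (simp add: idem_wt_def mult.assoc)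
  also have "\<dots> \<approx> proj gx a * (gy * proj gy b)" by (intro eqH_left eqH_sym[OF proj_commute])
  also have "\<dots> \<approx> proj gx a * (sc (q ^ b) * proj gy b)" by (intro eqH_left proj_eigen rel_y)
  finally show ?thesis by (simp only: idem_wt_def sc_left_commute[of "proj gx a"])
qed

lemma idem_wt_x: "idem_wt a b * gx \<approx> sc (q ^ a) * idem_wt a b"
proof -
  have "idem_wt a b * gx = proj gx a * (proj gy b * gx)" by (simp add: idem_wt_def mult.assoc)
  also have "\<dots> \<approx> proj gx a * (gx * proj gy b)" by (intro eqH_left eqH_sym[OF proj_intertwine] rel_xy)
  also have "\<dots> = (proj gx a * gx) * proj gy b" by (simp add: mult.assoc)
  also have "\<dots> \<approx> (gx * proj gx a) * proj gy b" by (intro eqH_right eqH_sym[OF proj_commute])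
  also have "\<dots> \<approx> (sc (q ^ a) * proj gx a) * proj gy b" by (intro eqH_right proj_eigen rel_x)
  finally show ?thesis by (simp add: idem_wt_def mult.assoc)
qed

lemma z_idem_wt: "gz * idem_wt a b \<approx> idem_wt b a * gz"
proof -
  have xy: "proj gy a * proj gx b \<approx> proj gx b * proj gy a"
  proof -
    have "gx * proj gy a \<approx> proj gy a * gx" by (rule proj_intertwine[OF rel_xy])
    from proj_intertwine[OF eqH_sym[OF this]] show ?thesis .
  qed
  have "gz * idem_wt a b = (gz * proj gx a) * proj gy b" by (simp add: idem_wt_def mult.assoc)
  also have "\<dots> \<approx> (proj gy a * gz) * proj gy b" by (intro eqH_right proj_intertwine rel_zx)
  also have "\<dots> = proj gy a * (gz * proj gy b)" by (simp add: mult.assoc)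
  also have "\<dots> \<approx> proj gy a * (proj gx b * gz)" by (intro eqH_left proj_intertwine rel_zy)
  also have "\<dots> = (proj gy a * proj gx b) * gz" by (simp add: mult.assoc)
  also have "\<dots> \<approx> (proj gx b * proj gy a) * gz" by (intro eqH_right xy)
  finally show ?thesis by (simp add: idem_wt_def)
qed

lemma idem_wt_idem_wt: "idem_wt a b * idem_wt c d \<approx> (if q ^ a = q ^ c \<and> q ^ b = q ^ d then idem_wt c d else 0)"
proof -
  have "idem_wt a b * idem_wt c d = proj gx a * (proj gy b * idem_wt c d)" by (simp add: idem_wt_def mult.assoc)
  also have "\<dots> \<approx> proj gx a * (if q ^ b = q ^ d then idem_wt c d else 0)"
    by (intro eqH_left proj_on_eigen y_idem_wt)
  also have "\<dots> \<approx> (if q ^ a = q ^ c \<and> q ^ b = q ^ d then idem_wt c d else 0)"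
    using proj_on_eigen[OF x_idem_wt, of a c d] by (cases "q ^ b = q ^ d"; cases "q ^ a = q ^ c") simp_all
  finally show ?thesis .
qed

lemma zz_idem_wt: "gz * (gz * idem_wt a b) \<approx> sc (q ^ (a * b)) * idem_wt a b"
proof -
  have "gz * (gz * idem_wt a b) = (gz * gz) * idem_wt a b" by (simp add: mult.assoc)
  also have "\<dots> \<approx> (sc (1 / of_nat n) * (\<Sum>i<n. \<Sum>j<n. sc (inverse (q ^ (i * j))) * gx ^ i * gy ^ j)) * idem_wt a b"
    by (rule eqH_right[OF rel_zz])
  also have "\<dots> = sc (1 / of_nat n) * (\<Sum>i<n. \<Sum>j<n. sc (inverse (q ^ (i * j))) * (gx ^ i * (gy ^ j * idem_wt a b)))"
    by (simp add: sum_distrib_right mult.assoc)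
  also have "\<dots> \<approx> sc (1 / of_nat n) * (\<Sum>i<n. \<Sum>j<n. sc (inverse (q ^ (i * j))) *
      (sc ((q ^ a) ^ i) * (sc ((q ^ b) ^ j) * idem_wt a b)))"
  proof (intro eqH_left eqH_sum)
    fix i j
    have "gx ^ i * (gy ^ j * idem_wt a b) \<approx> gx ^ i * (sc ((q ^ b) ^ j) * idem_wt a b)"
      by (intro eqH_left power_on_eigen y_idem_wt)
    also have "\<dots> = sc ((q ^ b) ^ j) * (gx ^ i * idem_wt a b)" by (rule sc_left_commute)
    also have "\<dots> \<approx> sc ((q ^ b) ^ j) * (sc ((q ^ a) ^ i) * idem_wt a b)" by (intro eqH_left power_on_eigen x_idem_wt)
    finally show "gx ^ i * (gy ^ j * idem_wt a b) \<approx> sc ((q ^ a) ^ i) * (sc ((q ^ b) ^ j) * idem_wt a b)"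
      by (simp add: sc_sc_mult mult.commute)
  qed
  also have "\<dots> = sc (1 / of_nat n * (\<Sum>i<n. \<Sum>j<n. inverse (q ^ (i * j)) * ((q ^ a) ^ i * (q ^ b) ^ j))) * idem_wt a b"
    by (simp only: sc_mult[symmetric] sc_sum sum_distrib_right mult.assoc)
  finally show ?thesis by (simp only: gauss_sum)
qed

lemma sum_idem_wt: "(\<Sum>a<n. \<Sum>b<n. idem_wt a b) = 1"
proof -
  have "(\<Sum>a<n. \<Sum>b<n. idem_wt a b) = (\<Sum>a<n. proj gx a) * (\<Sum>b<n. proj gy b)"
    by (simp add: idem_wt_def sum_product)
  then show ?thesis by (simp add: sum_proj)
qed

text \<open>
  A square root of \<open>q\<close> that is again an \<open>n\<close>-th root of unity; the
  exponent is an integer as \<open>n\<close> is odd.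
\<close>

definition sqrt_q :: 'k where "sqrt_q = q ^ ((n + 1) div 2)"

lemma sqrt_q_sq: "sqrt_q ^ 2 = q"
proof -
  have "(n + 1) div 2 * 2 = n + 1" using n_eq by simp
  then show ?thesis by (simp add: sqrt_q_def flip: power_mult)
qed

lemma sqrt_q_n: "sqrt_q ^ n = 1"
  by (simp add: sqrt_q_def flip: power_mult)

text \<open>
  The eigenvalue of \<open>z\<close> on \<open>dim1 j\<close>. Of the two square roots of
  \<open>q^(j\<^sup>2)\<close>, the sign \<open>(-1)^j\<close> selects the one for which tensoring
  adds the indices (\<open>z_val_add\<close>); replacing \<open>j\<close> by \<open>j + n\<close>
  keeps the weight and changes the root.
\<close>

definition z_val :: "nat \<Rightarrow> 'k" where "z_val j = (-1) ^ j * sqrt_q ^ (j ^ 2)"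

lemma z_val_sq: "z_val j * z_val j = q ^ (j * j)"
proof -
  have "z_val j * z_val j = ((-1) ^ j * (-1) ^ j) * (sqrt_q ^ 2) ^ (j * j)"
    by (simp add: z_val_def power2_eq_square power_mult_distrib)
  also have "(-1) ^ j * (-1) ^ j = (1 :: 'k)" by (simp flip: power_mult_distrib)
  finally show ?thesis by (simp add: sqrt_q_sq)
qed

lemma z_val_neq_0 [simp]: "z_val j \<noteq> 0"
  using z_val_sq[of j] by auto

lemma z_val_add: "z_val (i + j) = z_val i * z_val j * q ^ (i * j)"
proof -
  have "sqrt_q ^ ((i + j) ^ 2) = sqrt_q ^ (i ^ 2) * sqrt_q ^ (j ^ 2) * (sqrt_q ^ 2) ^ (i * j)"
    by (simp add: power2_sum algebra_simps flip: power_add power_mult)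
  then show ?thesis by (simp add: z_val_def sqrt_q_sq power_add)
qed

lemma z_val_n: "z_val n = -1"
  using odd_n by (simp add: z_val_def power2_eq_square power_mult sqrt_q_n)

lemma z_val_add_n: "z_val (j + n) = - z_val j"
  by (simp add: z_val_add z_val_n)

text \<open>
  The part of \<open>idem_wt j j\<close> on which \<open>z\<close> acts as \<open>z_val j\<close>,
  namely \<open>idem_wt j j * (1 + z / z_val j) / 2\<close>.
\<close>

definition idem1 :: "nat \<Rightarrow> 'k falg" where
  "idem1 j = sc (1 / 2) * idem_wt j j + sc (inverse (z_val j) / 2) * (idem_wt j j * gz)"

lemma x_idem1: "gx * idem1 j \<approx> sc (q ^ j) * idem1 j" and y_idem1: "gy * idem1 j \<approx> sc (q ^ j) * idem1 j"
proof -
  have *: "g * idem1 j \<approx> sc (q ^ j) * idem1 j" if "g * idem_wt j j \<approx> sc (q ^ j) * idem_wt j j" for g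
  proof -
    have "g * idem1 j = sc (1 / 2) * (g * idem_wt j j) + sc (inverse (z_val j) / 2) * ((g * idem_wt j j) * gz)"
      by (simp add: idem1_def distrib_left sc_left_commute[of g] mult.assoc)
    also have "\<dots> \<approx> sc (1 / 2) * (sc (q ^ j) * idem_wt j j) + sc (inverse (z_val j) / 2) * ((sc (q ^ j) * idem_wt j j) * gz)"
      by (intro eqH_add eqH_left eqH_right that)
    finally show ?thesis by (simp add: idem1_def distrib_left sc_sc_mult mult.assoc mult.commute)
  qed
  show "gx * idem1 j \<approx> sc (q ^ j) * idem1 j" by (rule *[OF x_idem_wt])
  show "gy * idem1 j \<approx> sc (q ^ j) * idem1 j" by (rule *[OF y_idem_wt])
qed

lemma idem1_xy:
  assumes "idem_wt j j * g \<approx> sc (q ^ j) * idem_wt j j" "idem_wt j j * g' \<approx> sc (q ^ j) * idem_wt j j" "gz * g \<approx> g' * gz"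
  shows "idem1 j * g \<approx> sc (q ^ j) * idem1 j"
proof -
  have "idem1 j * g = sc (1 / 2) * (idem_wt j j * g) + sc (inverse (z_val j) / 2) * (idem_wt j j * (gz * g))"
    by (simp add: idem1_def distrib_right mult.assoc)
  also have "\<dots> \<approx> sc (1 / 2) * (idem_wt j j * g) + sc (inverse (z_val j) / 2) * (idem_wt j j * (g' * gz))"
    by (intro eqH_add eqH_left eqH_refl assms)
  also have "\<dots> = sc (1 / 2) * (idem_wt j j * g) + sc (inverse (z_val j) / 2) * ((idem_wt j j * g') * gz)"
    by (simp add: mult.assoc)
  also have "\<dots> \<approx> sc (1 / 2) * (sc (q ^ j) * idem_wt j j) + sc (inverse (z_val j) / 2) * ((sc (q ^ j) * idem_wt j j) * gz)"
    by (intro eqH_add eqH_left eqH_right assms)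
  finally show ?thesis by (simp add: idem1_def distrib_left sc_sc_mult mult.assoc mult.commute)
qed

lemma idem1_x: "idem1 j * gx \<approx> sc (q ^ j) * idem1 j"
  by (rule idem1_xy[OF idem_wt_x idem_wt_y rel_zx])

lemma idem1_y: "idem1 j * gy \<approx> sc (q ^ j) * idem1 j"
  by (rule idem1_xy[OF idem_wt_y idem_wt_x rel_zy])

lemma idem_wt_zz: "idem_wt a b * (gz * gz) \<approx> sc (q ^ (a * b)) * idem_wt a b"
proof -
  have "idem_wt a b * (gz * gz) = (idem_wt a b * gz) * gz" by (simp add: mult.assoc)
  also have "\<dots> \<approx> (gz * idem_wt b a) * gz" by (intro eqH_right eqH_sym[OF z_idem_wt])
  also have "\<dots> = gz * (idem_wt b a * gz)" by (simp add: mult.assoc)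
  also have "\<dots> \<approx> gz * (gz * idem_wt a b)" by (intro eqH_left eqH_sym[OF z_idem_wt])
  also have "\<dots> \<approx> sc (q ^ (a * b)) * idem_wt a b" by (rule zz_idem_wt)
  finally show ?thesis .
qed

lemma idem1_z: "idem1 j * gz \<approx> sc (z_val j) * idem1 j"
proof -
  have "idem1 j * gz = sc (1 / 2) * (idem_wt j j * gz) + sc (inverse (z_val j) / 2) * (idem_wt j j * (gz * gz))"
    by (simp add: idem1_def distrib_right mult.assoc)
  also have "\<dots> \<approx> sc (1 / 2) * (idem_wt j j * gz) + sc (inverse (z_val j) / 2) * (sc (q ^ (j * j)) * idem_wt j j)"
    by (intro eqH_add eqH_left eqH_refl idem_wt_zz)
  also have "inverse (z_val j) / 2 * q ^ (j * j) = z_val j / 2" by (simp add: field_simps flip: z_val_sq)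
  then have "sc (inverse (z_val j) / 2) * (sc (q ^ (j * j)) * idem_wt j j) = sc (z_val j / 2) * idem_wt j j"
    by (simp add: sc_sc_mult)
  finally show ?thesis by (simp add: idem1_def distrib_left sc_sc_mult add.commute)
qed

lemma z_idem1: "gz * idem1 j \<approx> sc (z_val j) * idem1 j"
proof -
  have "gz * idem1 j = sc (1 / 2) * (gz * idem_wt j j) + sc (inverse (z_val j) / 2) * ((gz * idem_wt j j) * gz)"
    by (simp add: idem1_def distrib_left sc_left_commute[of gz] mult.assoc)
  also have "\<dots> \<approx> sc (1 / 2) * (idem_wt j j * gz) + sc (inverse (z_val j) / 2) * ((idem_wt j j * gz) * gz)"
    by (intro eqH_add eqH_left eqH_right z_idem_wt)
  also have "\<dots> = idem1 j * gz" by (simp add: idem1_def distrib_right mult.assoc)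
  also have "\<dots> \<approx> sc (z_val j) * idem1 j" by (rule idem1_z)
  finally show ?thesis .
qed

lemma idem1_idem1: "idem1 j * idem1 j \<approx> idem1 j"
proof -
  have e: "idem_wt j j * idem1 j \<approx> idem1 j"
  proof -
    have "idem_wt j j * idem1 j = sc (1 / 2) * (idem_wt j j * idem_wt j j) + sc (inverse (z_val j) / 2) * ((idem_wt j j * idem_wt j j) * gz)"
      by (simp add: idem1_def distrib_left sc_left_commute[of "idem_wt j j"] mult.assoc)
    also have "\<dots> \<approx> sc (1 / 2) * idem_wt j j + sc (inverse (z_val j) / 2) * (idem_wt j j * gz)"
      by (intro eqH_add eqH_left eqH_right) (use idem_wt_idem_wt[of j j j j] in simp_all)
    finally show ?thesis by (simp add: idem1_def)
  qed
  have "idem1 j * idem1 j = sc (1 / 2) * (idem_wt j j * idem1 j) + sc (inverse (z_val j) / 2) * (idem_wt j j * (gz * idem1 j))"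
    by (simp add: idem1_def[of j] distrib_right mult.assoc)
  also have "\<dots> \<approx> sc (1 / 2) * (idem_wt j j * idem1 j) + sc (inverse (z_val j) / 2) * (idem_wt j j * (sc (z_val j) * idem1 j))"
    by (intro eqH_add eqH_left eqH_refl z_idem1)
  also have "\<dots> = (sc (1 / 2) + sc (1 / 2)) * (idem_wt j j * idem1 j)"
    by (simp add: sc_left_commute[of "idem_wt j j"] sc_sc_mult distrib_right)
  also have "\<dots> = idem_wt j j * idem1 j" by (simp flip: sc_add)
  also have "\<dots> \<approx> idem1 j" by (rule e)
  finally show ?thesis .
qed

lemma idem1_sum: "idem1 j + idem1 (j + n) = idem_wt j j"
proof -
  have "q ^ (j + n) = q ^ j" by (simp add: power_add)
  then have "proj g (j + n) = proj g j" for g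
    by (simp add: proj_def power_mult)
  then have "idem_wt (j + n) (j + n) = idem_wt j j" by (simp add: idem_wt_def)
  then have "idem1 j + idem1 (j + n) = (sc (1 / 2) + sc (1 / 2)) * idem_wt j j
      + (sc (inverse (z_val j) / 2) + sc (- (inverse (z_val j) / 2))) * (idem_wt j j * gz)"
    by (simp add: idem1_def z_val_add_n distrib_right)
  also have "\<dots> = sc (1 / 2 + 1 / 2) * idem_wt j j + sc (inverse (z_val j) / 2 + - (inverse (z_val j) / 2)) * (idem_wt j j * gz)"
    by (simp only: sc_add)
  also have "\<dots> = idem_wt j j" by simp
  finally show ?thesis .
qed

end

lemma mat_diag_index [simp]: "i < d \<Longrightarrow> j < d \<Longrightarrow> mat_diag d f $$ (i, j) = (if i = j then f j else 0)"
  by (simp add: mat_diag_def)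

lemma mat_diag_dims [simp]: "dim_row (mat_diag d f) = d" "dim_col (mat_diag d f) = d"
  by (simp_all add: mat_diag_def)

lemma act_power_diag:
  assumes "gens_ok R" "act R g = mat_diag (fst R) x"
  shows "act R (g ^ i) = mat_diag (fst R) (\<lambda>r. x r ^ i)"
proof (induction i)
  case 0
  then show ?case using assms by (simp add: act_def ev_one)
next
  case (Suc i)
  have "act R (g ^ Suc i) = act R g * act R (g ^ i)"
    using assms by (simp add: act_def ev_mult)
  then show ?case by (simp add: assms Suc)
qed

text \<open>
  Renumbering the basis is conjugation by a permutation matrix.
\<close>

lemma rep_reindex:
  assumes R: "gens_ok R" and d: "fst R = d" and \<pi>: "bij_betw \<pi> {..<d} {..<d}"
  shows "rep_iso R (d, \<lambda>g. mat d d (\<lambda>(i, j). snd R g $$ (\<pi> i, \<pi> j)))"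
proof -
  have \<pi>l: "\<pi> i < d" if "i < d" for i using bij_betwE[OF \<pi>] that by auto
  have \<pi>i: "\<pi> i = \<pi> j \<longleftrightarrow> i = j" if "i < d" "j < d" for i j
    using bij_betw_imp_inj_on[OF \<pi>] that by (auto dest: inj_onD)
  define P where "P = mat d d (\<lambda>(i, j). if j = \<pi> i then 1 else 0 :: 'a)"
  define Q where "Q = mat d d (\<lambda>(i, j). if i = \<pi> j then 1 else 0 :: 'a)"
  have PQ: "P * Q = 1\<^sub>m d"
  proof (rule eq_matI)
    fix i j assume "i < dim_row (1\<^sub>m d :: 'a mat)" "j < dim_col (1\<^sub>m d :: 'a mat)"
    then have ij: "i < d" "j < d" by simp_all
    have "(P * Q) $$ (i, j) = (\<Sum>k<d. P $$ (i, k) * Q $$ (k, j))"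
      using ij by (subst mat_times_index) (auto simp: P_def Q_def)
    also have "\<dots> = (\<Sum>k<d. if k = \<pi> i then (if \<pi> i = \<pi> j then 1 else 0) else 0)"
      by (rule sum.cong) (use ij in \<open>auto simp: P_def Q_def\<close>)
    also have "\<dots> = 1\<^sub>m d $$ (i, j)" using ij \<pi>l \<pi>i by simp
    finally show "(P * Q) $$ (i, j) = 1\<^sub>m d $$ (i, j)" .
  qed (simp_all add: P_def Q_def)
  have QP: "Q * P = 1\<^sub>m d"
    by (rule mat_mult_left_right_inverse[OF _ _ PQ]) (simp_all add: P_def Q_def)
  have "P * snd R g = mat d d (\<lambda>(i, j). snd R g $$ (\<pi> i, \<pi> j)) * P" for g
  proof (rule eq_matI)
    let ?S = "mat d d (\<lambda>(i, j). snd R g $$ (\<pi> i, \<pi> j))"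
    note \<phi> = gens_inD[OF R, of g, unfolded d]
    fix i j assume "i < dim_row (?S * P)" "j < dim_col (?S * P)"
    then have ij: "i < d" "j < d" by (simp_all add: P_def)
    have "(P * snd R g) $$ (i, j) = (\<Sum>k<d. P $$ (i, k) * snd R g $$ (k, j))"
      using ij \<phi> by (subst mat_times_index) (auto simp: P_def)
    also have "\<dots> = (\<Sum>k<d. if k = \<pi> i then snd R g $$ (\<pi> i, j) else 0)"
      by (rule sum.cong) (use ij in \<open>auto simp: P_def\<close>)
    also have "\<dots> = (\<Sum>k<d. if k = j then snd R g $$ (\<pi> i, k) else 0)"
      using ij \<pi>l by simp
    also have "\<dots> = (\<Sum>k<d. if \<pi> k = j then snd R g $$ (\<pi> i, \<pi> k) else 0)"
      by (rule sum.reindex_bij_betw[OF \<pi>, symmetric])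
    also have "\<dots> = (\<Sum>k<d. ?S $$ (i, k) * P $$ (k, j))"
      by (rule sum.cong) (use ij in \<open>auto simp: P_def\<close>)
    also have "\<dots> = (?S * P) $$ (i, j)" using ij by (subst mat_times_index) (auto simp: P_def)
    finally show "(P * snd R g) $$ (i, j) = (?S * P) $$ (i, j)" .
  qed (use gens_inD[OF R, of g] d in \<open>auto simp: P_def\<close>)
  then show ?thesis unfolding rep_iso_def
    by (intro bexI[of _ P] bexI[of _ Q]) (use PQ QP in \<open>auto simp: P_def Q_def d\<close>)
qed

context H_alg
begin

section \<open>Representations in a weight basis\<close>

definition weight_rep :: "nat \<Rightarrow> (nat \<Rightarrow> nat) \<Rightarrow> (nat \<Rightarrow> nat) \<Rightarrow> 'k mat \<Rightarrow> 'k rep" where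
  "weight_rep d a b Z = (d, \<lambda>g. case g of GenX \<Rightarrow> mat_diag d (\<lambda>i. q ^ a i)
     | GenY \<Rightarrow> mat_diag d (\<lambda>i. q ^ b i) | GenZ \<Rightarrow> Z)"

lemma fst_weight_rep [simp]: "fst (weight_rep d a b Z) = d"
  by (simp add: weight_rep_def)

lemma gens_ok_weight: "Z \<in> carrier_mat d d \<Longrightarrow> gens_ok (weight_rep d a b Z)"
  by (auto simp: gens_in_def weight_rep_def split: gen.split)

lemma weight_rep_cong:
  assumes "\<And>i. i < d \<Longrightarrow> q ^ a i = q ^ a' i" "\<And>i. i < d \<Longrightarrow> q ^ b i = q ^ b' i" "Z = Z'"
  shows "weight_rep d a b Z = weight_rep d a' b' Z'"
proof -
  have "mat_diag d (\<lambda>i. q ^ a i) = mat_diag d (\<lambda>i. q ^ a' i)" "mat_diag d (\<lambda>i. q ^ b i) = mat_diag d (\<lambda>i. q ^ b' i)"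
    by (rule eq_matI; use assms in simp)+
  then show ?thesis using assms(3) by (auto simp: weight_rep_def fun_eq_iff split: gen.split)
qed

context
  fixes d a b Z and R
  assumes Z: "Z \<in> carrier_mat d d" and R_def: "R = weight_rep d a b Z"
begin

lemma act_weight_gens:
  "act R gx = mat_diag d (\<lambda>i. q ^ a i)" "act R gy = mat_diag d (\<lambda>i. q ^ b i)" "act R gz = Z"
  using gens_ok_weight[OF Z, of a b] by (simp_all add: R_def act_def ev_letter) (simp_all add: weight_rep_def)

lemma gens_ok_R: "gens_ok R" and fst_R: "fst R = d"
  using gens_ok_weight[OF Z] by (simp_all add: R_def)

lemma act_weight_power:
  "act R (gx ^ i) = mat_diag d (\<lambda>r. (q ^ a r) ^ i)" "act R (gy ^ i) = mat_diag d (\<lambda>r. (q ^ b r) ^ i)"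
  using act_power_diag[OF gens_ok_R, of _ _ i] by (simp_all add: fst_R act_weight_gens)

lemma act_R_mult: "act R (f * g) = act R f * act R g"
  by (simp add: act_def ev_mult[OF gens_ok_R])

lemma act_R_sum: "r < d \<Longrightarrow> c < d \<Longrightarrow> act R (\<Sum>i\<in>A. f i) $$ (r, c) = (\<Sum>i\<in>A. act R (f i) $$ (r, c))"
  unfolding act_def by (rule ev_sum_entry) (simp_all add: fst_R)

lemma act_R_sc: "r < d \<Longrightarrow> c < d \<Longrightarrow> act R (sc x * f) $$ (r, c) = x * act R f $$ (r, c)"
  unfolding act_def ev_sc_mult[OF gens_ok_R] using ev_dim[of "fst R" "snd R" f] by (simp add: fst_R)

lemma act_weight_xz:
  assumes "r < d" "c < d"
  shows "act R (gx ^ i * gz) $$ (r, c) = (q ^ a r) ^ i * Z $$ (r, c)"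
    "act R (gy ^ i * gz) $$ (r, c) = (q ^ b r) ^ i * Z $$ (r, c)"
  using assms by (simp_all add: act_R_mult act_weight_power act_weight_gens mat_diag_mult_left[OF Z])

text \<open>
  In a weight basis the relations \<open>z x = y z\<close> and \<open>z y = x z\<close> say which
  entries of \<open>z\<close> may be nonzero, and the Gauss sum turns the last relation into a
  condition on \<open>Z * Z\<close>.
\<close>

lemma is_rep_weight:
  assumes wt: "\<And>r c. r < d \<Longrightarrow> c < d \<Longrightarrow> Z $$ (r, c) \<noteq> 0 \<Longrightarrow> q ^ a r = q ^ b c \<and> q ^ b r = q ^ a c"
    and ZZ: "Z * Z = mat_diag d (\<lambda>r. q ^ (a r * b r))"
  shows "is_rep n q R"
proof -
  have one: "act R 1 = 1\<^sub>m d" using ev_one[OF gens_ok_R] by (simp add: act_def fst_R)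
  have pw: "(q ^ k) ^ n = 1" for k by (simp flip: power_mult)
  have 1: "act R (gx ^ n) = act R 1" "act R (gy ^ n) = act R 1"
    by (simp_all only: act_weight_power pw one mat_diag_one)
  have 2: "act R (gx * gy) = act R (gy * gx)"
    by (simp add: act_R_mult act_weight_gens mult.commute)
  have wt': "Z $$ (r, c) * q ^ a c = q ^ b r * Z $$ (r, c)" "Z $$ (r, c) * q ^ b c = q ^ a r * Z $$ (r, c)"
    if "r < d" "c < d" for r c
    using wt[OF that] by (cases "Z $$ (r, c) = 0"; simp)+
  have 3: "act R (gz * gx) = act R (gy * gz)"
    unfolding act_R_mult act_weight_gens mat_diag_mult_left[OF Z] mat_diag_mult_right[OF Z]
    by (rule eq_matI) (use wt' in simp_all)
  have 4: "act R (gz * gy) = act R (gx * gz)"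
    unfolding act_R_mult act_weight_gens mat_diag_mult_left[OF Z] mat_diag_mult_right[OF Z]
    by (rule eq_matI) (use wt' in simp_all)
  have 5: "act R (gz ^ 2) = act R (sc (1 / of_nat n) * (\<Sum>i<n. \<Sum>j<n. sc (inverse (q ^ (i * j))) * gx ^ i * gy ^ j))"
    (is "_ = act R ?J")
  proof (rule eq_matI)
    fix r c assume "r < dim_row (act R ?J)" "c < dim_col (act R ?J)"
    then have rc: "r < d" "c < d" by (simp_all add: fst_R)
    have "act R (gx ^ i * gy ^ j) $$ (r, c) = (if r = c then (q ^ a r) ^ i * (q ^ b r) ^ j else 0)" for i j
      using rc by (simp add: act_R_mult act_weight_power)
    then have "act R ?J $$ (r, c) = 1 / of_nat n * (\<Sum>i<n. \<Sum>j<n. inverse (q ^ (i * j)) *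
        (if r = c then (q ^ a r) ^ i * (q ^ b r) ^ j else 0))"
      using rc by (simp only: act_R_sc act_R_sum mult.assoc)
    also have "\<dots> = (if r = c then 1 / of_nat n * (\<Sum>i<n. \<Sum>j<n. inverse (q ^ (i * j)) * ((q ^ a r) ^ i * (q ^ b r) ^ j)) else 0)"
      by simp
    also have "\<dots> = act R (gz ^ 2) $$ (r, c)"
      unfolding gauss_sum using rc by (simp add: power2_eq_square act_R_mult act_weight_gens ZZ)
    finally show "act R (gz ^ 2) $$ (r, c) = act R ?J $$ (r, c)" by simp
  qed (simp_all add: fst_R)
  show ?thesis
    using 1 2 3 4 5 gens_ok_R ev_eq_iff[OF gens_ok_R]
    by (auto simp: is_rep_def relators_def act_def)
qed

lemma act_weight_proj:
  "act R (proj gx s) = mat_diag d (\<lambda>r. if q ^ a r = q ^ s then 1 else 0)"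
  "act R (proj gy s) = mat_diag d (\<lambda>r. if q ^ b r = q ^ s then 1 else 0)"
proof -
  have *: "act R (proj g s) = mat_diag d (\<lambda>r. if q ^ w r = q ^ s then 1 else 0)"
    if "\<And>i. act R (g ^ i) = mat_diag d (\<lambda>r. (q ^ w r) ^ i)" for g w
  proof (rule eq_matI)
    fix r c assume "r < dim_row (mat_diag d (\<lambda>r. if q ^ w r = q ^ s then 1 else 0 :: 'k))"
      "c < dim_col (mat_diag d (\<lambda>r. if q ^ w r = q ^ s then 1 else 0 :: 'k))"
    then have rc: "r < d" "c < d" by (simp_all add: mat_diag_def)
    have "act R (proj g s) $$ (r, c)
        = 1 / of_nat n * (\<Sum>i<n. inverse (q ^ (s * i)) * (if r = c then q ^ (w c * i) else 0))"
      using rc unfolding proj_def by (simp only: act_R_sc act_R_sum that mat_diag_index power_mult)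
    also have "\<dots> = (if r = c then 1 / of_nat n * (\<Sum>i<n. inverse (q ^ (s * i)) * q ^ (w c * i)) else 0)" by simp
    finally show "act R (proj g s) $$ (r, c) = mat_diag d (\<lambda>r. if q ^ w r = q ^ s then 1 else 0) $$ (r, c)"
      using rc by (simp add: sum_char)
  qed (simp_all add: fst_R)
  show "act R (proj gx s) = mat_diag d (\<lambda>r. if q ^ a r = q ^ s then 1 else 0)"
    "act R (proj gy s) = mat_diag d (\<lambda>r. if q ^ b r = q ^ s then 1 else 0)"
    by (rule *, rule act_weight_power)+
qed

lemma act_weight_idem_wt:
  "act R (idem_wt s t) = mat_diag d (\<lambda>r. if q ^ a r = q ^ s \<and> q ^ b r = q ^ t then 1 else 0)"
  unfolding idem_wt_def act_R_mult act_weight_proj by (auto intro!: arg_cong[of _ _ "mat_diag d"])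

lemma act_weight_idem1:
  assumes "r < d" "c < d"
  shows "act R (idem1 j) $$ (r, c) = (if q ^ a r = q ^ j \<and> q ^ b r = q ^ j
    then ((if r = c then 1 else 0) + inverse (z_val j) * Z $$ (r, c)) / 2 else 0)"
proof -
  have "act R (idem1 j) $$ (r, c) = 1 / 2 * act R (idem_wt j j) $$ (r, c) + inverse (z_val j) / 2 * act R (idem_wt j j * gz) $$ (r, c)"
    using assms act_R_sc[OF assms] ev_dim[of "fst R" "snd R"]
    unfolding idem1_def act_def by (simp add: ev_add fst_R)
  also have "act R (idem_wt j j * gz) $$ (r, c) = (if q ^ a r = q ^ j \<and> q ^ b r = q ^ j then 1 else 0) * Z $$ (r, c)"
    using assms by (simp add: act_R_mult act_weight_idem_wt act_weight_gens mat_diag_mult_left[OF Z])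
  finally show ?thesis using assms
    by (cases "q ^ a r = q ^ j \<and> q ^ b r = q ^ j") (auto simp: act_weight_idem_wt field_simps)
qed

end

text \<open>
  The Gauss sum collapses the double sum in the comultiplication of \<open>z\<close> to the factor
  \<open>q^(a b')\<close>, with the \<open>x\<close>-weight of the first and the
  \<open>y\<close>-weight of the second factor of the row.
\<close>

lemma rep_tensor_weight:
  assumes Z: "Z \<in> carrier_mat d d" and Z': "Z' \<in> carrier_mat e e"
  shows "rep_tensor n q (weight_rep d a b Z) (weight_rep e a' b' Z')
    = weight_rep (d * e) (\<lambda>r. a (r div e) + a' (r mod e)) (\<lambda>r. b (r div e) + b' (r mod e))
       (mat (d * e) (d * e) (\<lambda>(r, c). q ^ (a (r div e) * b' (r mod e)) *
          Z $$ (r div e, c div e) * Z' $$ (r mod e, c mod e)))" (is "rep_tensor n q ?R ?S = ?T")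
proof -
  note gR = gens_ok_R[OF Z refl, of a b] and gS = gens_ok_R[OF Z' refl, of a' b']
  have diag: "kronecker (mat_diag d f) (mat_diag e g) = mat_diag (d * e) (\<lambda>r. f (r div e) * g (r mod e))" for f g :: "nat \<Rightarrow> 'k"
  proof (rule eq_matI)
    fix i j assume "i < dim_row (mat_diag (d * e) (\<lambda>r. f (r div e) * g (r mod e)))"
      "j < dim_col (mat_diag (d * e) (\<lambda>r. f (r div e) * g (r mod e)))"
    then have ij: "i < d * e" "j < d * e" by simp_all
    have "i = j" if "i div e = j div e" "i mod e = j mod e" using that by (metis div_mult_mod_eq)
    then show "kronecker (mat_diag d f) (mat_diag e g) $$ (i, j) = mat_diag (d * e) (\<lambda>r. f (r div e) * g (r mod e)) $$ (i, j)"
      using ij div_mod_less[OF ij(1)] div_mod_less[OF ij(2)] by (auto simp: kronecker_index)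
  qed simp_all
  have X: "act2_rep ?R ?S (comult_gen n q GenX) = snd ?T GenX"
    and Y: "act2_rep ?R ?S (comult_gen n q GenY) = snd ?T GenY"
    by (simp_all add: act2_rep_tens[OF gR gS] act_weight_gens[OF Z refl] act_weight_gens[OF Z' refl] diag)
       (simp_all add: weight_rep_def power_add)
  have Zs: "act2_rep ?R ?S (comult_gen n q GenZ) = snd ?T GenZ"
  proof (rule eq_matI)
    fix r c assume "r < dim_row (snd ?T GenZ)" "c < dim_col (snd ?T GenZ)"
    then have rc: "r < d * e" "c < d * e" by (simp_all add: weight_rep_def)
    note bd = div_mod_less[OF rc(1)] div_mod_less[OF rc(2)]
    note mr = monoid_rep_word_kron[OF gR gS]
    have scm: "act2_rep ?R ?S (sc x * f) $$ (r, c) = x * act2_rep ?R ?S f $$ (r, c)" for x f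
    proof -
      have "act2_rep ?R ?S (sc x * f) = (x \<cdot>\<^sub>m 1\<^sub>m (d * e)) * act2_rep ?R ?S f"
        using lin_ext_mult[OF mr] lin_ext_sc[OF mr] by (simp add: act2_rep_def)
      also have "\<dots> = x \<cdot>\<^sub>m act2_rep ?R ?S f"
        using mult_smult_assoc_mat[of "1\<^sub>m (d * e)" "d * e" "d * e" "act2_rep ?R ?S f" "d * e" x]
          act2_rep_carrier[of ?R ?S f] by auto
      finally show ?thesis using rc act2_rep_carrier[of ?R ?S f] by simp
    qed
    have sm: "act2_rep ?R ?S (\<Sum>i\<in>A. f i) $$ (r, c) = (\<Sum>i\<in>A. act2_rep ?R ?S (f i) $$ (r, c))" for A :: "nat set" and f
      unfolding act2_rep_def using rc by (intro lin_ext_sum_entry) simp_all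
    have te: "act2_rep ?R ?S (tens (gx ^ i * gz) (gy ^ j * gz)) $$ (r, c)
      = ((q ^ a (r div e)) ^ i * (q ^ b' (r mod e)) ^ j) * (Z $$ (r div e, c div e) * Z' $$ (r mod e, c mod e))" for i j
      using rc bd by (simp add: act2_rep_tens[OF gR gS] kronecker_index act_weight_xz[OF Z refl] act_weight_xz[OF Z' refl] mult_ac)
    have "act2_rep ?R ?S (comult_gen n q GenZ) $$ (r, c)
      = (1 / of_nat n * (\<Sum>i<n. \<Sum>j<n. inverse (q ^ (i * j)) * ((q ^ a (r div e)) ^ i * (q ^ b' (r mod e)) ^ j)))
        * (Z $$ (r div e, c div e) * Z' $$ (r mod e, c mod e))"
      by (simp only: comult_gen.simps scm sm te sum_distrib_right mult.assoc)
    then show "act2_rep ?R ?S (comult_gen n q GenZ) $$ (r, c) = snd ?T GenZ $$ (r, c)"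
      unfolding gauss_sum using rc by (simp add: weight_rep_def mult.assoc)
  qed (simp_all add: weight_rep_def act2_rep_def)
  have "act2_rep ?R ?S (comult_gen n q g) = snd ?T g" for g
    by (cases g) (use X Y Zs in auto)
  then show ?thesis by (simp add: rep_tensor_def prod_eq_iff fun_eq_iff)
qed

section \<open>The simple modules\<close>

definition dim1 :: "nat \<Rightarrow> 'k rep" where
  "dim1 j = weight_rep 1 (\<lambda>_. j) (\<lambda>_. j) (mat 1 1 (\<lambda>_. z_val j))"

definition swap_mat :: "'k \<Rightarrow> 'k \<Rightarrow> 'k mat" where
  "swap_mat \<alpha> \<beta> = mat 2 2 (\<lambda>(i, j). if i = 0 \<and> j = 1 then \<beta> else if i = 1 \<and> j = 0 then \<alpha> else 0)"

text \<open>
  A basis of two vectors of weights \<open>(a, b)\<close> and \<open>(b, a)\<close> that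
  \<open>z\<close> exchanges up to scalars. Tensor products yield this form with varying scalars,
  but only the product \<open>\<alpha> * \<beta>\<close> matters up to isomorphism
  (\<open>swap_rep_iso_dim2\<close>).
\<close>

definition swap_rep :: "nat \<Rightarrow> nat \<Rightarrow> 'k \<Rightarrow> 'k \<Rightarrow> 'k rep" where
  "swap_rep a b \<alpha> \<beta> = weight_rep 2 (\<lambda>i. if i = 0 then a else b) (\<lambda>i. if i = 0 then b else a) (swap_mat \<alpha> \<beta>)"

text \<open>
  Also used for \<open>a\<close> congruent to \<open>b\<close>, where it is not simple
  (\<open>dim2_diag\<close>); this keeps the rule for tensor products free of case distinctions.
\<close>

definition dim2 :: "nat \<Rightarrow> nat \<Rightarrow> 'k rep" where
  "dim2 a b = swap_rep a b 1 (q ^ (a * b))"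

lemma swap_mat_carrier [simp]: "swap_mat \<alpha> \<beta> \<in> carrier_mat 2 2"
  by (simp add: swap_mat_def)

lemma swap_mat_dim [simp]: "dim_row (swap_mat \<alpha> \<beta>) = 2" "dim_col (swap_mat \<alpha> \<beta>) = 2"
  by (simp_all add: swap_mat_def)

lemma swap_mat_index [simp]:
  "swap_mat \<alpha> \<beta> $$ (0, 0) = 0" "swap_mat \<alpha> \<beta> $$ (0, Suc 0) = \<beta>"
  "swap_mat \<alpha> \<beta> $$ (Suc 0, 0) = \<alpha>" "swap_mat \<alpha> \<beta> $$ (Suc 0, Suc 0) = 0"
  by (simp_all add: swap_mat_def)

lemma sum_less_2: "(\<Sum>i<2. f i) = f 0 + (f (Suc 0) :: 'a::comm_monoid_add)"
  by (simp add: numeral_2_eq_2)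

lemma fst_simples [simp]: "fst (dim1 j) = 1" "fst (swap_rep a b \<alpha> \<beta>) = 2" "fst (dim2 a b) = 2"
  by (simp_all add: dim1_def swap_rep_def dim2_def)

lemma gens_ok_simples [simp]: "gens_in (Suc 0) (snd (dim1 j))" "gens_in 2 (snd (swap_rep a b \<alpha> \<beta>))" "gens_in 2 (snd (dim2 a b))"
proof -
  have "gens_ok (dim1 j)" "gens_ok (swap_rep a b \<alpha> \<beta>)" "gens_ok (dim2 a b)"
    unfolding dim1_def swap_rep_def dim2_def by (rule gens_ok_weight; simp)+
  then show "gens_in (Suc 0) (snd (dim1 j))" "gens_in 2 (snd (swap_rep a b \<alpha> \<beta>))" "gens_in 2 (snd (dim2 a b))"
    by simp_all
qed

lemma is_rep_dim1: "is_rep n q (dim1 j)"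
proof (rule is_rep_weight[OF _ dim1_def])
  show "mat 1 1 (\<lambda>_. z_val j) * mat 1 1 (\<lambda>_. z_val j) = mat_diag 1 (\<lambda>r. q ^ (j * j))"
    by (rule eq_matI) (auto simp: mat_times_index z_val_sq simp del: index_mult_mat(1))
qed simp_all

lemma is_rep_swap_rep: "\<alpha> * \<beta> = q ^ (a * b) \<Longrightarrow> is_rep n q (swap_rep a b \<alpha> \<beta>)"
proof (rule is_rep_weight[OF _ swap_rep_def])
  assume ab: "\<alpha> * \<beta> = q ^ (a * b)"
  show "swap_mat \<alpha> \<beta> * swap_mat \<alpha> \<beta> = mat_diag 2 (\<lambda>r. q ^ ((if r = 0 then a else b) * (if r = 0 then b else a)))"
    by (rule eq_matI)
       (auto simp: mat_times_index sum_less_2 ab mult.commute less_2_cases_iff simp del: index_mult_mat(1))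
qed (auto simp: less_2_cases_iff)

lemma is_rep_dim2: "is_rep n q (dim2 a b)"
  unfolding dim2_def by (rule is_rep_swap_rep) simp

lemma rep_unit_eq: "rep_unit = dim1 0"
proof -
  have "z_val 0 = 1" by (simp add: z_val_def)
  then have "mat 1 1 (\<lambda>_. z_val 0) = 1\<^sub>m 1" by (intro eq_matI) auto
  then show ?thesis
    by (auto simp: rep_unit_def dim1_def weight_rep_def fun_eq_iff split: gen.split)
qed

lemma dim1_cong: "j mod (2 * n) = j' mod (2 * n) \<Longrightarrow> dim1 j = dim1 j'"
proof -
  have *: "dim1 j = dim1 (j mod (2 * n))" for j
  proof -
    have "dim1 (j + 2 * n) = dim1 j" for j
    proof -
      have "z_val (j + 2 * n) = z_val j" using z_val_add_n[of "j + n"] by (simp add: z_val_add_n mult_2 add.assoc)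
      then show ?thesis unfolding dim1_def by (intro weight_rep_cong) (simp_all add: power_add power_mult[of q 2 n] mult.commute[of 2 n])
    qed
    then have "dim1 (j + k * (2 * n)) = dim1 j" for j k
      by (induction k) (simp_all add: algebra_simps, metis add.assoc add.commute)
    then show ?thesis by (metis mod_div_mult_eq)
  qed
  assume "j mod (2 * n) = j' mod (2 * n)"
  then show ?thesis using *[of j] *[of j'] by simp
qed

lemma dim2_cong: "q ^ a = q ^ a' \<Longrightarrow> q ^ b = q ^ b' \<Longrightarrow> dim2 a b = dim2 a' b'"
proof -
  assume ab: "q ^ a = q ^ a'" "q ^ b = q ^ b'"
  have "q ^ (a * b) = (q ^ a) ^ b" by (rule power_mult)
  also have "\<dots> = (q ^ b) ^ a'" by (simp add: ab(1) mult.commute flip: power_mult)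
  also have "\<dots> = q ^ (a' * b')" by (simp add: ab(2) mult.commute flip: power_mult)
  finally show ?thesis unfolding dim2_def swap_rep_def using ab by (intro weight_rep_cong) auto
qed

lemma rep_iso_2I:
  assumes "gens_in 2 (snd R)" "gens_in 2 (snd S)" "fst R = 2" "fst S = 2"
    "P \<in> carrier_mat 2 2" "Q \<in> carrier_mat 2 2" "P * Q = 1\<^sub>m 2" "\<And>g. P * snd R g = snd S g * P"
  shows "rep_iso R S"
  unfolding rep_iso_def using assms mat_mult_left_right_inverse[OF assms(5-7)] by auto

lemma swap_rep_iso_dim2:
  assumes "\<alpha> * \<beta> = q ^ (a * b)"
  shows "rep_iso (swap_rep a b \<alpha> \<beta>) (dim2 a b)"
proof (rule rep_iso_2I)
  have nz: "\<alpha> \<noteq> 0" using assms by auto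
  let ?P = "mat_diag 2 (\<lambda>i. if i = 0 then \<alpha> else 1)" and ?Q = "mat_diag 2 (\<lambda>i. if i = 0 then inverse \<alpha> else 1)"
  show "?P * ?Q = 1\<^sub>m 2"
    by (rule eq_matI) (use nz in auto)
  fix g
  show "?P * snd (swap_rep a b \<alpha> \<beta>) g = snd (dim2 a b) g * ?P"
  proof (cases g)
    case GenZ
    have "?P * swap_mat \<alpha> \<beta> = swap_mat 1 (q ^ (a * b)) * ?P"
      unfolding mat_diag_mult_left[OF swap_mat_carrier] mat_diag_mult_right[OF swap_mat_carrier]
      by (rule eq_matI) (use assms in \<open>auto simp: less_2_cases_iff\<close>)
    then show ?thesis by (simp add: GenZ swap_rep_def dim2_def weight_rep_def)
  qed (simp_all add: swap_rep_def dim2_def weight_rep_def mult.commute)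
qed simp_all

lemma dim2_swap: "rep_iso (dim2 a b) (dim2 b a)"
proof -
  have "rep_iso (swap_rep a b 1 (q ^ (a * b))) (swap_rep b a (q ^ (a * b)) 1)"
  proof (rule rep_iso_2I)
    let ?P = "swap_mat 1 1"
    show "?P * ?P = 1\<^sub>m 2"
      by (rule eq_matI) (auto simp: mat_times_index sum_less_2 less_2_cases_iff simp del: index_mult_mat(1))
    fix g
    show "?P * snd (swap_rep a b 1 (q ^ (a * b))) g = snd (swap_rep b a (q ^ (a * b)) 1) g * ?P"
      by (cases g; rule eq_matI)
         (auto simp: swap_rep_def weight_rep_def mat_times_index sum_less_2 less_2_cases_iff simp del: index_mult_mat(1))
  qed simp_all
  then show ?thesis
    using swap_rep_iso_dim2[of "q ^ (a * b)" 1 b a] rep_iso_trans[of "dim2 a b" "swap_rep b a (q ^ (a * b)) 1" "dim2 b a"]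
    by (simp add: dim2_def[of a b] mult.commute)
qed

text \<open>
  On equal weights \<open>z\<close> has the two eigenvalues \<open>z_val a\<close> and \<open>-
  z_val a\<close>. The rows of the change of basis are left eigenvectors of \<open>z\<close>.
\<close>

lemma dim2_diag: "q ^ a = q ^ b \<Longrightarrow> rep_iso (dim2 a b) (rep_sum (dim1 a) (dim1 (a + n)))"
proof -
  assume ab: "q ^ a = q ^ b"
  have qa: "q ^ (a + n) = q ^ a" by (simp add: power_add)
  have M: "dim2 a b = dim2 a a" by (rule dim2_cong) (simp_all add: ab)
  let ?e = "z_val a"
  let ?P = "mat 2 2 (\<lambda>(i, j). if j = 0 then 1 else if i = 0 then ?e else - ?e)"
  let ?Q = "mat 2 2 (\<lambda>(i, j). if i = 0 then 1 / 2 else if j = 0 then 1 / (2 * ?e) else - 1 / (2 * ?e))"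
  have "rep_iso (dim2 a a) (rep_sum (dim1 a) (dim1 (a + n)))"
  proof (rule rep_iso_2I)
    show "gens_in 2 (snd (rep_sum (dim1 a) (dim1 (a + n))))"
      using gens_ok_sum[of "dim1 a" "dim1 (a + n)"] by (simp add: numeral_2_eq_2)
    show "?P * ?Q = 1\<^sub>m 2"
      by (rule eq_matI) (auto simp: mat_times_index sum_less_2 less_2_cases_iff field_simps simp del: index_mult_mat(1))
    fix g
    show "?P * snd (dim2 a a) g = snd (rep_sum (dim1 a) (dim1 (a + n))) g * ?P"
      by (cases g; rule eq_matI)
         (auto simp: dim2_def swap_rep_def dim1_def rep_sum_def block_sum_def weight_rep_def mat_times_index sum_less_2
           less_2_cases_iff qa z_val_add_n z_val_sq simp del: index_mult_mat(1))
  qed simp_all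
  then show ?thesis by (simp add: M)
qed

section \<open>Tensor products of simple modules\<close>

lemma tensor_dim1_dim1: "rep_tensor n q (dim1 i) (dim1 j) = dim1 (i + j)"
proof -
  have "rep_tensor n q (dim1 i) (dim1 j) = weight_rep (1 * 1) (\<lambda>r. i + j) (\<lambda>r. i + j)
    (mat (1 * 1) (1 * 1) (\<lambda>(r, c). q ^ (i * j) * mat 1 1 (\<lambda>_. z_val i) $$ (r div 1, c div 1) * mat 1 1 (\<lambda>_. z_val j) $$ (r mod 1, c mod 1)))"
    unfolding dim1_def by (subst rep_tensor_weight) simp_all
  also have "\<dots> = dim1 (i + j)"
    unfolding dim1_def by (simp, rule weight_rep_cong, simp_all, rule eq_matI, simp_all add: z_val_add mult_ac)
  finally show ?thesis .
qed

lemma tensor_dim1_swap_rep: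
  "rep_tensor n q (dim1 i) (swap_rep a b \<alpha> \<beta>) = swap_rep (i + a) (i + b) (q ^ (i * a) * z_val i * \<alpha>) (q ^ (i * b) * z_val i * \<beta>)"
  unfolding dim1_def swap_rep_def
  by (subst rep_tensor_weight, simp, simp, simp, rule weight_rep_cong, simp_all, rule eq_matI)
     (auto simp: less_2_cases_iff)

lemma tensor_swap_rep_dim1:
  "rep_tensor n q (swap_rep a b \<alpha> \<beta>) (dim1 i) = swap_rep (a + i) (b + i) (q ^ (b * i) * \<alpha> * z_val i) (q ^ (a * i) * \<beta> * z_val i)"
  unfolding dim1_def swap_rep_def
  by (subst rep_tensor_weight, simp, simp, simp, rule weight_rep_cong, simp_all, rule eq_matI)
     (auto simp: less_2_cases_iff)

lemma less_4_cases: "i < 4 \<longleftrightarrow> i = 0 \<or> i = Suc 0 \<or> i = 2 \<or> i = (3 :: nat)"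
  by auto

text \<open>
  The first and last vector of the product basis are exchanged by \<open>z\<close>, and so are the
  two middle ones; the permutation brings each pair together.
\<close>

lemma tensor_swap_rep_swap_rep:
  "rep_iso (rep_tensor n q (swap_rep a b \<alpha> \<beta>) (swap_rep a' b' \<alpha>' \<beta>'))
    (rep_sum (swap_rep (a + a') (b + b') (q ^ (b * a') * \<alpha> * \<alpha>') (q ^ (a * b') * \<beta> * \<beta>'))
             (swap_rep (a + b') (b + a') (q ^ (b * b') * \<alpha> * \<beta>') (q ^ (a * a') * \<beta> * \<alpha>')))" (is "rep_iso ?T ?S")
proof -
  (* The order 0, 3, 1, 2 of the product basis. *)
  let ?\<pi> = "\<lambda>i. if i = 0 then 0 else if i = 1 then 3 else i - 1 :: nat"
  have bij: "bij_betw ?\<pi> {..<4} {..<4}"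
    by (rule bij_betw_byWitness[where f' = "\<lambda>i. if i = 0 then 0 else if i = 3 then 1 else i + 1"]) auto
  have "rep_iso ?T (4, \<lambda>g. mat 4 4 (\<lambda>(i, j). snd ?T g $$ (?\<pi> i, ?\<pi> j)))"
    by (rule rep_reindex[OF gens_ok_tensor _ bij]) simp
  also have "(4, \<lambda>g. mat 4 4 (\<lambda>(i, j). snd ?T g $$ (?\<pi> i, ?\<pi> j))) = ?S"
  proof -
    have "mat 4 4 (\<lambda>(i, j). snd ?T g $$ (?\<pi> i, ?\<pi> j)) = snd ?S g" for g
    proof (rule eq_matI)
      fix i j assume "i < dim_row (snd ?S g)" "j < dim_col (snd ?S g)"
      then have ij: "i < 4" "j < 4" by (cases g; auto simp: rep_sum_def swap_rep_def weight_rep_def)+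
      have T: "?T = weight_rep (2 * 2) (\<lambda>r. (if r div 2 = 0 then a else b) + (if r mod 2 = 0 then a' else b'))
          (\<lambda>r. (if r div 2 = 0 then b else a) + (if r mod 2 = 0 then b' else a'))
          (mat (2 * 2) (2 * 2) (\<lambda>(r, c). q ^ ((if r div 2 = 0 then a else b) * (if r mod 2 = 0 then b' else a')) *
             swap_mat \<alpha> \<beta> $$ (r div 2, c div 2) * swap_mat \<alpha>' \<beta>' $$ (r mod 2, c mod 2)))"
        unfolding swap_rep_def by (subst rep_tensor_weight) simp_all
      show "mat 4 4 (\<lambda>(i, j). snd ?T g $$ (?\<pi> i, ?\<pi> j)) $$ (i, j) = snd ?S g $$ (i, j)"
        unfolding T using ij
        by (cases g) (auto simp: less_4_cases weight_rep_def rep_sum_def block_sum_def swap_rep_def)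
    qed (cases g; simp add: rep_sum_def swap_rep_def weight_rep_def)+
    then show ?thesis by (simp add: prod_eq_iff fun_eq_iff)
  qed
  finally show ?thesis .
qed

section \<open>Decomposition into simple modules\<close>

text \<open>
  The simple modules: \<open>(j, 0)\<close> labels the one-dimensional \<open>dim1 j\<close>, and
  \<open>(j, t)\<close> with \<open>t > 0\<close> the module with weights \<open>(j, j +
  t)\<close> and \<open>(j + t, j)\<close>. An unordered pair of distinct residues modulo \<open>n
  = 2 m + 1\<close> has exactly one such form with \<open>1 \<le> t \<le> m\<close>.
\<close>

definition labels :: "(nat \<times> nat) set" where
  "labels = {..<2 * n} \<times> {0} \<union> {..<n} \<times> {1..m}"

definition simple_rep :: "nat \<times> nat \<Rightarrow> 'k rep" where
  "simple_rep l = (if snd l = 0 then dim1 (fst l) else dim2 (fst l) (fst l + snd l))"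

lemma finite_labels: "finite labels"
  by (simp add: labels_def)

lemma is_rep_simple_rep: "is_rep n q (simple_rep l)"
  by (simp add: simple_rep_def is_rep_dim1 is_rep_dim2)

lemma dim2_label:
  assumes "a < n" "b < n" "a \<noteq> b"
  obtains l where "l \<in> labels" "rep_iso (dim2 a b) (simple_rep l)"
proof -
  have *: "\<exists>l\<in>labels. rep_iso (dim2 a b) (simple_rep l)" if ab: "a < b" "b < n" for a b
  proof (cases "b - a \<le> m")
    case True
    then have "(a, b - a) \<in> labels" using ab by (auto simp: labels_def)
    moreover have "simple_rep (a, b - a) = dim2 a b" using ab by (simp add: simple_rep_def)
    ultimately show ?thesis using rep_iso_refl[of "dim2 a b"] by (intro bexI[of _ "(a, b - a)"]) simp_all
  next
    case False
    (* For b - a > m, pass to the pair (b, a + n), whose difference is at most m. *)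
    let ?t = "a + n - b"
    have t: "1 \<le> ?t" "?t \<le> m" using False ab n_eq by auto
    then have "(b, ?t) \<in> labels" using ab by (auto simp: labels_def)
    moreover have "simple_rep (b, ?t) = dim2 b a"
    proof -
      have "simple_rep (b, ?t) = dim2 b (a + n)" using ab by (simp add: simple_rep_def)
      also have "\<dots> = dim2 b a" by (rule dim2_cong) (simp_all add: power_add)
      finally show ?thesis .
    qed
    ultimately show ?thesis using dim2_swap[of a b] by (intro bexI[of _ "(b, ?t)"]) simp_all
  qed
  have "\<exists>l\<in>labels. rep_iso (dim2 a b) (simple_rep l)"
  proof (cases "a < b")
    case True
    then show ?thesis using * assms by blast
  next
    case False
    then obtain l where l: "l \<in> labels" "rep_iso (dim2 b a) (simple_rep l)" using *[of b a] assms by auto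
    have "rep_iso (dim2 a b) (simple_rep l)"
      by (rule rep_iso_trans[OF _ _ _ dim2_swap l(2)]) (use is_rep_gens[OF is_rep_simple_rep] in simp_all)
    then show ?thesis using l by blast
  qed
  then show thesis using that by blast
qed

lemma split_dim1:
  assumes R: "is_rep n q R" and e: "act R (idem1 j) \<noteq> 0\<^sub>m (fst R) (fst R)"
  obtains R' where "is_rep n q R'" "rep_iso R (rep_sum (dim1 j) R')"
proof (rule split_off_units[OF R _ e, where S = "dim1 j" and u = "\<lambda>_. idem1 j" and w = "\<lambda>_. idem1 j"])
  show "gens_ok (dim1 j)" by simp
  fix k l assume "k < fst (dim1 j)" "l < fst (dim1 j)"
  then show "act R (idem1 j * idem1 j) = (if k = l then act R (idem1 j) else 0\<^sub>m (fst R) (fst R))"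
    using act_eqH[OF R idem1_idem1] by simp
next
  fix g l assume l: "l < fst (dim1 j)"
  have "letter g * idem1 j \<approx> sc (snd (dim1 j) g $$ (0, 0)) * idem1 j"
    by (cases g) (simp_all add: x_idem1 y_idem1 z_idem1, simp_all add: dim1_def weight_rep_def x_idem1 y_idem1 z_idem1)
  then show "act R (letter g * idem1 j) = act R (\<Sum>k<fst (dim1 j). sc (snd (dim1 j) g $$ (k, l)) * idem1 j)"
    using l act_eqH[OF R] by simp
  have "idem1 j * letter g \<approx> sc (snd (dim1 j) g $$ (0, 0)) * idem1 j"
    by (cases g) (simp_all add: dim1_def weight_rep_def idem1_x idem1_y idem1_z)
  then show "act R (idem1 j * letter g) = act R (\<Sum>k<fst (dim1 j). sc (snd (dim1 j) g $$ (l, k)) * idem1 j)"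
    using l act_eqH[OF R] by simp
qed (rule that)

lemma x_z_idem_wt: "gx * (gz * idem_wt a b) \<approx> sc (q ^ b) * (gz * idem_wt a b)"
proof -
  have "gx * (gz * idem_wt a b) = (gx * gz) * idem_wt a b" by (simp add: mult.assoc)
  also have "\<dots> \<approx> (gz * gy) * idem_wt a b" by (rule eqH_right[OF eqH_sym[OF rel_zy]])
  also have "\<dots> = gz * (gy * idem_wt a b)" by (simp add: mult.assoc)
  also have "\<dots> \<approx> gz * (sc (q ^ b) * idem_wt a b)" by (rule eqH_left[OF y_idem_wt])
  finally show ?thesis by (simp only: sc_left_commute[of gz])
qed

lemma y_z_idem_wt: "gy * (gz * idem_wt a b) \<approx> sc (q ^ a) * (gz * idem_wt a b)"
proof -
  have "gy * (gz * idem_wt a b) = (gy * gz) * idem_wt a b" by (simp add: mult.assoc)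
  also have "\<dots> \<approx> (gz * gx) * idem_wt a b" by (rule eqH_right[OF eqH_sym[OF rel_zx]])
  also have "\<dots> = gz * (gx * idem_wt a b)" by (simp add: mult.assoc)
  also have "\<dots> \<approx> gz * (sc (q ^ a) * idem_wt a b)" by (rule eqH_left[OF x_idem_wt])
  finally show ?thesis by (simp only: sc_left_commute[of gz])
qed

lemma idem_wt_z_x: "idem_wt a b * gz * gx \<approx> sc (q ^ b) * (idem_wt a b * gz)"
proof -
  have "idem_wt a b * gz * gx = idem_wt a b * (gz * gx)" by (simp add: mult.assoc)
  also have "\<dots> \<approx> idem_wt a b * (gy * gz)" by (rule eqH_left[OF rel_zx])
  also have "\<dots> = (idem_wt a b * gy) * gz" by (simp add: mult.assoc)
  also have "\<dots> \<approx> (sc (q ^ b) * idem_wt a b) * gz" by (rule eqH_right[OF idem_wt_y])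
  finally show ?thesis by (simp only: mult.assoc)
qed

lemma idem_wt_z_y: "idem_wt a b * gz * gy \<approx> sc (q ^ a) * (idem_wt a b * gz)"
proof -
  have "idem_wt a b * gz * gy = idem_wt a b * (gz * gy)" by (simp add: mult.assoc)
  also have "\<dots> \<approx> idem_wt a b * (gx * gz)" by (rule eqH_left[OF rel_zy])
  also have "\<dots> = (idem_wt a b * gx) * gz" by (simp add: mult.assoc)
  also have "\<dots> \<approx> (sc (q ^ a) * idem_wt a b) * gz" by (rule eqH_right[OF idem_wt_x])
  finally show ?thesis by (simp only: mult.assoc)
qed

text \<open>
  The matrix units are \<open>e, z e\<close> and \<open>e, e z / q^(a b)\<close>. Since
  \<open>z\<close> exchanges the weights \<open>(a, b)\<close> and \<open>(b, a)\<close>, which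
  are different, \<open>e z e = 0\<close>, while \<open>e z z e = q^(a b) e\<close>.
\<close>

lemma split_dim2:
  assumes R: "is_rep n q R" and e: "act R (idem_wt a b) \<noteq> 0\<^sub>m (fst R) (fst R)" and ab: "q ^ a \<noteq> q ^ b"
  obtains R' where "is_rep n q R'" "rep_iso R (rep_sum (dim2 a b) R')"
proof -
  define c where "c = q ^ (a * b)"
  have c: "c \<noteq> 0" by (simp add: c_def)
  define u where "u l = (if l = 0 then idem_wt a b else gz * idem_wt a b)" for l :: nat
  define w where "w k = (if k = 0 then idem_wt a b else sc (inverse c) * (idem_wt a b * gz))" for k :: nat
  have ee: "idem_wt a b * idem_wt a b \<approx> idem_wt a b" using idem_wt_idem_wt[of a b a b] by simp
  have eze: "idem_wt a b * (gz * idem_wt a b) \<approx> 0"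
  proof -
    have "idem_wt a b * (gz * idem_wt a b) \<approx> idem_wt a b * (idem_wt b a * gz)" by (rule eqH_left[OF z_idem_wt])
    also have "\<dots> = (idem_wt a b * idem_wt b a) * gz" by (simp add: mult.assoc)
    also have "\<dots> \<approx> 0 * gz" using eqH_right[OF idem_wt_idem_wt[of a b b a]] ab by simp
    finally show ?thesis by simp
  qed
  have ezze: "sc (inverse c) * (idem_wt a b * gz) * (gz * idem_wt a b) \<approx> idem_wt a b"
  proof -
    have "sc (inverse c) * (idem_wt a b * gz) * (gz * idem_wt a b) = sc (inverse c) * (idem_wt a b * (gz * (gz * idem_wt a b)))"
      by (simp add: mult.assoc)
    also have "\<dots> \<approx> sc (inverse c) * (idem_wt a b * (sc c * idem_wt a b))"
      unfolding c_def by (intro eqH_left zz_idem_wt)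
    also have "\<dots> = idem_wt a b * idem_wt a b" using c by (simp add: sc_left_commute[of "idem_wt a b"] sc_sc_mult)
    also note ee
    finally show ?thesis .
  qed
  show thesis
  proof (rule split_off_units[OF R _ e, where S = "dim2 a b" and u = u and w = w])
    show "gens_ok (dim2 a b)" by simp
  next
    fix k l assume kl: "k < fst (dim2 a b)" "l < fst (dim2 a b)"
    have zero: "act R 0 = 0\<^sub>m (fst R) (fst R)" by (simp add: act_def)
    have "w k * u l \<approx> (if k = l then idem_wt a b else 0)"
    proof -
      have "idem_wt a b * gz * idem_wt a b \<approx> 0" using eze by (simp add: mult.assoc)
      from eqH_left[OF this, of "sc (inverse c)"]
      have "sc (inverse c) * (idem_wt a b * gz) * idem_wt a b \<approx> 0" by (simp add: mult.assoc)
      then show ?thesis using kl ee eze ezze by (auto simp: w_def u_def less_2_cases_iff)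
    qed
    from act_eqH[OF R this] show "act R (w k * u l) = (if k = l then act R (idem_wt a b) else 0\<^sub>m (fst R) (fst R))"
      by (auto simp: zero)
  next
    fix g l assume l: "l < fst (dim2 a b)"
    have "letter g * u l \<approx> (\<Sum>k<2. sc (snd (dim2 a b) g $$ (k, l)) * u k)"
      using l x_idem_wt[of a b] y_idem_wt[of a b] x_z_idem_wt[of a b] y_z_idem_wt[of a b] zz_idem_wt[of a b]
      by (cases g) (auto simp: sum_less_2 dim2_def swap_rep_def weight_rep_def less_2_cases_iff u_def)
    then show "act R (letter g * u l) = act R (\<Sum>k<fst (dim2 a b). sc (snd (dim2 a b) g $$ (k, l)) * u k)"
      using act_eqH[OF R] by simp
  next
    fix g k assume k: "k < fst (dim2 a b)"
    have sw: "sc (inverse c) * (idem_wt a b * gz) * h \<approx> sc y * (sc (inverse c) * (idem_wt a b * gz))"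
      if "idem_wt a b * gz * h \<approx> sc y * (idem_wt a b * gz)" for h y
      using eqH_left[OF that, of "sc (inverse c)"] by (simp add: mult.assoc sc_sc_mult mult.commute)
    have zz: "sc (inverse c) * (idem_wt a b * gz) * gz \<approx> idem_wt a b"
      using eqH_left[OF idem_wt_zz[of a b], of "sc (inverse c)"] c by (simp add: mult.assoc sc_sc_mult flip: c_def)
    have "w k * letter g \<approx> (\<Sum>l<2. sc (snd (dim2 a b) g $$ (k, l)) * w l)"
      using k idem_wt_x[of a b] idem_wt_y[of a b] sw[OF idem_wt_z_x] sw[OF idem_wt_z_y] zz c
      by (cases g) (auto simp: sum_less_2 dim2_def swap_rep_def weight_rep_def less_2_cases_iff w_def sc_sc_mult simp flip: c_def)
    then show "act R (w k * letter g) = act R (\<Sum>l<fst (dim2 a b). sc (snd (dim2 a b) g $$ (k, l)) * w l)"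
      using act_eqH[OF R] by simp
  qed (rule that)
qed

text \<open>
  The weight projections sum to 1, so some \<open>idem_wt a b\<close> acts as a nonzero matrix.
  For \<open>a = b\<close> it is the sum of two idempotents \<open>idem1\<close>.
\<close>

lemma split_simple:
  assumes R: "is_rep n q R" and d: "fst R > 0"
  obtains l R' where "l \<in> labels" "is_rep n q R'" "rep_iso R (rep_sum (simple_rep l) R')"
proof -
  let ?d = "fst R"
  note g = is_rep_gens[OF R]
  have "\<exists>a<n. \<exists>b<n. act R (idem_wt a b) \<noteq> 0\<^sub>m ?d ?d"
  proof (rule ccontr)
    assume "\<not> ?thesis"
    then have z: "act R (idem_wt a b) = 0\<^sub>m ?d ?d" if "a < n" "b < n" for a b using that by blast
    have "act R 1 $$ (0, 0) = (\<Sum>a<n. \<Sum>b<n. act R (idem_wt a b) $$ (0, 0))"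
      unfolding sum_idem_wt[symmetric] using d by (simp add: act_def ev_sum_entry)
    also have "\<dots> = 0" using d by (simp add: z)
    finally show False using d by (simp add: act_def ev_one[OF g])
  qed
  then obtain a b where ab: "a < n" "b < n" "act R (idem_wt a b) \<noteq> 0\<^sub>m ?d ?d" by blast
  show thesis
  proof (cases "a = b")
    case True
    have "act R (idem1 a) \<noteq> 0\<^sub>m ?d ?d \<or> act R (idem1 (a + n)) \<noteq> 0\<^sub>m ?d ?d"
    proof (rule ccontr)
      assume "\<not> ?thesis"
      then have "act R (idem1 a + idem1 (a + n)) = 0\<^sub>m ?d ?d" by (simp add: act_def ev_add)
      then show False using ab True by (simp add: idem1_sum)
    qed
    moreover have "a < 2 * n" "a + n < 2 * n" using ab by simp_all
    ultimately obtain j where j: "j < 2 * n" "act R (idem1 j) \<noteq> 0\<^sub>m ?d ?d" by blast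
    obtain R' where "is_rep n q R'" "rep_iso R (rep_sum (dim1 j) R')" using split_dim1[OF R j(2)] .
    then show thesis using that[of "(j, 0)" R'] j by (simp add: labels_def simple_rep_def)
  next
    case False
    then have "q ^ a \<noteq> q ^ b" using ab by (simp add: q_pow_eq_iff)
    then obtain R' where R': "is_rep n q R'" "rep_iso R (rep_sum (dim2 a b) R')"
      using split_dim2[OF R ab(3)] by blast
    obtain l where l: "l \<in> labels" "rep_iso (dim2 a b) (simple_rep l)" using dim2_label[OF ab(1,2) False] .
    note gs = is_rep_gens[OF is_rep_simple_rep[of l]] is_rep_gens[OF is_rep_dim2[of a b]] is_rep_gens[OF R'(1)]
    have "rep_iso (rep_sum (dim2 a b) R') (rep_sum (simple_rep l) R')"
      by (rule rep_iso_sum[OF gs(2,1,3,3) l(2) rep_iso_refl[OF gs(3)]])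
    then have "rep_iso R (rep_sum (simple_rep l) R')"
      by (rule rep_iso_trans[OF g gens_ok_sum[OF gs(2,3)] gens_ok_sum[OF gs(1,3)] R'(2)])
    then show thesis using that l R' by blast
  qed
qed

text \<open>
  Complete reducibility, in the form in which it is used: simple summands are split off one at a
  time.
\<close>

lemma rep_induct [consumes 1, case_names zero sum iso]:
  assumes R: "is_rep n q R"
    and zero: "\<And>R. is_rep n q R \<Longrightarrow> fst R = 0 \<Longrightarrow> P R"
    and sum: "\<And>l R. l \<in> labels \<Longrightarrow> is_rep n q R \<Longrightarrow> P R \<Longrightarrow> P (rep_sum (simple_rep l) R)"
    and iso: "\<And>R R'. is_rep n q R \<Longrightarrow> is_rep n q R' \<Longrightarrow> rep_iso R R' \<Longrightarrow> P R' \<Longrightarrow> P R"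
  shows "P R"
  using R
proof (induction "fst R" arbitrary: R rule: less_induct)
  case less
  show ?case
  proof (cases "fst R = 0")
    case True
    then show ?thesis using zero less.prems by blast
  next
    case False
    then obtain l R' where l: "l \<in> labels" "is_rep n q R'" "rep_iso R (rep_sum (simple_rep l) R')"
      using split_simple[OF less.prems] by blast
    have "fst R = fst (simple_rep l) + fst R'" using rep_iso_dim[OF l(3)] by simp
    moreover have "fst (simple_rep l) > 0" by (simp add: simple_rep_def)
    ultimately have "P R'" using less.hyps l(2) by simp
    then show ?thesis
      using iso[OF less.prems is_rep_sum[OF is_rep_simple_rep l(2)] l(3)] sum l by blast
  qed
qed

end

section \<open>Tensor products, isomorphisms and direct sums\<close>

lemma rep_iso_tensor:
  assumes g: "gens_ok R" "gens_ok R'" "gens_ok S" "gens_ok S'"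
    and iso: "rep_iso R R'" "rep_iso S S'"
  shows "rep_iso (rep_tensor n q R S) (rep_tensor n q R' S')"
proof -
  obtain P Q where PQ: "P \<in> carrier_mat (fst R') (fst R)" "Q \<in> carrier_mat (fst R) (fst R')"
    "P * Q = 1\<^sub>m (fst R')" "Q * P = 1\<^sub>m (fst R)" "\<And>g. P * snd R g = snd R' g * P"
    using iso(1) by (auto simp: rep_iso_def)
  obtain P' Q' where PQ': "P' \<in> carrier_mat (fst S') (fst S)" "Q' \<in> carrier_mat (fst S) (fst S')"
    "P' * Q' = 1\<^sub>m (fst S')" "Q' * P' = 1\<^sub>m (fst S)" "\<And>g. P' * snd S g = snd S' g * P'"
    using iso(2) by (auto simp: rep_iso_def)
  let ?P = "kronecker P P'" and ?Q = "kronecker Q Q'"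
  have P: "?P \<in> carrier_mat (fst R' * fst S') (fst R * fst S)" and Q: "?Q \<in> carrier_mat (fst R * fst S) (fst R' * fst S')"
    using kronecker_carrier PQ(1,2) PQ'(1,2) by blast+
  have "?P * word_kron R S w = word_kron R' S' w * ?P" for w
  proof -
    obtain u v where w: "w = (u, v)" by (cases w)
    note c = wmat_carrier[OF g(1), of u] wmat_carrier[OF g(2), of u] wmat_carrier[OF g(3), of v] wmat_carrier[OF g(4), of v]
    have "?P * word_kron R S w = kronecker (P * wmat (fst R) (snd R) u) (P' * wmat (fst S) (snd S) v)"
      unfolding w word_kron_def by (simp add: kronecker_mult[OF PQ(1) c(1) PQ'(1) c(3)])
    also have "\<dots> = kronecker (wmat (fst R') (snd R') u * P) (wmat (fst S') (snd S') v * P')"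
      using wmat_intertwine[OF g(1,2) PQ(1,5), of u] wmat_intertwine[OF g(3,4) PQ'(1,5), of v] by simp
    also have "\<dots> = word_kron R' S' w * ?P"
      unfolding w word_kron_def by (simp add: kronecker_mult[OF c(2) PQ(1) c(4) PQ'(1)])
    finally show ?thesis .
  qed
  then have "?P * act2_rep R S f = act2_rep R' S' f * ?P" for f
    unfolding act2_rep_def
    by (intro lin_ext_intertwine P word_kron_carrier g)
  moreover have "?P * ?Q = 1\<^sub>m (fst R' * fst S')" "?Q * ?P = 1\<^sub>m (fst R * fst S)"
    by (simp_all add: PQ PQ' kronecker_one flip: kronecker_mult[OF PQ(1,2) PQ'(1,2)] kronecker_mult[OF PQ(2,1) PQ'(2,1)])
  ultimately show ?thesis
    unfolding rep_iso_def using P Q by (intro bexI[of _ ?P] bexI[of _ ?Q]) (simp_all add: rep_tensor_def)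
qed

lemma kronecker_block_sum_left:
  assumes A: "A \<in> carrier_mat a a" and B: "B \<in> carrier_mat b b" and C: "C \<in> carrier_mat c c"
  shows "kronecker (block_sum A B) C = block_sum (kronecker A C) (kronecker B C)"
proof (rule eq_matI)
  fix i j assume "i < dim_row (block_sum (kronecker A C) (kronecker B C))"
    "j < dim_col (block_sum (kronecker A C) (kronecker B C))"
  then have ij: "i < (a + b) * c" "j < (a + b) * c" using assms by (auto simp: distrib_right)
  have c: "c > 0" using ij by (cases c) auto
  have *: "(k div c < a \<longleftrightarrow> k < a * c) \<and> (k - a * c) div c = k div c - a
      \<and> (\<not> k < a * c \<longrightarrow> (k - a * c) mod c = k mod c \<and> k - a * c < b * c)" if "k < (a + b) * c" for k
  proof -
    have 1: "k div c < a \<longleftrightarrow> k < a * c" using c by (simp add: div_less_iff_less_mult)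
    have 2: "(k - a * c) div c = k div c - a"
    proof (cases "k < a * c")
      case True
      then show ?thesis using 1 by simp
    next
      case False
      then obtain r where "k = r + a * c" by (metis le_add_diff_inverse2 not_less)
      then show ?thesis using c by simp
    qed
    have 3: "(k - a * c) mod c = k mod c" if "\<not> k < a * c"
      using that by (metis le_add_diff_inverse mod_mult_self3 not_less add.commute)
    show ?thesis using 1 2 3 that by (auto simp: distrib_right)
  qed
  show "kronecker (block_sum A B) C $$ (i, j) = block_sum (kronecker A C) (kronecker B C) $$ (i, j)"
    using assms ij *[OF ij(1)] *[OF ij(2)] div_mod_less[OF ij(1)] div_mod_less[OF ij(2)]
    by (auto simp: kronecker_index block_sum_def distrib_right)
qed (use assms in \<open>auto simp: distrib_right\<close>)

lemma rep_tensor_sum_left: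
  assumes g: "gens_ok R" "gens_ok R'" "gens_ok S"
  shows "rep_tensor n q (rep_sum R R') S = rep_sum (rep_tensor n q R S) (rep_tensor n q R' S)"
proof -
  have "word_kron (rep_sum R R') S w = block_sum (word_kron R S w) (word_kron R' S w)" for w
    unfolding word_kron_def
    by (cases w) (simp add: rep_sum_def wmat_block_sum[OF g(1,2)]
        kronecker_block_sum_left[OF wmat_carrier[OF g(1)] wmat_carrier[OF g(2)] wmat_carrier[OF g(3)]])
  then have "word_kron (rep_sum R R') S = (\<lambda>w. block_sum (word_kron R S w) (word_kron R' S w))" by (rule ext)
  then have "act2_rep (rep_sum R R') S f = block_sum (act2_rep R S f) (act2_rep R' S f)" for f
    unfolding act2_rep_def
    by (simp add: distrib_right lin_ext_block_sum[OF word_kron_carrier[OF g(1,3)] word_kron_carrier[OF g(2,3)]])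
  then show ?thesis by (simp add: rep_tensor_def rep_sum_def distrib_right)
qed

text \<open>
  Renumber the basis \<open>e\<^sub>i \<otimes> f\<^sub>j\<close> so that all
  \<open>f\<^sub>j\<close> of the first summand come first. For a sum on the left the basis is in
  this order already (\<open>rep_tensor_sum_left\<close>).
\<close>

lemma rep_tensor_sum_right:
  assumes g: "gens_ok R" "gens_ok S" "gens_ok S'"
  shows "rep_iso (rep_tensor n q R (rep_sum S S')) (rep_sum (rep_tensor n q R S) (rep_tensor n q R S'))"
proof -
  let ?d = "fst R" and ?e = "fst S" and ?f = "fst S'"
  let ?ef = "?e + ?f"
  define \<pi> where "\<pi> r = (if r < ?d * ?e then (r div ?e) * ?ef + r mod ?e
     else ((r - ?d * ?e) div ?f) * ?ef + ?e + (r - ?d * ?e) mod ?f)" for r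
  have \<pi>: "(r < ?d * ?e \<longrightarrow> \<pi> r div ?ef = r div ?e \<and> \<pi> r mod ?ef = r mod ?e \<and> r div ?e < ?d \<and> r mod ?e < ?e)
    \<and> (\<not> r < ?d * ?e \<longrightarrow> \<pi> r div ?ef = (r - ?d * ?e) div ?f \<and> \<pi> r mod ?ef = ?e + (r - ?d * ?e) mod ?f
       \<and> (r - ?d * ?e) div ?f < ?d \<and> (r - ?d * ?e) mod ?f < ?f \<and> r - ?d * ?e < ?d * ?f)"
    if "r < ?d * ?ef" for r
  proof (cases "r < ?d * ?e")
    case True
    then show ?thesis using div_mod_less[OF True] by (simp add: \<pi>_def)
  next
    case False
    then have s: "r - ?d * ?e < ?d * ?f" using that by (simp add: distrib_left)
    have "?e + (r - ?d * ?e) mod ?f < ?ef" using div_mod_less[OF s] by simp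
    then have "\<pi> r div ?ef = (r - ?d * ?e) div ?f" "\<pi> r mod ?ef = ?e + (r - ?d * ?e) mod ?f"
      using False by (simp_all add: \<pi>_def add.assoc)
    then show ?thesis using False s div_mod_less[OF s] by simp
  qed
  have bound: "\<pi> r < ?d * ?ef" if "r < ?d * ?ef" for r
  proof -
    have "\<pi> r div ?ef < ?d" using \<pi>[OF that] by (cases "r < ?d * ?e") simp_all
    then show ?thesis using div_less_iff_less_mult[of ?ef "\<pi> r" ?d] that by (cases "?ef = 0") auto
  qed
  have inj: "inj_on \<pi> {..<?d * ?ef}"
  proof (rule inj_onI)
    fix r s assume rs: "r \<in> {..<?d * ?ef}" "s \<in> {..<?d * ?ef}" "\<pi> r = \<pi> s"
    then have r: "r < ?d * ?ef" "s < ?d * ?ef" by simp_all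
    consider "r < ?d * ?e" "s < ?d * ?e" | "\<not> r < ?d * ?e" "\<not> s < ?d * ?e"
      | "r < ?d * ?e" "\<not> s < ?d * ?e" | "\<not> r < ?d * ?e" "s < ?d * ?e" by blast
    then show "r = s"
    proof cases
      case 1
      then have "r div ?e = s div ?e" "r mod ?e = s mod ?e" using \<pi>[OF r(1)] \<pi>[OF r(2)] rs(3) by auto
      then show ?thesis by (metis div_mult_mod_eq)
    next
      case 2
      then have "(r - ?d * ?e) div ?f = (s - ?d * ?e) div ?f" "(r - ?d * ?e) mod ?f = (s - ?d * ?e) mod ?f"
        using \<pi>[OF r(1)] \<pi>[OF r(2)] rs(3) by auto
      then have "r - ?d * ?e = s - ?d * ?e" by (metis div_mult_mod_eq)
      then show ?thesis using 2 by simp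
    next
      case 3
      then have "r mod ?e = ?e + (s - ?d * ?e) mod ?f" "r mod ?e < ?e" using \<pi>[OF r(1)] \<pi>[OF r(2)] rs(3) by auto
      then show ?thesis by simp
    next
      case 4
      then have "s mod ?e = ?e + (r - ?d * ?e) mod ?f" "s mod ?e < ?e" using \<pi>[OF r(1)] \<pi>[OF r(2)] rs(3) by auto
      then show ?thesis by simp
    qed
  qed
  have bij: "bij_betw \<pi> {..<?d * ?ef} {..<?d * ?ef}"
    unfolding bij_betw_def using inj bound by (intro conjI endo_inj_surj) auto
  let ?T = "rep_tensor n q R (rep_sum S S')" and ?U = "rep_sum (rep_tensor n q R S) (rep_tensor n q R S')"
  have "rep_iso ?T (?d * ?ef, \<lambda>g. mat (?d * ?ef) (?d * ?ef) (\<lambda>(i, j). snd ?T g $$ (\<pi> i, \<pi> j)))"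
    by (rule rep_reindex[OF gens_ok_tensor _ bij]) simp
  also have "(?d * ?ef, \<lambda>g. mat (?d * ?ef) (?d * ?ef) (\<lambda>(i, j). snd ?T g $$ (\<pi> i, \<pi> j))) = ?U"
  proof -
    have w: "word_kron R (rep_sum S S') w $$ (\<pi> i, \<pi> j) = block_sum (word_kron R S w) (word_kron R S' w) $$ (i, j)"
      if ij: "i < ?d * ?ef" "j < ?d * ?ef" for w i j
    proof -
      obtain u v where uv: "w = (u, v)" by (cases w)
      note c = wmat_carrier[OF g(1), of u] wmat_carrier[OF g(2), of v] wmat_carrier[OF g(3), of v]
      have "i < ?d * ?e + ?d * ?f" "j < ?d * ?e + ?d * ?f" using ij by (simp_all add: distrib_left)
      then show ?thesis
        using \<pi>[OF ij(1)] \<pi>[OF ij(2)] bound[OF ij(1)] bound[OF ij(2)] c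
        by (simp add: uv word_kron_def rep_sum_def wmat_block_sum[OF g(2,3)])
           (cases "i < ?d * ?e"; cases "j < ?d * ?e"; simp add: kronecker_index block_sum_def trans_less_add1)
    qed
    have "mat (?d * ?ef) (?d * ?ef) (\<lambda>(i, j). snd ?T g $$ (\<pi> i, \<pi> j)) = snd ?U g" for g
    proof (rule eq_matI)
      fix i j assume "i < dim_row (snd ?U g)" "j < dim_col (snd ?U g)"
      then have ij: "i < ?d * ?ef" "j < ?d * ?ef" by (auto simp: rep_sum_def rep_tensor_def act2_rep_def distrib_left)
      have "snd ?U g = lin_ext (?d * ?ef) (\<lambda>w. block_sum (word_kron R S w) (word_kron R S' w)) (comult_gen n q g)"
        by (simp add: rep_sum_def rep_tensor_def act2_rep_def distrib_left
            lin_ext_block_sum[OF word_kron_carrier[OF g(1,2)] word_kron_carrier[OF g(1,3)]])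
      then have "snd ?U g $$ (i, j) = snd ?T g $$ (\<pi> i, \<pi> j)"
        using ij bound[OF ij(1)] bound[OF ij(2)]
        by (simp add: rep_tensor_def act2_rep_def lin_ext_def w)
      then show "mat (?d * ?ef) (?d * ?ef) (\<lambda>(i, j). snd ?T g $$ (\<pi> i, \<pi> j)) $$ (i, j) = snd ?U g $$ (i, j)"
        using ij by simp
    qed (auto simp: rep_sum_def rep_tensor_def act2_rep_def distrib_left)
    then show ?thesis by (simp add: prod_eq_iff fun_eq_iff distrib_left)
  qed
  finally show ?thesis .
qed

lemma is_rep_zero_dim: "gens_ok R \<Longrightarrow> fst R = 0 \<Longrightarrow> is_rep n q R"
  unfolding is_rep_def by (auto intro!: eq_matI)

section \<open>The character of a module\<close>

text \<open>
  Values at the pairs \<open>(\<omega>^i, \<omega>^k)\<close> and at the points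
  \<open>\<omega>^i\<close>, for \<open>\<omega> = omega\<close> a primitive complex
  \<open>n\<close>-th root of unity. Evaluating at roots of unity takes care of exponents modulo
  \<open>n\<close>.
\<close>

type_synonym char_fun = "nat \<times> nat + nat \<Rightarrow> complex"

context H_alg
begin

definition omega :: complex where "omega = cis (2 * pi / real n)"

lemma omega_power: "omega ^ k = cis (2 * pi * real k / real n)"
  by (simp add: omega_def DeMoivre mult_ac)

lemma prim_omega: "primitive_root_of_unity n omega"
proof -
  have "omega ^ n = 1" using n3 by (simp add: omega_power)
  moreover have "omega ^ j \<noteq> 1" if "0 < j" "j < n" for j
  proof
    assume "omega ^ j = 1"
    then have eq: "cis (2 * pi * real j / real n) = cis (2 * pi * real 0 / real n)" by (simp add: omega_power)
    have "inj_on (\<lambda>k. cis (2 * pi * real k / real n)) {..<n}"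
      using bij_betw_roots_unity[of n] n3 by (simp add: bij_betw_def)
    then have "j = 0" by (rule inj_onD) (use eq that in auto)
    then show False using that by simp
  qed
  ultimately show ?thesis by (simp add: primitive_root_of_unity_def)
qed

lemma omega_n: "(omega ^ i) ^ n = 1"
proof -
  have "(omega ^ i) ^ n = (omega ^ n) ^ i" by (metis mult.commute power_mult)
  then show ?thesis using prim_omega by (simp add: primitive_root_of_unity_def)
qed

lemma power_mod_eq: "x ^ k = 1 \<Longrightarrow> x ^ (j mod k) = (x ^ j :: complex)"
  by (metis mod_mult_div_eq mult.right_neutral power_add power_mult power_one)

definition char1 :: "nat \<Rightarrow> char_fun" where
  "char1 j = case_sum (\<lambda>(i, k). (omega ^ i * omega ^ k) ^ j) (\<lambda>i. (- (omega ^ i)) ^ j)"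

definition char2 :: "nat \<Rightarrow> nat \<Rightarrow> char_fun" where
  "char2 a b = case_sum (\<lambda>(i, k). (omega ^ i) ^ a * (omega ^ k) ^ b + (omega ^ i) ^ b * (omega ^ k) ^ a) (\<lambda>_. 0)"

definition simple_char :: "nat \<times> nat \<Rightarrow> char_fun" where
  "simple_char l = (if snd l = 0 then char1 (fst l) else char2 (fst l) (fst l + snd l))"

definition simple_idem :: "nat \<times> nat \<Rightarrow> 'k falg" where
  "simple_idem l = (if snd l = 0 then idem1 (fst l) else idem_wt (fst l) (fst l + snd l))"

definition mult_of :: "nat \<times> nat \<Rightarrow> 'k rep \<Rightarrow> nat" where
  "mult_of l R = idrank (act R (simple_idem l))"

text \<open>
  The multiplicities are integers that do not depend on the characteristic of \<open>k\<close>,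
  and the values are complex numbers even if \<open>k\<close> has positive characteristic.
\<close>

definition rep_char :: "'k rep \<Rightarrow> char_fun" where
  "rep_char R = (\<Sum>l\<in>labels. of_nat (mult_of l R) * simple_char l)"

lemma mult_of_sum: "gens_ok R \<Longrightarrow> gens_ok R' \<Longrightarrow> mult_of l (rep_sum R R') = mult_of l R + mult_of l R'"
  unfolding mult_of_def by (simp add: act_sum idrank_block_sum[OF act_carrier act_carrier])

lemma mult_of_iso: "gens_ok R \<Longrightarrow> gens_ok R' \<Longrightarrow> rep_iso R R' \<Longrightarrow> mult_of l R = mult_of l R'"
  unfolding mult_of_def by (rule idrank_iso)

lemma mult_of_zero_dim: "fst R = 0 \<Longrightarrow> mult_of l R = 0"
  unfolding mult_of_def using act_carrier[of R "simple_idem l"] by (intro idrank_zero_dim) simp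

lemma mod_n_less: "a < 2 * n \<Longrightarrow> a mod n = (if a < n then a else a - n)"
  by (simp add: mod_if)

lemma m2: "2 * m < n"
  using n_eq by simp

text \<open>
  The idempotents separate the simple modules. The one-dimensional modules \<open>dim1 j\<close>
  and \<open>dim1 (j + n)\<close> have the same weight, and there the opposite eigenvalues of
  \<open>z\<close> decide; the pairs \<open>(j, j + t)\<close> and \<open>(j' + t', j')\<close>
  cannot agree modulo \<open>n\<close> because \<open>0 < t + t' < n\<close>.
\<close>

lemma mult_of_simple_rep:
  assumes "l \<in> labels" "l' \<in> labels"
  shows "mult_of l (simple_rep l') = (if l = l' then 1 else 0)"
proof -
  obtain j t j' t' where l: "l = (j, t)" "l' = (j', t')" by (cases l, cases l')
  have E: "mat 1 1 (\<lambda>_. z_val j') \<in> carrier_mat 1 1" by simp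
  show ?thesis
  proof (cases "t = 0")
    case t: True
    then have j: "j < 2 * n" using assms l by (auto simp: labels_def)
    show ?thesis
    proof (cases "t' = 0")
      case t': True
      then have j': "j' < 2 * n" using assms l by (auto simp: labels_def)
      define v where "v = (if q ^ j' = q ^ j then (1 + inverse (z_val j) * z_val j') / 2 else 0)"
      have "act (dim1 j') (idem1 j) = mat_diag 1 (\<lambda>_. v)"
        by (rule eq_matI) (auto simp: act_weight_idem1[OF E dim1_def] v_def)
      then have "mult_of l (simple_rep l') = card {i. i < (1::nat) \<and> v = 1}"
        by (simp add: mult_of_def simple_rep_def simple_idem_def l t t' idrank_diag)
      moreover have "v = 1 \<longleftrightarrow> j = j'"
      proof (cases "q ^ j' = q ^ j")
        case True
        then have m: "j' mod n = j mod n" by (simp add: q_pow_eq_iff)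
        consider "j' = j" | "j' = j + n" | "j = j' + n"
          using m j j' by (auto simp: mod_n_less split: if_splits)
        then show ?thesis
        proof cases
          case 1
          then show ?thesis by (simp add: v_def)
        next
          case 2
          then have "z_val j' = - z_val j" by (simp add: z_val_add_n)
          then show ?thesis using 2 n3 by (simp add: v_def)
        next
          case 3
          then have "z_val j = - z_val j'" by (simp add: z_val_add_n)
          then show ?thesis using 3 n3 by (simp add: v_def)
        qed
      qed (auto simp: v_def)
      moreover have "card {i. i < (1::nat) \<and> P} = (if P then 1 else 0)" for P by auto
      ultimately show ?thesis by (simp add: l t t')
    next
      case t': False
      then have j': "j' < n" "1 \<le> t'" "t' \<le> m" using assms l by (auto simp: labels_def)
      have ne: "q ^ j' \<noteq> q ^ (j' + t')"
        using j' m2 by (auto simp: q_pow_eq_iff mod_n_less split: if_splits)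
      have "act (dim2 j' (j' + t')) (idem1 j) = mat_diag 2 (\<lambda>_. 0)"
        unfolding dim2_def
        by (rule eq_matI) (use ne in \<open>auto simp: act_weight_idem1[OF _ swap_rep_def]\<close>)
      then have "mult_of l (simple_rep l') = 0" using t' by (simp add: mult_of_def simple_rep_def simple_idem_def l t idrank_diag)
      then show ?thesis using t t' by (simp add: l)
    qed
  next
    case t: False
    then have j: "j < n" "1 \<le> t" "t \<le> m" using assms l by (auto simp: labels_def)
    have ne: "q ^ j \<noteq> q ^ (j + t)"
      using j m2 by (auto simp: q_pow_eq_iff mod_n_less split: if_splits)
    show ?thesis
    proof (cases "t' = 0")
      case t': True
      have "act (dim1 j') (idem_wt j (j + t)) = mat_diag 1 (\<lambda>_. 0)"
        unfolding act_weight_idem_wt[OF E dim1_def] using ne by (auto intro!: arg_cong[of _ _ "mat_diag 1"])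
      then have "mult_of l (simple_rep l') = 0" using t by (simp add: mult_of_def simple_rep_def simple_idem_def l t' idrank_diag)
      then show ?thesis using t t' by (simp add: l)
    next
      case t': False
      then have j': "j' < n" "1 \<le> t'" "t' \<le> m" using assms l by (auto simp: labels_def)
      let ?a = "\<lambda>i. if i = 0 then j' else j' + t'" and ?b = "\<lambda>i. if i = 0 then j' + t' else j'"
      have "act (dim2 j' (j' + t')) (idem_wt j (j + t))
        = mat_diag 2 (\<lambda>i. if q ^ ?a i = q ^ j \<and> q ^ ?b i = q ^ (j + t) then 1 else 0)"
        unfolding dim2_def act_weight_idem_wt[OF swap_mat_carrier swap_rep_def] ..
      then have "mult_of l (simple_rep l') = card {i. i < (2::nat) \<and> (if q ^ ?a i = q ^ j \<and> q ^ ?b i = q ^ (j + t) then 1 else 0) = (1 :: 'k)}"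
        using t t' by (simp only: mult_of_def simple_rep_def simple_idem_def l fst_conv snd_conv if_False idrank_diag)
      also have "{i. i < (2::nat) \<and> (if q ^ ?a i = q ^ j \<and> q ^ ?b i = q ^ (j + t) then 1 else 0) = (1 :: 'k)}
          = {i. i = 0 \<and> j = j' \<and> t = t'}"
      proof -
        have "q ^ j' = q ^ j \<and> q ^ (j' + t') = q ^ (j + t) \<longleftrightarrow> j = j' \<and> t = t'"
          using j j' m2 by (auto simp: q_pow_eq_iff mod_n_less split: if_splits)
        moreover have "\<not> (q ^ (j' + t') = q ^ j \<and> q ^ j' = q ^ (j + t))"
          using j j' m2 by (auto simp: q_pow_eq_iff mod_n_less split: if_splits)
        ultimately show ?thesis by (auto simp: less_2_cases_iff)
      qed
      also have "card \<dots> = (if l = l' then 1 else 0)" by (auto simp: l)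
      finally show ?thesis .
    qed
  qed
qed

lemma rep_char_sum: "gens_ok R \<Longrightarrow> gens_ok R' \<Longrightarrow> rep_char (rep_sum R R') = rep_char R + rep_char R'"
  unfolding rep_char_def by (simp add: mult_of_sum distrib_right sum.distrib)

lemma rep_char_iso: "gens_ok R \<Longrightarrow> gens_ok R' \<Longrightarrow> rep_iso R R' \<Longrightarrow> rep_char R = rep_char R'"
  unfolding rep_char_def using mult_of_iso by (intro sum.cong) simp_all

lemma rep_char_zero_dim: "fst R = 0 \<Longrightarrow> rep_char R = 0"
  unfolding rep_char_def by (simp add: mult_of_zero_dim)

lemma rep_char_simple_rep: "l \<in> labels \<Longrightarrow> rep_char (simple_rep l) = simple_char l"
proof -
  assume l: "l \<in> labels"
  have "rep_char (simple_rep l) = (\<Sum>l'\<in>labels. if l' = l then simple_char l else 0)"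
    unfolding rep_char_def by (rule sum.cong) (use l in \<open>auto simp: mult_of_simple_rep\<close>)
  then show ?thesis using l finite_labels by simp
qed

lemma char_fun_eqI: "(\<And>i k. f (Inl (i, k)) = g (Inl (i, k))) \<Longrightarrow> (\<And>i. f (Inr i) = g (Inr i)) \<Longrightarrow> f = (g :: char_fun)"
proof
  fix x assume "\<And>i k. f (Inl (i, k)) = g (Inl (i, k))" "\<And>i. f (Inr i) = g (Inr i)"
  then show "f x = g x" by (cases x) (auto split: prod.split)
qed

lemma rep_char_dim1: "rep_char (dim1 j) = char1 j"
proof -
  let ?j = "j mod (2 * n)"
  have j: "?j < 2 * n" using n3 by simp
  have "dim1 j = dim1 ?j" by (rule dim1_cong) simp
  also have "\<dots> = simple_rep (?j, 0)" by (simp add: simple_rep_def)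
  finally have "rep_char (dim1 j) = simple_char (?j, 0)" using rep_char_simple_rep[of "(?j, 0)"] j by (simp add: labels_def)
  also have "\<dots> = char1 ?j" by (simp add: simple_char_def)
  also have "\<dots> = char1 j"
  proof (rule char_fun_eqI)
    fix i k
    have "(omega ^ i * omega ^ k) ^ (2 * n) = 1"
      by (simp add: power_mult_distrib omega_n mult.commute[of 2 n] power_mult[of _ n 2])
    then show "char1 ?j (Inl (i, k)) = char1 j (Inl (i, k))" by (simp add: char1_def power_mod_eq)
    have "(- (omega ^ i)) ^ (2 * n) = ((omega ^ i) ^ n) ^ 2"
      by (simp only: power_mult[of _ 2 n] power2_minus power_commutes flip: power_mult) (simp add: mult_ac)
    then have "(- (omega ^ i)) ^ (2 * n) = 1" by (simp add: omega_n)
    then show "char1 ?j (Inr i) = char1 j (Inr i)" by (simp add: char1_def power_mod_eq)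
  qed
  finally show ?thesis .
qed

lemma char2_mod: "char2 (a mod n) (b mod n) = char2 a b"
  by (rule char_fun_eqI) (simp_all add: char2_def power_mod_eq[OF omega_n])

lemma char2_commute: "char2 a b = char2 b a"
  by (rule char_fun_eqI) (simp_all add: char2_def add.commute)

text \<open>
  For a label this holds by \<open>rep_char_simple_rep\<close>. The general case reduces to labels
  by the symmetry of \<open>dim2\<close>, by reduction modulo \<open>n\<close>, and for equal
  weights by \<open>dim2_diag\<close>, where the contributions of the two summands at the single
  roots of unity cancel.
\<close>

lemma rep_char_dim2: "rep_char (dim2 a b) = char2 a b"
proof -
  have less: "rep_char (dim2 a b) = char2 a b" if ab: "a < b" "b < n" for a b
  proof (cases "b - a \<le> m")
    case True
    then have "(a, b - a) \<in> labels" using ab by (auto simp: labels_def)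
    from rep_char_simple_rep[OF this] show ?thesis using ab by (simp add: simple_rep_def simple_char_def)
  next
    case False
    (* For b - a > m, pass to the pair (b, a + n), whose difference is at most m. *)
    let ?t = "a + n - b"
    have t: "1 \<le> ?t" "?t \<le> m" using False ab n_eq by auto
    then have "(b, ?t) \<in> labels" using ab by (auto simp: labels_def)
    from rep_char_simple_rep[OF this] have "rep_char (dim2 b (a + n)) = char2 b (a + n)" using ab by (simp add: simple_rep_def simple_char_def)
    moreover have "dim2 b (a + n) = dim2 b a" by (rule dim2_cong) (simp_all add: power_add)
    moreover have "char2 b (a + n) = char2 a b"
      using char2_mod[of b "a + n"] char2_mod[of b a] by (simp add: char2_commute)
    ultimately show ?thesis using rep_char_iso[OF _ _ dim2_swap[of a b]] by simp
  qed
  have eq: "rep_char (dim2 a a) = char2 a a" for a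
  proof -
    have "rep_char (dim2 a a) = char1 a + char1 (a + n)"
      using rep_char_iso[OF _ _ dim2_diag[of a a]] gens_ok_sum[of "dim1 a" "dim1 (a + n)"] rep_char_sum[of "dim1 a" "dim1 (a + n)"]
      by (simp add: rep_char_dim1)
    also have "\<dots> = char2 a a"
    proof (rule char_fun_eqI)
      fix i k
      show "(char1 a + char1 (a + n)) (Inl (i, k)) = char2 a a (Inl (i, k))"
        by (simp add: char1_def char2_def power_add power_mult_distrib omega_n)
      show "(char1 a + char1 (a + n)) (Inr i) = char2 a a (Inr i)"
        using odd_n by (simp add: char1_def char2_def power_add omega_n)
    qed
    finally show ?thesis .
  qed
  let ?a = "a mod n" and ?b = "b mod n"
  have lt: "?a < n" "?b < n" using n3 by simp_all
  have "dim2 a b = dim2 ?a ?b" by (rule dim2_cong) (simp_all add: q_pow_eq_iff)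
  moreover have "rep_char (dim2 ?a ?b) = char2 ?a ?b"
  proof -
    consider "?a < ?b" | "?a = ?b" | "?b < ?a" by linarith
    then show ?thesis
    proof cases
      case 1
      then show ?thesis using less lt by blast
    next
      case 2
      then show ?thesis using eq[of ?b] by simp
    next
      case 3
      then have "rep_char (dim2 ?b ?a) = char2 ?b ?a" using less lt by blast
      then show ?thesis using rep_char_iso[OF _ _ dim2_swap[of ?a ?b]] by (simp add: char2_commute)
    qed
  qed
  ultimately show ?thesis by (simp add: char2_mod)
qed

section \<open>Multiplicativity of the character\<close>

text \<open>
  The two properties are carried through the inductions together, since the character of a tensor
  product is only known along the isomorphisms that also transport the relations.
\<close>

definition tensor_ok :: "'k rep \<Rightarrow> 'k rep \<Rightarrow> bool" where
  "tensor_ok R R' \<longleftrightarrow> is_rep n q (rep_tensor n q R R') \<and> rep_char (rep_tensor n q R R') = rep_char R * rep_char R'"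

lemma tensor_ok_iso:
  assumes R: "is_rep n q R" "is_rep n q R1" "is_rep n q R'" "is_rep n q R1'"
    and iso: "rep_iso R R1" "rep_iso R' R1'" and tensor_ok: "tensor_ok R1 R1'"
  shows "tensor_ok R R'"
proof -
  note g = is_rep_gens[OF R(1)] is_rep_gens[OF R(2)] is_rep_gens[OF R(3)] is_rep_gens[OF R(4)]
  have i: "rep_iso (rep_tensor n q R R') (rep_tensor n q R1 R1')" by (rule rep_iso_tensor[OF g iso])
  have "is_rep n q (rep_tensor n q R R')"
    using is_rep_iso[OF _ gens_ok_tensor rep_iso_sym[OF gens_ok_tensor gens_ok_tensor i]] tensor_ok by (simp add: tensor_ok_def)
  then show ?thesis
    using tensor_ok rep_char_iso[OF gens_ok_tensor gens_ok_tensor i] rep_char_iso[OF g(1,2) iso(1)] rep_char_iso[OF g(3,4) iso(2)]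
    by (simp add: tensor_ok_def)
qed

lemma tensor_ok_dim1_dim1: "tensor_ok (dim1 i) (dim1 j)"
proof -
  have "char1 (i + j) = char1 i * char1 j" by (rule char_fun_eqI) (simp_all add: char1_def power_add)
  then show ?thesis by (simp add: tensor_ok_def tensor_dim1_dim1 is_rep_dim1 rep_char_dim1)
qed

lemma rep_char_swap_rep: "\<alpha> * \<beta> = q ^ (a * b) \<Longrightarrow> rep_char (swap_rep a b \<alpha> \<beta>) = char2 a b"
  using rep_char_iso[OF _ _ swap_rep_iso_dim2[of \<alpha> \<beta> a b]] by (simp add: rep_char_dim2)

lemma tensor_ok_dim1_dim2: "tensor_ok (dim1 i) (dim2 a b)"
proof -
  have p: "(q ^ (i * a) * z_val i * 1) * (q ^ (i * b) * z_val i * q ^ (a * b)) = q ^ ((i + a) * (i + b))"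
  proof -
    have "(q ^ (i * a) * z_val i * 1) * (q ^ (i * b) * z_val i * q ^ (a * b))
      = (z_val i * z_val i) * (q ^ (i * a) * q ^ (i * b) * q ^ (a * b))" by (simp add: mult_ac)
    also have "\<dots> = q ^ ((i + a) * (i + b))"
      unfolding z_val_sq by (simp add: algebra_simps flip: power_add)
    finally show ?thesis .
  qed
  have c: "char2 (i + a) (i + b) = char1 i * char2 a b"
    by (rule char_fun_eqI) (simp_all add: char1_def char2_def power_add power_mult_distrib algebra_simps)
  show ?thesis
    using tensor_dim1_swap_rep[of i a b 1 "q ^ (a * b)"] is_rep_swap_rep[OF p] rep_char_swap_rep[OF p]
    by (simp add: tensor_ok_def dim2_def[symmetric] rep_char_dim1 rep_char_dim2 c)
qed

lemma tensor_ok_dim2_dim1: "tensor_ok (dim2 a b) (dim1 i)"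
proof -
  have p: "(q ^ (b * i) * 1 * z_val i) * (q ^ (a * i) * q ^ (a * b) * z_val i) = q ^ ((a + i) * (b + i))"
  proof -
    have "(q ^ (b * i) * 1 * z_val i) * (q ^ (a * i) * q ^ (a * b) * z_val i)
      = (z_val i * z_val i) * (q ^ (b * i) * q ^ (a * i) * q ^ (a * b))" by (simp add: mult_ac)
    also have "\<dots> = q ^ ((a + i) * (b + i))"
      unfolding z_val_sq by (simp add: algebra_simps flip: power_add)
    finally show ?thesis .
  qed
  have c: "char2 (a + i) (b + i) = char2 a b * char1 i"
    by (rule char_fun_eqI) (simp_all add: char1_def char2_def power_add power_mult_distrib algebra_simps)
  show ?thesis
    using tensor_swap_rep_dim1[of a b 1 "q ^ (a * b)" i] is_rep_swap_rep[OF p] rep_char_swap_rep[OF p]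
    by (simp add: tensor_ok_def dim2_def[symmetric] rep_char_dim1 rep_char_dim2 c)
qed

lemma tensor_ok_dim2_dim2: "tensor_ok (dim2 a b) (dim2 a' b')"
proof -
  let ?W1 = "swap_rep (a + a') (b + b') (q ^ (b * a') * 1 * 1) (q ^ (a * b') * q ^ (a * b) * q ^ (a' * b'))"
  let ?W2 = "swap_rep (a + b') (b + a') (q ^ (b * b') * 1 * q ^ (a' * b')) (q ^ (a * a') * q ^ (a * b) * 1)"
  have p1: "(q ^ (b * a') * 1 * 1) * (q ^ (a * b') * q ^ (a * b) * q ^ (a' * b')) = q ^ ((a + a') * (b + b'))"
    by (simp add: algebra_simps flip: power_add)
  have p2: "(q ^ (b * b') * 1 * q ^ (a' * b')) * (q ^ (a * a') * q ^ (a * b) * 1) = q ^ ((a + b') * (b + a'))"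
    by (simp add: algebra_simps flip: power_add)
  have i: "rep_iso (rep_tensor n q (dim2 a b) (dim2 a' b')) (rep_sum ?W1 ?W2)"
    unfolding dim2_def by (rule tensor_swap_rep_swap_rep)
  have r: "is_rep n q (rep_sum ?W1 ?W2)" by (rule is_rep_sum[OF is_rep_swap_rep[OF p1] is_rep_swap_rep[OF p2]])
  note gs = is_rep_gens[OF r]
  have "is_rep n q (rep_tensor n q (dim2 a b) (dim2 a' b'))"
    by (rule is_rep_iso[OF r gens_ok_tensor rep_iso_sym[OF gens_ok_tensor gs i]])
  moreover have "rep_char (rep_tensor n q (dim2 a b) (dim2 a' b')) = char2 (a + a') (b + b') + char2 (a + b') (b + a')"
    unfolding rep_char_iso[OF gens_ok_tensor gs i]
    using rep_char_sum[OF is_rep_gens[OF is_rep_swap_rep[OF p1]] is_rep_gens[OF is_rep_swap_rep[OF p2]]]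
    unfolding rep_char_swap_rep[OF p1] rep_char_swap_rep[OF p2] .
  moreover have "char2 (a + a') (b + b') + char2 (a + b') (b + a') = char2 a b * char2 a' b'"
    by (rule char_fun_eqI) (simp_all add: char2_def power_add algebra_simps)
  ultimately show ?thesis by (simp add: tensor_ok_def rep_char_dim2)
qed

lemma tensor_ok_simple_rep_simple_rep: "tensor_ok (simple_rep l) (simple_rep l')"
  by (simp add: simple_rep_def tensor_ok_dim1_dim1 tensor_ok_dim1_dim2 tensor_ok_dim2_dim1 tensor_ok_dim2_dim2)

lemma tensor_ok_zero_dim:
  assumes "fst R = 0 \<or> fst R' = 0"
  shows "tensor_ok R R'"
  using assms is_rep_zero_dim[OF gens_ok_tensor, of n q R R' n q] rep_char_zero_dim[of "rep_tensor n q R R'"]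
    rep_char_zero_dim[of R] rep_char_zero_dim[of R'] by (auto simp: tensor_ok_def)

text \<open>
  Induction over the second factor; the first one is kept simple.
\<close>

lemma tensor_ok_simple_rep: "is_rep n q R' \<Longrightarrow> tensor_ok (simple_rep l) R'"
proof (induction rule: rep_induct)
  case (zero R)
  then show ?case by (intro tensor_ok_zero_dim) simp
next
  case (sum l' R)
  note g = is_rep_gens[OF is_rep_simple_rep[of l]] is_rep_gens[OF is_rep_simple_rep[of l']] is_rep_gens[OF sum(2)]
  have i: "rep_iso (rep_tensor n q (simple_rep l) (rep_sum (simple_rep l') R))
      (rep_sum (rep_tensor n q (simple_rep l) (simple_rep l')) (rep_tensor n q (simple_rep l) R))"
    by (rule rep_tensor_sum_right[OF g])
  have r: "is_rep n q (rep_sum (rep_tensor n q (simple_rep l) (simple_rep l')) (rep_tensor n q (simple_rep l) R))"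
    using tensor_ok_simple_rep_simple_rep[of l l'] sum by (intro is_rep_sum) (simp_all add: tensor_ok_def)
  have "is_rep n q (rep_tensor n q (simple_rep l) (rep_sum (simple_rep l') R))"
    by (rule is_rep_iso[OF r gens_ok_tensor rep_iso_sym[OF gens_ok_tensor is_rep_gens[OF r] i]])
  moreover have "rep_char (rep_tensor n q (simple_rep l) (rep_sum (simple_rep l') R)) = rep_char (simple_rep l) * rep_char (simple_rep l') + rep_char (simple_rep l) * rep_char R"
    unfolding rep_char_iso[OF gens_ok_tensor is_rep_gens[OF r] i] rep_char_sum[OF gens_ok_tensor gens_ok_tensor]
    using tensor_ok_simple_rep_simple_rep[of l l'] sum by (simp add: tensor_ok_def)
  ultimately show ?case by (simp add: tensor_ok_def rep_char_sum[OF g(2,3)] distrib_left)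
next
  case (iso R R')
  then show ?case using tensor_ok_iso[OF is_rep_simple_rep is_rep_simple_rep iso(1,2) rep_iso_refl[OF is_rep_gens[OF is_rep_simple_rep]]] by blast
qed

text \<open>
  Induction over the first factor reduces this to \<open>tensor_ok_simple_rep\<close>.
\<close>

lemma all_tensor_ok: "is_rep n q R \<Longrightarrow> is_rep n q R' \<Longrightarrow> tensor_ok R R'"
proof (induction rule: rep_induct)
  case (zero R)
  then show ?case by (intro tensor_ok_zero_dim) simp
next
  case (sum l R)
  note g = is_rep_gens[OF is_rep_simple_rep[of l]] is_rep_gens[OF sum(2)] is_rep_gens[OF sum(4)]
  have gd: "tensor_ok (simple_rep l) R'" "tensor_ok R R'" using tensor_ok_simple_rep[OF sum(4)] sum(3)[OF sum(4)] by auto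
  then show ?case unfolding tensor_ok_def rep_tensor_sum_left[OF g]
    by (simp add: is_rep_sum rep_char_sum[OF gens_ok_tensor gens_ok_tensor] rep_char_sum[OF g(1,2)] distrib_right)
next
  case (iso R1 R2)
  then show ?case using tensor_ok_iso[OF iso(1,2) iso(5,5) iso(3) rep_iso_refl[OF is_rep_gens[OF iso(5)]]] by blast
qed

end

section \<open>Linear independence of the simple characters\<close>

lemma of_int_fun_apply [simp]: "(of_int k :: 'a \<Rightarrow> 'b::ring_1) x = of_int k"
  by (cases k rule: int_cases2) (simp_all del: of_nat_fun_apply add: of_nat_fun_apply fun_Compl_def)

lemma sum_fun_apply: "(\<Sum>i\<in>A. f i) x = (\<Sum>i\<in>A. (f i x :: 'b::comm_monoid_add))"
  by (induction A rule: infinite_finite_induct) simp_all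

context H_alg
begin

lemma omega_pow_eq_iff: "omega ^ a = omega ^ b \<longleftrightarrow> a mod n = b mod n"
  using primitive_root_power_eq_iff[OF prim_omega] n3 by simp

lemma omega_neq_0 [simp]: "omega \<noteq> 0"
  by (simp add: omega_def)

lemma omega_orthogonal:
  "(\<Sum>i<n. inverse ((omega ^ i) ^ a) * (omega ^ i) ^ b) = (if a mod n = b mod n then of_nat n else 0)"
proof -
  have sw: "(omega ^ i) ^ c = (omega ^ c) ^ i" for i c by (metis mult.commute power_mult)
  have "(\<Sum>i<n. inverse ((omega ^ i) ^ a) * (omega ^ i) ^ b) = (\<Sum>i<n. (omega ^ b / omega ^ a) ^ i)"
    by (intro sum.cong refl) (simp only: power_divide divide_inverse sw[of _ a] sw[of _ b] power_mult_distrib power_inverse mult.commute)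
  also have "(omega ^ b / omega ^ a) ^ n = 1" by (simp add: power_divide omega_n)
  from sum_powers_root_of_unity[OF this]
  have "(\<Sum>i<n. (omega ^ b / omega ^ a) ^ i) = (if omega ^ b = omega ^ a then of_nat n else 0)" by simp
  finally show ?thesis by (simp add: omega_pow_eq_iff eq_commute)
qed

definition pair_wt :: "nat \<Rightarrow> nat \<Rightarrow> char_fun \<Rightarrow> complex" where
  "pair_wt a b g = (\<Sum>i<n. \<Sum>k<n. inverse ((omega ^ i) ^ a) * inverse ((omega ^ k) ^ b) * g (Inl (i, k)))"

definition pair_diag :: "nat \<Rightarrow> char_fun \<Rightarrow> complex" where
  "pair_diag a g = (\<Sum>i<n. inverse ((omega ^ i) ^ a) * g (Inr i))"

lemma pair_wt_lincomb: "pair_wt a b (\<Sum>l\<in>A. of_int (f l) * g l) = (\<Sum>l\<in>A. of_int (f l) * pair_wt a b (g l))"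
proof -
  have "pair_wt a b (\<Sum>l\<in>A. of_int (f l) * g l)
    = (\<Sum>i<n. \<Sum>k<n. \<Sum>l\<in>A. of_int (f l) * (inverse ((omega ^ i) ^ a) * inverse ((omega ^ k) ^ b) * g l (Inl (i, k))))"
    by (simp add: pair_wt_def sum_fun_apply sum_distrib_left mult_ac)
  also have "\<dots> = (\<Sum>i<n. \<Sum>l\<in>A. \<Sum>k<n. of_int (f l) * (inverse ((omega ^ i) ^ a) * inverse ((omega ^ k) ^ b) * g l (Inl (i, k))))"
    by (intro sum.cong refl sum.swap)
  also have "\<dots> = (\<Sum>l\<in>A. of_int (f l) * pair_wt a b (g l))"
    by (subst sum.swap) (simp add: pair_wt_def sum_distrib_left)
  finally show ?thesis .
qed

lemma pair_diag_lincomb: "pair_diag a (\<Sum>l\<in>A. of_int (f l) * g l) = (\<Sum>l\<in>A. of_int (f l) * pair_diag a (g l))"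
proof -
  have "pair_diag a (\<Sum>l\<in>A. of_int (f l) * g l) = (\<Sum>i<n. \<Sum>l\<in>A. of_int (f l) * (inverse ((omega ^ i) ^ a) * g l (Inr i)))"
    by (simp add: pair_diag_def sum_fun_apply sum_distrib_left mult_ac)
  also have "\<dots> = (\<Sum>l\<in>A. of_int (f l) * pair_diag a (g l))"
    by (subst sum.swap) (simp add: pair_diag_def sum_distrib_left)
  finally show ?thesis .
qed

lemma pair_wt_monomial:
  "(\<Sum>i<n. \<Sum>k<n. inverse ((omega ^ i) ^ a) * inverse ((omega ^ k) ^ b) * ((omega ^ i) ^ c * (omega ^ k) ^ d))
    = (if a mod n = c mod n \<and> b mod n = d mod n then of_nat n ^ 2 else 0)"
proof -
  have "(\<Sum>i<n. \<Sum>k<n. inverse ((omega ^ i) ^ a) * inverse ((omega ^ k) ^ b) * ((omega ^ i) ^ c * (omega ^ k) ^ d))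
    = (\<Sum>i<n. inverse ((omega ^ i) ^ a) * (omega ^ i) ^ c) * (\<Sum>k<n. inverse ((omega ^ k) ^ b) * (omega ^ k) ^ d)"
    unfolding sum_product by (intro sum.cong refl) (simp add: mult_ac)
  then show ?thesis by (simp add: omega_orthogonal power2_eq_square)
qed

lemma pair_wt_char1: "pair_wt a b (char1 j) = (if a mod n = j mod n \<and> b mod n = j mod n then of_nat n ^ 2 else 0)"
  using pair_wt_monomial[of a b j j] by (simp add: pair_wt_def char1_def power_mult_distrib)

lemma pair_wt_char2: "pair_wt a b (char2 c d)
  = (if a mod n = c mod n \<and> b mod n = d mod n then of_nat n ^ 2 else 0)
  + (if a mod n = d mod n \<and> b mod n = c mod n then of_nat n ^ 2 else 0)"
  using pair_wt_monomial[of a b c d] pair_wt_monomial[of a b d c]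
  by (simp add: pair_wt_def char2_def distrib_left sum.distrib)

lemma pair_diag_char1: "pair_diag a (char1 j) = (if a mod n = j mod n then (- 1) ^ j * of_nat n else 0)"
proof -
  have "pair_diag a (char1 j) = (- 1) ^ j * (\<Sum>i<n. inverse ((omega ^ i) ^ a) * (omega ^ i) ^ j)"
    unfolding pair_diag_def char1_def sum_distrib_left
    by (intro sum.cong refl) (simp, subst power_minus, simp add: mult_ac)
  then show ?thesis by (simp add: omega_orthogonal)
qed

text \<open>
  Pair the relation with the weight of a label. For \<open>t0 > 0\<close> only the label itself
  contributes. For \<open>t0 = 0\<close> the labels \<open>(j1, 0)\<close> and \<open>(j1 + n,
  0)\<close> have the same weight and give the sum of their coefficients; as \<open>n\<close> is
  odd they have opposite signs at the single roots of unity, which gives the difference.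
\<close>

lemma simple_char_independent:
  assumes zero: "(\<Sum>l\<in>labels. of_int (f l) * simple_char l) = 0" and l0: "l0 \<in> labels"
  shows "f l0 = 0"
proof -
  have L: "(\<Sum>l\<in>labels. of_int (f l) * pair_wt a b (simple_char l)) = 0" for a b
    using pair_wt_lincomb[of a b f simple_char labels] by (simp add: zero) (simp add: pair_wt_def)
  have R: "(\<Sum>l\<in>labels. of_int (f l) * pair_diag a (simple_char l)) = 0" for a
    using pair_diag_lincomb[of a f simple_char labels] by (simp add: zero) (simp add: pair_diag_def)
  have n0: "(of_nat n :: complex) \<noteq> 0" using n3 by simp
  obtain j0 t0 where l0': "l0 = (j0, t0)" by (cases l0)
  show ?thesis
  proof (cases "t0 = 0")
    case False
    then have j0: "j0 < n" "1 \<le> t0" "t0 \<le> m" using l0 by (auto simp: l0' labels_def)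
    have "(\<Sum>l\<in>labels. of_int (f l) * pair_wt j0 (j0 + t0) (simple_char l)) = (\<Sum>l\<in>labels. if l = l0 then of_int (f l0) * of_nat n ^ 2 else 0)"
    proof (rule sum.cong[OF refl])
      fix l assume "l \<in> labels"
      then obtain j t where l: "l = (j, t)" "t = 0 \<and> j < 2 * n \<or> j < n \<and> 1 \<le> t \<and> t \<le> m" by (auto simp: labels_def)
      show "of_int (f l) * pair_wt j0 (j0 + t0) (simple_char l) = (if l = l0 then of_int (f l0) * of_nat n ^ 2 else 0)"
      proof (cases "t = 0")
        case True
        have neg: "\<not> (j0 mod n = j mod n \<and> (j0 + t0) mod n = j mod n)"
        proof
          assume "j0 mod n = j mod n \<and> (j0 + t0) mod n = j mod n"
          then have "(j0 + t0) mod n = j0 mod n" by simp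
          then show False using j0 m2 by (simp add: mod_n_less split: if_splits)
        qed
        have "pair_wt j0 (j0 + t0) (simple_char l) = 0"
          by (simp only: l(1) simple_char_def True fst_conv snd_conv simp_thms if_True pair_wt_char1 neg if_False)
        then show ?thesis using True j0 by (simp add: l l0')
      next
        case False
        then have j: "j < n" "1 \<le> t" "t \<le> m" using l by auto
        have neg: "\<not> (j0 mod n = (j + t) mod n \<and> (j0 + t0) mod n = j mod n)"
          using j j0 m2 by (auto simp: mod_n_less split: if_splits)
        have iff: "j0 mod n = j mod n \<and> (j0 + t0) mod n = (j + t) mod n \<longleftrightarrow> j = j0 \<and> t = t0"
          using j j0 m2 by (auto simp: mod_n_less split: if_splits)
        have "pair_wt j0 (j0 + t0) (simple_char l) = (if j = j0 \<and> t = t0 then of_nat n ^ 2 else 0)"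
          by (simp only: l(1) simple_char_def False fst_conv snd_conv if_False pair_wt_char2 neg iff add_0_right)
        then show ?thesis by (simp add: l l0')
      qed
    qed
    then have "of_int (f l0) * (of_nat n ^ 2 :: complex) = 0" using L[of j0 "j0 + t0"] l0 finite_labels by simp
    then show ?thesis using n0 by simp
  next
    case True
    (* The labels of weight (j0, j0) are (j1, 0) and (j1 + n, 0). *)
    define j1 where "j1 = j0 mod n"
    have j1: "j1 < n" using n3 by (simp add: j1_def)
    have j0: "j0 = j1 \<or> j0 = j1 + n" using l0 by (auto simp: l0' labels_def j1_def True mod_n_less)
    have inLab: "{(j1, 0), (j1 + n, 0)} \<subseteq> labels" using j1 by (auto simp: labels_def)
    have chiL: "pair_wt j1 j1 (simple_char l) = 0" "pair_diag j1 (simple_char l) = 0" if l_in: "l \<in> labels - {(j1, 0), (j1 + n, 0)}" for l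
    proof -
      obtain j t where l: "l = (j, t)" "t = 0 \<and> j < 2 * n \<or> j < n \<and> 1 \<le> t \<and> t \<le> m" using l_in by (auto simp: labels_def)
      have *: "pair_wt j1 j1 (simple_char l) = 0 \<and> pair_diag j1 (simple_char l) = 0"
      proof (cases "t = 0")
        case True
        then have "\<not> j1 mod n = j mod n" using l l_in j1 by (auto simp: mod_n_less split: if_splits)
        then show ?thesis using True by (simp add: l simple_char_def pair_wt_char1 pair_diag_char1)
      next
        case False
        then have "\<not> (j1 mod n = j mod n \<and> j1 mod n = (j + t) mod n)"
          using l m2 by (auto simp: mod_n_less split: if_splits)
        moreover have "\<not> (j1 mod n = (j + t) mod n \<and> j1 mod n = j mod n)" using calculation by blast
        ultimately have "pair_wt j1 j1 (simple_char l) = 0"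
          by (simp only: l(1) simple_char_def False fst_conv snd_conv if_False pair_wt_char2 add_0_right)
        moreover have "pair_diag j1 (simple_char l) = 0" using False by (simp add: l simple_char_def pair_diag_def char2_def)
        ultimately show ?thesis by simp
      qed
      then show "pair_wt j1 j1 (simple_char l) = 0" "pair_diag j1 (simple_char l) = 0" by auto
    qed
    have "(\<Sum>l\<in>{(j1, 0), (j1 + n, 0)}. of_int (f l) * pair_wt j1 j1 (simple_char l)) = 0"
      using L[of j1 j1] sum.mono_neutral_left[OF finite_labels inLab, of "\<lambda>l. of_int (f l) * pair_wt j1 j1 (simple_char l)"] chiL by simp
    then have "(of_int (f (j1, 0)) + of_int (f (j1 + n, 0))) * (of_nat n ^ 2 :: complex) = 0"
      using n3 by (simp add: simple_char_def pair_wt_char1 algebra_simps)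
    then have "of_int (f (j1, 0)) + of_int (f (j1 + n, 0)) = (0 :: complex)" using n0 by simp
    then have s: "f (j1, 0) + f (j1 + n, 0) = 0" by (simp flip: of_int_add)
    have "(\<Sum>l\<in>{(j1, 0), (j1 + n, 0)}. of_int (f l) * pair_diag j1 (simple_char l)) = 0"
      using R[of j1] sum.mono_neutral_left[OF finite_labels inLab, of "\<lambda>l. of_int (f l) * pair_diag j1 (simple_char l)"] chiL by simp
    then have "(of_int (f (j1, 0)) - of_int (f (j1 + n, 0))) * ((- 1) ^ j1 * of_nat n :: complex) = 0"
      using n3 odd_n by (simp add: simple_char_def pair_diag_char1 power_add algebra_simps)
    then have "of_int (f (j1, 0)) - of_int (f (j1 + n, 0)) = (0 :: complex)" using n0 by simp
    then have "f (j1, 0) - f (j1 + n, 0) = 0" by (simp flip: of_int_diff)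
    then show ?thesis using s j0 by (auto simp: l0' True)
  qed
qed

end

section \<open>Evaluation of polynomials in two variables\<close>

definition poly_hom :: "('a::comm_ring_1 \<Rightarrow> 'b::comm_ring_1) \<Rightarrow> 'b \<Rightarrow> 'a poly \<Rightarrow> 'b" where
  "poly_hom h x p = poly (map_poly h p) x"

definition is_hom :: "('a::comm_ring_1 \<Rightarrow> 'b::comm_ring_1) \<Rightarrow> bool" where
  "is_hom h \<longleftrightarrow> h 0 = 0 \<and> h 1 = 1 \<and> (\<forall>a b. h (a + b) = h a + h b) \<and> (\<forall>a b. h (a * b) = h a * h b)"

context
  fixes h :: "'a::comm_ring_1 \<Rightarrow> 'b::comm_ring_1" and x :: 'b
  assumes h: "is_hom h"
begin

lemma poly_hom_pCons: "poly_hom h x (pCons a p) = h a + x * poly_hom h x p"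
proof -
  have "h 0 = 0" using h by (simp add: is_hom_def)
  then have "map_poly h (pCons a p) = pCons (h a) (map_poly h p)" by (rule Polynomial.map_poly_pCons)
  then show ?thesis by (simp add: poly_hom_def)
qed

lemma poly_hom_0: "poly_hom h x 0 = 0"
  by (simp add: poly_hom_def)

lemma poly_hom_add: "poly_hom h x (p + r) = poly_hom h x p + poly_hom h x r"
  using h by (induction p r rule: poly_induct2) (simp_all add: poly_hom_0 poly_hom_pCons is_hom_def algebra_simps)

lemma poly_hom_smult: "poly_hom h x (Polynomial.smult a p) = h a * poly_hom h x p"
  using h by (induction p) (simp_all add: poly_hom_0 poly_hom_pCons is_hom_def algebra_simps)

lemma poly_hom_mult: "poly_hom h x (p * r) = poly_hom h x p * poly_hom h x r"
proof (induction p)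
  case (pCons a p)
  have "h 0 = 0" using h by (simp add: is_hom_def)
  then show ?case using pCons by (simp add: poly_hom_add poly_hom_smult poly_hom_pCons algebra_simps)
qed (simp add: poly_hom_0)

lemma is_hom_poly_hom: "is_hom (poly_hom h x)"
  using h by (simp add: is_hom_def[of "poly_hom h x"] poly_hom_0 poly_hom_add poly_hom_mult one_pCons poly_hom_pCons)
     (simp add: is_hom_def)

end

lemma is_hom_of_int: "is_hom of_int"
  by (simp add: is_hom_def)

lemma is_hom_power: "is_hom h \<Longrightarrow> h (a ^ k) = h a ^ k"
  by (induction k) (simp_all add: is_hom_def)

lemma is_hom_diff: "is_hom h \<Longrightarrow> h (a - b) = h a - h b"
  unfolding is_hom_def by (metis add_diff_cancel_right' diff_add_cancel)

lemma is_hom_of_int_apply: "is_hom h \<Longrightarrow> h (of_int k) = of_int k"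
proof -
  assume h: "is_hom h"
  have nat: "h (of_nat k) = of_nat k" for k by (induction k) (use h in \<open>simp_all add: is_hom_def\<close>)
  have "h (- of_nat k) = - of_nat k" for k
    using is_hom_diff[OF h, of 0 "of_nat k"] h nat by (simp add: is_hom_def)
  then show ?thesis using nat by (cases k rule: int_cases2) simp_all
qed

lemma is_hom_sum: "is_hom h \<Longrightarrow> h (\<Sum>i\<in>A. f i) = (\<Sum>i\<in>A. h (f i))"
  by (induction A rule: infinite_finite_induct) (simp_all add: is_hom_def)

section \<open>The presentation\<close>

text \<open>
  Both sides satisfy the recursion of \<open>F\<close>, by Pascal's rule. The bound of the sum may
  be raised freely, because the binomial coefficient vanishes for \<open>2 i > t\<close>.
\<close>

lemma F_closed_form:
  "F (Suc t) = (\<Sum>i\<le>t div 2. (- 1) ^ i * of_nat ((t - i) choose i) * varY ^ i * varZ ^ (t - 2 * i))"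
proof -
  define T where "T t i = (- 1) ^ i * of_nat ((t - i) choose i) * varY ^ i * varZ ^ (t - 2 * i)" for t i
  have T0: "T t i = 0" if "t < 2 * i" for t i
  proof -
    have "t - i < i" using that by simp
    then show ?thesis by (simp add: T_def)
  qed
  have ext: "(\<Sum>i\<le>t div 2. T t i) = (\<Sum>i\<le>N. T t i)" if "t div 2 \<le> N" for t N
    by (rule sum.mono_neutral_left) (use that in \<open>auto intro!: T0\<close>)
  have step: "T (Suc (Suc t)) (Suc i) = varZ * T (Suc t) (Suc i) - varY * T t i" for t i
  proof (cases "t < 2 * i")
    case True
    then show ?thesis by (simp add: T0)
  next
    case False
    then obtain s where s: "t = 2 * i + s" by (metis le_add_diff_inverse not_less)
    show ?thesis
    proof (cases s)
      case 0
      then show ?thesis using s by (simp add: T_def)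
    next
      case (Suc s')
      have "(Suc (Suc t) - Suc i) choose Suc i = ((Suc t - Suc i) choose Suc i) + ((t - i) choose i)"
        using s Suc by (simp add: Suc_diff_le)
      moreover have "varZ * varZ ^ (Suc t - 2 * Suc i) = varZ ^ (t - 2 * i)" using s Suc by simp
      ultimately show ?thesis
        unfolding T_def by (simp add: algebra_simps)
    qed
  qed
  have "F (Suc t) = (\<Sum>i\<le>t div 2. T t i)"
  proof (induction t rule: less_induct)
    case (less t)
    consider "t = 0" | "t = 1" | s where "t = Suc (Suc s)" by (metis One_nat_def not0_implies_Suc)
    then show ?case
    proof cases
      case 3
      have "(\<Sum>i\<le>t div 2. T t i) = T t 0 + (\<Sum>i\<le>s div 2. T t (Suc i))"
      proof -
        have "t div 2 = Suc (s div 2)" by (simp add: 3)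
        then show ?thesis by (simp only: sum.atMost_Suc_shift)
      qed
      also have "\<dots> = varZ * T (Suc s) 0 + (\<Sum>i\<le>s div 2. varZ * T (Suc s) (Suc i) - varY * T s i)"
        by (simp add: 3 step) (simp add: T_def)
      also have "\<dots> = varZ * (T (Suc s) 0 + (\<Sum>i\<le>s div 2. T (Suc s) (Suc i))) - varY * (\<Sum>i\<le>s div 2. T s i)"
        by (simp add: sum_subtractf sum_distrib_left distrib_left)
      also have "T (Suc s) 0 + (\<Sum>i\<le>s div 2. T (Suc s) (Suc i)) = (\<Sum>i\<le>Suc (s div 2). T (Suc s) i)"
        by (simp only: sum.atMost_Suc_shift)
      also have "\<dots> = (\<Sum>i\<le>Suc s div 2. T (Suc s) i)" by (rule ext[symmetric]) simp
      finally show ?thesis using less[of s] less[of "Suc s"] 3 by simp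
    qed (simp_all add: T_def)
  qed
  then show ?thesis by (simp add: T_def)
qed

context H_alg
begin

definition poly_char :: "int poly poly \<Rightarrow> char_fun" where
  "poly_char = poly_hom (poly_hom of_int (char1 1)) (char2 0 1)"

lemma is_hom_poly_char: "is_hom poly_char"
  unfolding poly_char_def by (intro is_hom_poly_hom is_hom_of_int)

lemma poly_char_varY: "poly_char varY = char1 1"
proof -
  have "is_hom (poly_hom of_int (char1 1))" by (intro is_hom_poly_hom is_hom_of_int)
  then show ?thesis
    by (simp add: poly_char_def varY_def poly_hom_pCons is_hom_of_int poly_hom_0)
qed

lemma poly_char_varZ: "poly_char varZ = char2 0 1"
proof -
  have h: "is_hom (poly_hom of_int (char1 1))" by (intro is_hom_poly_hom is_hom_of_int)
  then have "poly_hom of_int (char1 1) 1 = 1" "poly_hom of_int (char1 1) 0 = 0" by (simp_all add: is_hom_def)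
  then show ?thesis
    unfolding poly_char_def varZ_def poly_hom_pCons[OF h] by (simp add: poly_hom_0[OF h] del: One_nat_def)
qed

text \<open>
  The polynomial representing \<open>dim2 0 t\<close>. The recursion is the tensor rule
  \<open>dim2 0 1 \<otimes> dim2 0 (t + 1) = dim2 0 (t + 2) + dim2 1 (t + 1)\<close>; the value at
  0 reflects that \<open>dim2 0 0\<close> is the sum of \<open>dim1 0\<close> and \<open>dim1
  n\<close>.
\<close>

fun dim2_poly :: "nat \<Rightarrow> int poly poly" where
  "dim2_poly 0 = 1 + varY ^ n"
| "dim2_poly (Suc 0) = varZ"
| "dim2_poly (Suc (Suc t)) = varZ * dim2_poly (Suc t) - varY * dim2_poly t"

text \<open>
  Both sides satisfy the recursion of \<open>F\<close> and agree at \<open>t = 0\<close> and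
  \<open>t = 1\<close>.
\<close>

lemma dim2_poly_F: "dim2_poly (Suc t) = F (Suc (Suc t)) - varY ^ (n + 1) * F t"
proof (induction t rule: less_induct)
  case (less t)
  consider "t = 0" | "t = 1" | s where "t = Suc (Suc s)" by (metis One_nat_def not0_implies_Suc)
  then show ?case
  proof cases
    case 3
    have "dim2_poly (Suc t) = varZ * dim2_poly (Suc (Suc s)) - varY * dim2_poly (Suc s)" by (simp only: 3 dim2_poly.simps)
    also have "\<dots> = varZ * (F (Suc (Suc (Suc s))) - varY ^ (n + 1) * F (Suc s)) - varY * (F (Suc (Suc s)) - varY ^ (n + 1) * F s)"
      using less[of s] less[of "Suc s"] 3 by (simp only:)
    also have "\<dots> = F (Suc (Suc t)) - varY ^ (n + 1) * F t"
      unfolding 3 F.simps(3)[of "Suc (Suc s)"] F.simps(3)[of s] by (simp only: algebra_simps)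
    finally show ?thesis .
  qed (simp_all add: algebra_simps)
qed

definition rel_gens :: "int poly poly set" where
  "rel_gens = {varY ^ (2 * n) - 1, varZ * varY ^ n - varZ, dim2_poly (m + 1) - varY ^ (m + 1) * dim2_poly m}"

definition rel_ideal :: "int poly poly set" where
  "rel_ideal = Idl\<^bsub>ring_of_type_algebra\<^esub> rel_gens"

text \<open>
  The two sums are \<open>F\<^sub>m\<^sub>+\<^sub>2\<close> and
  \<open>F\<^sub>m\<^sub>+\<^sub>1\<close> without their leading terms. Together with the last two
  terms they combine to the polynomials of \<open>dim2 0 (m + 1)\<close> and \<open>dim2 0
  m\<close>.
\<close>

lemma third_relation:
  "varZ ^ (m + 1) - varZ ^ m * varY ^ (m + 1)
     + (\<Sum>i = 1..(m + 1) div 2. (-1) ^ i * of_nat ((m + 1 - i) choose i) * varY ^ i * varZ ^ (m + 1 - 2 * i))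
     - (\<Sum>i = 1..m div 2. (-1) ^ i * of_nat ((m - i) choose i) * varY ^ (m + 1 + i) * varZ ^ (m - 2 * i))
     - varY ^ (n + 1) * F m + varY ^ (m + n + 2) * F (m - 1) = dim2_poly (m + 1) - varY ^ (m + 1) * dim2_poly m"
proof -
  let ?T = "\<lambda>t i. (- 1) ^ i * of_nat ((t - i) choose i) * varY ^ i * varZ ^ (t - 2 * i)"
  have Fs: "F (Suc t) = varZ ^ t + (\<Sum>i = 1..t div 2. ?T t i)" for t
  proof -
    have "{..t div 2} = insert 0 {1..t div 2}" by auto
    then show ?thesis by (simp add: F_closed_form)
  qed
  have "(\<Sum>i = 1..m div 2. (-1) ^ i * of_nat ((m - i) choose i) * varY ^ (m + 1 + i) * varZ ^ (m - 2 * i))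
    = varY ^ (m + 1) * (\<Sum>i = 1..m div 2. ?T m i)"
    unfolding sum_distrib_left by (intro sum.cong refl) (simp add: power_add mult_ac)
  also have "(\<Sum>i = 1..m div 2. ?T m i) = F (Suc m) - varZ ^ m" by (simp add: Fs)
  finally have 1: "(\<Sum>i = 1..m div 2. (-1) ^ i * of_nat ((m - i) choose i) * varY ^ (m + 1 + i) * varZ ^ (m - 2 * i))
    = varY ^ (m + 1) * (F (Suc m) - varZ ^ m)" .
  have 2: "(\<Sum>i = 1..(m + 1) div 2. ?T (m + 1) i) = F (Suc (Suc m)) - varZ ^ (m + 1)"
    using Fs[of "m + 1"] by simp
  obtain m' where m': "m = Suc m'" using m_pos by (cases m) auto
  have mt1: "dim2_poly (m + 1) = F (Suc (Suc m)) - varY ^ (n + 1) * F m" using dim2_poly_F[of m] by simp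
  have mt2: "dim2_poly m = F (Suc m) - varY ^ (n + 1) * F (m - 1)" using dim2_poly_F[of m'] by (simp add: m')
  have "varY ^ (m + n + 2) = varY ^ (m + 1) * varY ^ (n + 1)" by (simp flip: power_add)
  then show ?thesis unfolding 1 2 mt1 mt2 by (simp only: algebra_simps)
qed

lemma ideal_I: "ideal rel_ideal ring_of_type_algebra"
  unfolding rel_ideal_def by (rule ideal_genideal_type_algebra)

lemmas I_closed = ideal_type_algebraD[OF ideal_I]

lemma rel_gens_I: "p \<in> rel_gens \<Longrightarrow> p \<in> rel_ideal"
  unfolding rel_ideal_def by (rule genideal_type_algebra_self)

lemma omega_2n: "(omega ^ i) ^ (2 * n) = 1"
proof -
  have "(omega ^ i) ^ (2 * n) = ((omega ^ i) ^ n) ^ 2" by (metis mult.commute power_mult)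
  then show ?thesis by (simp add: omega_n)
qed

lemma char1_add: "char1 (i + j) = char1 i * char1 j"
  by (rule char_fun_eqI) (simp_all add: char1_def power_add)

lemma char1_0: "char1 0 = 1"
  by (rule char_fun_eqI) (simp_all add: char1_def)

lemma char1_power: "char1 1 ^ j = char1 j"
  by (induction j) (simp_all add: char1_0 flip: char1_add)

lemma char1_char2: "char1 i * char2 a b = char2 (i + a) (i + b)"
  by (rule char_fun_eqI) (simp_all add: char1_def char2_def power_add power_mult_distrib algebra_simps)

lemma poly_char_power_varY: "poly_char (varY ^ j) = char1 j"
  by (simp only: is_hom_power[OF is_hom_poly_char] poly_char_varY char1_power)

lemma poly_char_dim2_poly: "poly_char (dim2_poly t) = char2 0 t"
proof (induction t rule: dim2_poly.induct)
  case 1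
  have "poly_char (dim2_poly 0) = 1 + char1 n"
    using is_hom_poly_char by (simp add: poly_char_power_varY is_hom_def)
  also have "\<dots> = char2 0 0"
    by (rule char_fun_eqI) (use odd_n in \<open>simp_all add: char1_def char2_def power_mult_distrib omega_n\<close>)
  finally show ?case .
next
  case 2
  show ?case by (simp add: poly_char_varZ)
next
  case (3 t)
  have "poly_char (dim2_poly (Suc (Suc t))) = char2 0 1 * char2 0 (Suc t) - char1 1 * char2 0 t"
    using 3 is_hom_poly_char by (simp add: is_hom_diff poly_char_varY poly_char_varZ is_hom_def)
  also have "\<dots> = char2 0 (Suc (Suc t))"
    by (rule char_fun_eqI) (simp_all add: char1_def char2_def algebra_simps)
  finally show ?case .
qed

text \<open>
  The polynomial representing \<open>simple_rep l\<close>: \<open>dim2 j (j + t)\<close> is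
  \<open>dim1 j \<otimes> dim2 0 t\<close>.
\<close>

definition simple_poly :: "nat \<times> nat \<Rightarrow> int poly poly" where
  "simple_poly l = (if snd l = 0 then varY ^ fst l else varY ^ fst l * dim2_poly (snd l))"

lemma poly_char_mult: "poly_char (p * r) = poly_char p * poly_char r"
  using is_hom_poly_char by (simp add: is_hom_def)

lemma poly_char_add: "poly_char (p + r) = poly_char p + poly_char r" and poly_char_0: "poly_char 0 = 0"
  using is_hom_poly_char by (simp_all add: is_hom_def)

lemma poly_char_simple_poly: "poly_char (simple_poly l) = simple_char l"
  by (simp add: simple_poly_def simple_char_def poly_char_mult poly_char_power_varY poly_char_dim2_poly char1_char2)

lemma poly_char_I: "p \<in> rel_ideal \<Longrightarrow> poly_char p = 0"
proof -
  have "ideal {p. poly_char p = 0} ring_of_type_algebra"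
    by (rule ideal_type_algebraI) (simp_all add: poly_char_mult poly_char_add poly_char_0)
  moreover have "rel_gens \<subseteq> {p. poly_char p = 0}"
  proof -
    have "char1 (2 * n) = 1"
      by (rule char_fun_eqI) (simp_all add: char1_def power_mult_distrib omega_2n)
    moreover have "char2 0 1 * char1 n = char2 0 1"
    proof -
      have "char2 0 1 * char1 n = char2 (n + 0) (n + 1)" by (simp only: mult.commute[of "char2 0 1"] char1_char2)
      also have "\<dots> = char2 0 1" by (rule char_fun_eqI) (simp_all add: char2_def omega_n)
      finally show ?thesis .
    qed
    moreover have "char1 (m + 1) * char2 0 m = char2 0 (m + 1)"
    proof -
      have "m + 1 + m = n" using n_eq by simp
      then have "char1 (m + 1) * char2 0 m = char2 (m + 1) n" by (simp only: char1_char2 add_0_right)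
      also have "\<dots> = char2 (m + 1) 0" using char2_mod[of "m + 1" n] char2_mod[of "m + 1" 0] by simp
      finally show ?thesis by (simp add: char2_commute)
    qed
    moreover have "poly_char 1 = 1" using is_hom_poly_char by (simp add: is_hom_def)
    ultimately have "poly_char (varY ^ (2 * n) - 1) = 0" "poly_char (varZ * varY ^ n - varZ) = 0"
      "poly_char (dim2_poly (m + 1) - varY ^ (m + 1) * dim2_poly m) = 0"
      by (simp_all only: is_hom_diff[OF is_hom_poly_char] poly_char_mult poly_char_power_varY poly_char_dim2_poly poly_char_varZ diff_self)
    then show ?thesis by (simp add: rel_gens_def)
  qed
  ultimately have "rel_ideal \<subseteq> {p. poly_char p = 0}" unfolding rel_ideal_def by (rule genideal_type_algebra_minimal)
  then show "p \<in> rel_ideal \<Longrightarrow> poly_char p = 0" by auto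
qed

definition spanned :: "int poly poly \<Rightarrow> bool" where
  "spanned p \<longleftrightarrow> (\<exists>f. p - (\<Sum>l\<in>labels. of_int (f l) * simple_poly l) \<in> rel_ideal)"

lemma spanned_add: "spanned p \<Longrightarrow> spanned r \<Longrightarrow> spanned (p + r)"
proof -
  assume "spanned p" "spanned r"
  then obtain f g where "p - (\<Sum>l\<in>labels. of_int (f l) * simple_poly l) \<in> rel_ideal" "r - (\<Sum>l\<in>labels. of_int (g l) * simple_poly l) \<in> rel_ideal"
    by (auto simp: spanned_def)
  from I_closed(2)[OF this] have "(p + r) - (\<Sum>l\<in>labels. of_int (f l + g l) * simple_poly l) \<in> rel_ideal"
    by (simp add: sum.distrib distrib_right algebra_simps)
  then show ?thesis unfolding spanned_def by (rule exI[of _ "\<lambda>l. f l + g l"])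
qed

lemma spanned_of_int: "spanned p \<Longrightarrow> spanned (of_int k * p)"
proof -
  assume "spanned p"
  then obtain f where "p - (\<Sum>l\<in>labels. of_int (f l) * simple_poly l) \<in> rel_ideal" by (auto simp: spanned_def)
  from I_closed(3)[OF this, of "of_int k"] have "of_int k * p - (\<Sum>l\<in>labels. of_int (k * f l) * simple_poly l) \<in> rel_ideal"
    by (simp add: right_diff_distrib sum_distrib_left mult.assoc)
  then show ?thesis unfolding spanned_def by (rule exI[of _ "\<lambda>l. k * f l"])
qed

lemma spanned_cong: "p - r \<in> rel_ideal \<Longrightarrow> spanned r \<Longrightarrow> spanned p"
proof -
  assume pr: "p - r \<in> rel_ideal" and "spanned r"
  then obtain f where "r - (\<Sum>l\<in>labels. of_int (f l) * simple_poly l) \<in> rel_ideal" by (auto simp: spanned_def)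
  from I_closed(2)[OF pr this] show ?thesis unfolding spanned_def by (intro exI[of _ f]) simp
qed

lemma spanned_0: "spanned 0"
  unfolding spanned_def by (rule exI[of _ "\<lambda>_. 0"]) (simp add: I_closed(1))

lemma spanned_sum: "(\<And>i. i \<in> A \<Longrightarrow> spanned (f i)) \<Longrightarrow> spanned (\<Sum>i\<in>A. f i)"
  by (induction A rule: infinite_finite_induct) (simp_all add: spanned_0 spanned_add)

lemma spanned_simple_poly: "l \<in> labels \<Longrightarrow> spanned (simple_poly l)"
proof -
  assume l: "l \<in> labels"
  have "(\<Sum>l'\<in>labels. of_int (if l' = l then 1 else 0) * simple_poly l') = (\<Sum>l'\<in>labels. if l' = l then simple_poly l else 0)"
    by (rule sum.cong) auto
  then have "simple_poly l - (\<Sum>l'\<in>labels. of_int (if l' = l then 1 else 0) * simple_poly l') = 0" using l finite_labels by simp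
  then have "simple_poly l - (\<Sum>l'\<in>labels. of_int (if l' = l then 1 else 0) * simple_poly l') \<in> rel_ideal" by (simp only: I_closed(1))
  then show ?thesis unfolding spanned_def by (rule exI[of _ "\<lambda>l'. if l' = l then 1 else 0"])
qed

lemma spanned_varY: "spanned (varY ^ j)"
proof (induction j rule: less_induct)
  case (less j)
  show ?case
  proof (cases "j < 2 * n")
    case True
    then have "(j, 0) \<in> labels" by (simp add: labels_def)
    from spanned_simple_poly[OF this] show ?thesis by (simp add: simple_poly_def)
  next
    case False
    have "varY ^ (j - 2 * n) * (varY ^ (2 * n) - 1) \<in> rel_ideal"
      by (intro I_closed(3) rel_gens_I) (simp add: rel_gens_def)
    then have "varY ^ j - varY ^ (j - 2 * n) \<in> rel_ideal"
      using False by (simp add: right_diff_distrib flip: power_add)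
    then show ?thesis by (rule spanned_cong) (use less[of "j - 2 * n"] False n3 in auto)
  qed
qed

text \<open>
  The first two relations are the cases \<open>t = 0\<close> and \<open>t = 1\<close>, and the
  recursion does the rest.
\<close>

lemma varY_n_dim2_poly: "varY ^ n * dim2_poly t - dim2_poly t \<in> rel_ideal"
proof (induction t rule: dim2_poly.induct)
  case 1
  have "varY ^ (2 * n) = varY ^ n * varY ^ n" by (simp add: mult_2 power_add)
  then have "varY ^ n * dim2_poly 0 - dim2_poly 0 = varY ^ (2 * n) - 1" by (simp only: dim2_poly.simps) (simp add: algebra_simps)
  then show ?case using rel_gens_I by (simp add: rel_gens_def)
next
  case 2
  have "varY ^ n * dim2_poly (Suc 0) - dim2_poly (Suc 0) = varZ * varY ^ n - varZ" by (simp add: mult.commute)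
  then show ?case using rel_gens_I by (simp add: rel_gens_def)
next
  case (3 t)
  have "varY ^ n * dim2_poly (Suc (Suc t)) - dim2_poly (Suc (Suc t))
    = varZ * (varY ^ n * dim2_poly (Suc t) - dim2_poly (Suc t)) - varY * (varY ^ n * dim2_poly t - dim2_poly t)"
    by (simp add: algebra_simps)
  then show ?case using I_closed(6)[OF I_closed(3)[OF 3(1)] I_closed(3)[OF 3(2)]] by simp
qed

lemma spanned_varY_dim2_poly:
  assumes "1 \<le> t" "t \<le> m"
  shows "spanned (varY ^ j * dim2_poly t)"
proof (induction j rule: less_induct)
  case (less j)
  show ?case
  proof (cases "j < n")
    case True
    then have "(j, t) \<in> labels" using assms by (simp add: labels_def)
    from spanned_simple_poly[OF this] show ?thesis using assms by (simp add: simple_poly_def)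
  next
    case False
    have "varY ^ (j - n) * (varY ^ n * dim2_poly t - dim2_poly t) \<in> rel_ideal" by (intro I_closed(3) varY_n_dim2_poly)
    moreover have "varY ^ (j - n) * (varY ^ n * dim2_poly t) = varY ^ j * dim2_poly t"
      using False by (simp flip: power_add mult.assoc)
    ultimately have "varY ^ j * dim2_poly t - varY ^ (j - n) * dim2_poly t \<in> rel_ideal" by (simp add: right_diff_distrib)
    then show ?thesis by (rule spanned_cong) (use less[of "j - n"] False n3 in auto)
  qed
qed

text \<open>
  At the ends of the range: \<open>t = 0\<close> is a sum of two powers of \<open>y\<close>, and
  \<open>t = m + 1\<close> is reduced by the third relation.
\<close>

lemma spanned_varY_dim2_poly': "t \<le> m + 1 \<Longrightarrow> spanned (varY ^ j * dim2_poly t)"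
proof -
  assume "t \<le> m + 1"
  then consider "t = 0" | "1 \<le> t" "t \<le> m" | "t = m + 1" by linarith
  then show ?thesis
  proof cases
    case 1
    then show ?thesis using spanned_add[OF spanned_varY[of j] spanned_varY[of "j + n"]]
      by (simp add: distrib_left power_add)
  next
    case 2
    then show ?thesis by (rule spanned_varY_dim2_poly)
  next
    case 3
    have "varY ^ j * (dim2_poly (m + 1) - varY ^ (m + 1) * dim2_poly m) \<in> rel_ideal"
      by (intro I_closed(3) rel_gens_I) (simp add: rel_gens_def)
    then have "varY ^ j * dim2_poly t - varY ^ (j + (m + 1)) * dim2_poly m \<in> rel_ideal"
      by (simp add: 3 right_diff_distrib power_add mult_ac)
    then show ?thesis by (rule spanned_cong) (rule spanned_varY_dim2_poly, use m_pos in auto)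
  qed
qed

lemma spanned_mult:
  assumes "\<And>l. l \<in> labels \<Longrightarrow> spanned (v * simple_poly l)" "spanned p"
  shows "spanned (v * p)"
proof -
  obtain f where f: "p - (\<Sum>l\<in>labels. of_int (f l) * simple_poly l) \<in> rel_ideal" using assms(2) by (auto simp: spanned_def)
  have "v * p - v * (\<Sum>l\<in>labels. of_int (f l) * simple_poly l) \<in> rel_ideal"
    using I_closed(3)[OF f, of v] by (simp add: right_diff_distrib)
  moreover have "v * (\<Sum>l\<in>labels. of_int (f l) * simple_poly l) = (\<Sum>l\<in>labels. of_int (f l) * (v * simple_poly l))"
    by (simp add: sum_distrib_left mult_ac)
  ultimately show ?thesis
    using spanned_cong[of "v * p"] spanned_sum[of labels "\<lambda>l. of_int (f l) * (v * simple_poly l)"] spanned_of_int assms(1) by simp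
qed

lemma spanned_varY_mult: "spanned p \<Longrightarrow> spanned (varY * p)"
proof (rule spanned_mult)
  fix l assume "l \<in> labels"
  then show "spanned (varY * simple_poly l)"
    using spanned_varY[of "Suc (fst l)"] spanned_varY_dim2_poly'[of "snd l" "Suc (fst l)"]
    by (auto simp: simple_poly_def mult.assoc labels_def)
qed

lemma spanned_varZ_mult: "spanned p \<Longrightarrow> spanned (varZ * p)"
proof (rule spanned_mult)
  fix l assume "l \<in> labels"
  then obtain j t where l: "l = (j, t)" "t \<le> m" by (auto simp: labels_def)
  show "spanned (varZ * simple_poly l)"
  proof (cases t)
    case 0
    then show ?thesis using spanned_varY_dim2_poly'[of "Suc 0" j] by (simp add: simple_poly_def l mult.commute)
  next
    case (Suc s)
    have "varZ * simple_poly l = varY ^ j * dim2_poly (Suc t) + varY ^ (Suc j) * dim2_poly s"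
      by (simp add: simple_poly_def l Suc algebra_simps)
    then show ?thesis
      using spanned_add[OF spanned_varY_dim2_poly'[of "Suc t" j] spanned_varY_dim2_poly'[of s "Suc j"]] l Suc by simp
  qed
qed

text \<open>
  The span contains the constants and is closed under multiplication by \<open>y\<close> and by
  \<open>z\<close>.
\<close>

lemma spanned_all: "spanned p"
proof -
  have const: "spanned [:c:]" for c
  proof (induction c)
    case 0
    show ?case using spanned_0 by simp
  next
    case (pCons a c)
    have "[:pCons a c:] = of_int a * varY ^ 0 + varY * [:c:]"
      by (simp add: varY_def of_int_poly)
    then show ?case by (simp only: spanned_add[OF spanned_of_int[OF spanned_varY] spanned_varY_mult[OF pCons(2)]])
  qed
  show ?thesis
  proof (induction p)
    case 0
    show ?case by (rule spanned_0)
  next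
    case (pCons c p)
    have "pCons c p = [:c:] + varZ * p" by (simp add: varZ_def)
    then show ?case by (simp only: spanned_add[OF const[of c] spanned_varZ_mult[OF pCons(2)]])
  qed
qed

lemma poly_char_lincomb: "poly_char (\<Sum>l\<in>labels. of_int (f l) * simple_poly l) = (\<Sum>l\<in>labels. of_int (f l) * simple_char l)"
  by (simp add: is_hom_sum[OF is_hom_poly_char] poly_char_mult is_hom_of_int_apply[OF is_hom_poly_char] poly_char_simple_poly)

lemma poly_char_spanned: obtains f where "p - (\<Sum>l\<in>labels. of_int (f l) * simple_poly l) \<in> rel_ideal"
  "poly_char p = (\<Sum>l\<in>labels. of_int (f l) * simple_char l)"
proof -
  obtain f where f: "p - (\<Sum>l\<in>labels. of_int (f l) * simple_poly l) \<in> rel_ideal" using spanned_all[of p] by (auto simp: spanned_def)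
  have "poly_char p = (\<Sum>l\<in>labels. of_int (f l) * simple_char l)"
    using poly_char_I[OF f] by (simp add: is_hom_diff[OF is_hom_poly_char] poly_char_lincomb)
  then show thesis using that f by blast
qed

lemma poly_char_eq_0_iff: "poly_char p = 0 \<longleftrightarrow> p \<in> rel_ideal"
proof
  assume p: "poly_char p = 0"
  obtain f where f: "p - (\<Sum>l\<in>labels. of_int (f l) * simple_poly l) \<in> rel_ideal" "poly_char p = (\<Sum>l\<in>labels. of_int (f l) * simple_char l)"
    by (rule poly_char_spanned)
  then have "f l = 0" if "l \<in> labels" for l using simple_char_independent[of f l] p that by simp
  then show "p \<in> rel_ideal" using f(1) by simp
qed (rule poly_char_I)

lemma range_poly_char: "range poly_char = range (\<lambda>f. \<Sum>l\<in>labels. of_int (f l) * simple_char l)"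
proof
  show "range poly_char \<subseteq> range (\<lambda>f. \<Sum>l\<in>labels. of_int (f l) * simple_char l)" using poly_char_spanned by blast
  show "range (\<lambda>f. \<Sum>l\<in>labels. of_int (f l) * simple_char l) \<subseteq> range poly_char" by (auto simp flip: poly_char_lincomb)
qed

end

section \<open>Quotients by kernels\<close>

definition image_ring :: "'c::ring_1 set \<Rightarrow> 'c ring" where
  "image_ring A = \<lparr>carrier = A, monoid.mult = (*), one = 1, ring.zero = 0, add = (+)\<rparr>"

text \<open>
  The cosets of \<open>K\<close> are the fibres of \<open>h\<close>, so the quotient inherits its
  ring structure from the target of \<open>h\<close>. In this way the associativity of the tensor
  product up to isomorphism comes from that of the multiplication of functions.
\<close>

lemma quotient_by_kernel_iso:
  fixes R :: "'a::ab_group_add ring" and h :: "'a \<Rightarrow> 'c::ring_1"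
  assumes add: "add R = (+)" and zero: "0 \<in> carrier R"
    and plus: "\<And>a b. a \<in> carrier R \<Longrightarrow> b \<in> carrier R \<Longrightarrow> a + b \<in> carrier R"
    and minus: "\<And>a b. a \<in> carrier R \<Longrightarrow> b \<in> carrier R \<Longrightarrow> a - b \<in> carrier R"
    and mult: "\<And>a b. a \<in> carrier R \<Longrightarrow> b \<in> carrier R \<Longrightarrow> a \<otimes>\<^bsub>R\<^esub> b \<in> carrier R"
    and one: "\<one>\<^bsub>R\<^esub> \<in> carrier R"
    and h_add: "\<And>a b. a \<in> carrier R \<Longrightarrow> b \<in> carrier R \<Longrightarrow> h (a + b) = h a + h b"
    and h_mult: "\<And>a b. a \<in> carrier R \<Longrightarrow> b \<in> carrier R \<Longrightarrow> h (a \<otimes>\<^bsub>R\<^esub> b) = h a * h b"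
    and h_one: "h \<one>\<^bsub>R\<^esub> = 1"
    and K: "K = {a \<in> carrier R. h a = 0}"
  shows "R Quot K \<simeq> image_ring (h ` carrier R)"
proof -
  define fib where "fib a = {b \<in> carrier R. h b = h a}" for a
  have h_minus: "h (a - b) = h a - h b" if "a \<in> carrier R" "b \<in> carrier R" for a b
    using h_add[OF minus[OF that] that(2)] by simp
  have coset: "K +>\<^bsub>R\<^esub> a = fib a" if a: "a \<in> carrier R" for a
  proof -
    have "K +>\<^bsub>R\<^esub> a = {k + a |k. k \<in> K}" by (auto simp: a_r_coset_def r_coset_def add)
    also have "\<dots> = fib a"
    proof (intro equalityI subsetI)
      fix b assume "b \<in> {k + a |k. k \<in> K}"
      then show "b \<in> fib a" using a plus h_add by (auto simp: K fib_def)
    next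
      fix b assume b: "b \<in> fib a"
      then have "b - a \<in> K" using a minus h_minus by (auto simp: K fib_def)
      then show "b \<in> {k + a |k. k \<in> K}" by force
    qed
    finally show ?thesis .
  qed
  have carr: "carrier (R Quot K) = fib ` carrier R"
    by (auto simp: FactRing_def A_RCOSETS_def' coset)
  have self: "a \<in> fib a" if "a \<in> carrier R" for a using that by (simp add: fib_def)
  have fib_mult: "fib a \<otimes>\<^bsub>R Quot K\<^esub> fib b = fib (a \<otimes>\<^bsub>R\<^esub> b)" if ab: "a \<in> carrier R" "b \<in> carrier R" for a b
  proof -
    have "K +>\<^bsub>R\<^esub> (x \<otimes>\<^bsub>R\<^esub> y) = fib (a \<otimes>\<^bsub>R\<^esub> b)" if "x \<in> fib a" "y \<in> fib b" for x y
    proof -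
      have xy: "x \<in> carrier R" "y \<in> carrier R" "h x = h a" "h y = h b" using that by (auto simp: fib_def)
      then show ?thesis using ab by (simp add: coset mult) (simp add: fib_def h_mult)
    qed
    then have "(\<Union>x\<in>fib a. \<Union>y\<in>fib b. K +>\<^bsub>R\<^esub> (x \<otimes>\<^bsub>R\<^esub> y)) = fib (a \<otimes>\<^bsub>R\<^esub> b)"
      using self[OF ab(1)] self[OF ab(2)] by blast
    then show ?thesis by (simp add: FactRing_def rcoset_mult_def)
  qed
  have fib_add: "fib a \<oplus>\<^bsub>R Quot K\<^esub> fib b = fib (a + b)" if ab: "a \<in> carrier R" "b \<in> carrier R" for a b
  proof -
    have "fib a \<oplus>\<^bsub>R Quot K\<^esub> fib b = {x + y |x y. x \<in> fib a \<and> y \<in> fib b}"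
      by (auto simp: FactRing_def set_add_def set_mult_def add)
    also have "\<dots> = fib (a + b)"
    proof (intro equalityI subsetI)
      fix c assume "c \<in> {x + y |x y. x \<in> fib a \<and> y \<in> fib b}"
      then show "c \<in> fib (a + b)" using ab plus h_add by (auto simp: fib_def)
    next
      fix c assume c: "c \<in> fib (a + b)"
      then have "c - a \<in> fib b" using ab minus h_minus h_add by (auto simp: fib_def)
      moreover have "c = a + (c - a)" by simp
      ultimately show "c \<in> {x + y |x y. x \<in> fib a \<and> y \<in> fib b}" using self[OF ab(1)] by blast
    qed
    finally show ?thesis .
  qed
  have fib_one: "\<one>\<^bsub>R Quot K\<^esub> = fib \<one>\<^bsub>R\<^esub>" by (simp add: FactRing_def coset one)
  let ?g = "\<lambda>A. the_elem (h ` A)"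
  have g: "?g (fib a) = h a" if "a \<in> carrier R" for a
    by (rule the_elem_image_const[OF self[OF that]]) (simp add: fib_def)
  have "?g \<in> ring_iso (R Quot K) (image_ring (h ` carrier R))"
  proof (rule ring_iso_memI)
    show "bij_betw ?g (carrier (R Quot K)) (carrier (image_ring (h ` carrier R)))"
      unfolding bij_betw_def
    proof
      show "inj_on ?g (carrier (R Quot K))"
      proof (rule inj_onI)
        fix A B assume AB: "A \<in> carrier (R Quot K)" "B \<in> carrier (R Quot K)" "?g A = ?g B"
        then obtain a b where ab: "a \<in> carrier R" "A = fib a" "b \<in> carrier R" "B = fib b"
          by (auto simp: carr)
        then have "h a = h b" using AB(3) by (simp only: g)
        then show "A = B" by (simp add: ab fib_def)
      qed
      show "?g ` carrier (R Quot K) = carrier (image_ring (h ` carrier R))"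
        by (auto simp: carr g image_ring_def image_iff)
    qed
  qed (auto simp: carr g fib_mult fib_add fib_one plus mult one h_add h_mult h_one image_ring_def)
  then show ?thesis by (auto simp: is_ring_iso_def)
qed

section \<open>Isomorphism classes of modules\<close>

context H_alg
begin

abbreviation cls :: "'k hmod \<Rightarrow> 'k hmod set" where "cls \<equiv> iso_class n q"
abbreviation rof :: "'k hmod \<Rightarrow> 'k rep" where "rof \<equiv> rep_of n q"

lemma rof_gens: "is_hmod n q M \<Longrightarrow> gens_ok (rof M)"
  by (blast intro: is_rep_gens is_rep_rep_of)

lemma mem_cls: "N \<in> cls M \<longleftrightarrow> is_hmod n q N \<and> rep_iso (rof M) (rof N)" if "is_hmod n q M"
  unfolding iso_class_def using hmod_iso_iff[OF that, of N] by blast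

lemma cls_self: "is_hmod n q M \<Longrightarrow> M \<in> cls M"
  using rep_iso_refl[OF rof_gens, of M] by (simp add: mem_cls)

lemma cls_eq:
  assumes M: "is_hmod n q M" and N: "is_hmod n q N" and iso: "rep_iso (rof M) (rof N)"
  shows "cls M = cls N"
proof -
  note MN = rof_gens[OF M] rof_gens[OF N]
  have "rep_iso (rof M) (rof L) \<longleftrightarrow> rep_iso (rof N) (rof L)" if "is_hmod n q L" for L
    using rep_iso_trans[OF MN rof_gens[OF that] iso]
      rep_iso_trans[OF MN(2,1) rof_gens[OF that] rep_iso_sym[OF MN iso]] by blast
  then show ?thesis using M N by (auto simp: mem_cls)
qed

definition class_char :: "'k hmod set \<Rightarrow> char_fun" where
  "class_char C = rep_char (rof (SOME M. M \<in> C))"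

lemma class_char_cls: "is_hmod n q M \<Longrightarrow> class_char (cls M) = rep_char (rof M)"
proof -
  assume M: "is_hmod n q M"
  have "(SOME N. N \<in> cls M) \<in> cls M" using cls_self[OF M] by (rule someI)
  then have "is_hmod n q (SOME N. N \<in> cls M)" "rep_iso (rof M) (rof (SOME N. N \<in> cls M))"
    by (simp_all only: mem_cls[OF M])
  then show ?thesis using rep_char_iso[OF rof_gens[OF M] rof_gens] by (simp only: class_char_def)
qed

lemma iso_classesE: "C \<in> iso_classes n q \<Longrightarrow> (\<And>M. is_hmod n q M \<Longrightarrow> C = cls M \<Longrightarrow> thesis) \<Longrightarrow> thesis"
  by (auto simp: iso_classes_def)

lemma cls_in: "is_hmod n q M \<Longrightarrow> cls M \<in> iso_classes n q"
  by (auto simp: iso_classes_def)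

lemma hmod_tensor_ok:
  assumes "is_hmod n q M" "is_hmod n q N"
  shows "is_hmod n q (hmod_tensor n q M N)" "rof (hmod_tensor n q M N) = rep_tensor n q (rof M) (rof N)"
    "rep_char (rof (hmod_tensor n q M N)) = rep_char (rof M) * rep_char (rof N)"
proof -
  have g: "tensor_ok (rof M) (rof N)" by (intro all_tensor_ok is_rep_rep_of assms)
  then have T: "is_rep n q (rep_tensor n q (rof M) (rof N))" by (simp add: tensor_ok_def)
  show "is_hmod n q (hmod_tensor n q M N)" "rof (hmod_tensor n q M N) = rep_tensor n q (rof M) (rof N)"
    by (rule hmod_tensor_rep[OF assms T])+
  then show "rep_char (rof (hmod_tensor n q M N)) = rep_char (rof M) * rep_char (rof N)" using g by (simp add: tensor_ok_def)
qed

lemma class_tensor_cls: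
  assumes M: "is_hmod n q M" and N: "is_hmod n q N"
  shows "class_tensor n q (cls M) (cls N) = cls (hmod_tensor n q M N)"
proof -
  have "cls (hmod_tensor n q M' N') = cls (hmod_tensor n q M N)" if "M' \<in> cls M" "N' \<in> cls N" for M' N'
  proof -
    have M': "is_hmod n q M'" "rep_iso (rof M) (rof M')" and N': "is_hmod n q N'" "rep_iso (rof N) (rof N')"
      using that by (simp_all add: mem_cls M N)
    have "rep_iso (rep_tensor n q (rof M) (rof N)) (rep_tensor n q (rof M') (rof N'))"
      by (intro rep_iso_tensor rof_gens M N M' N')
    then show ?thesis
      using cls_eq[OF hmod_tensor_ok(1)[OF M N] hmod_tensor_ok(1)[OF M'(1) N'(1)]]
      by (simp add: hmod_tensor_ok(2)[OF M N] hmod_tensor_ok(2)[OF M'(1) N'(1)])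
  qed
  then show ?thesis unfolding class_tensor_def using cls_self[OF M] cls_self[OF N] by blast
qed

lemma class_tensor_in: "C \<in> iso_classes n q \<Longrightarrow> D \<in> iso_classes n q \<Longrightarrow> class_tensor n q C D \<in> iso_classes n q"
  by (elim iso_classesE) (simp add: class_tensor_cls cls_in hmod_tensor_ok)

lemma class_char_tensor:
  "C \<in> iso_classes n q \<Longrightarrow> D \<in> iso_classes n q \<Longrightarrow> class_char (class_tensor n q C D) = class_char C * class_char D"
  by (elim iso_classesE) (simp add: class_tensor_cls class_char_cls hmod_tensor_ok(1,3))

section \<open>The character on the Green ring\<close>

abbreviation FG :: "('k hmod set \<Rightarrow>\<^sub>0 int) ring" where "FG \<equiv> free_green_ring n q"

lemma FG_simps [simp]:
  "carrier FG = {a. Poly_Mapping.keys a \<subseteq> iso_classes n q}"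
  "monoid.mult FG = (\<lambda>a b. frag_extend (\<lambda>C. frag_extend (\<lambda>D. frag_of (class_tensor n q C D)) b) a)"
  "one FG = frag_of (cls hmod_unit)" "ring.zero FG = 0" "add FG = (+)"
  by (simp_all add: free_green_ring_def)

definition green_char :: "('k hmod set \<Rightarrow>\<^sub>0 int) \<Rightarrow> char_fun" where
  "green_char a = (\<Sum>C\<in>Poly_Mapping.keys a. of_int (Poly_Mapping.lookup a C) * class_char C)"

lemma green_char_superset:
  assumes "finite A" "Poly_Mapping.keys a \<subseteq> A"
  shows "green_char a = (\<Sum>C\<in>A. of_int (Poly_Mapping.lookup a C) * class_char C)"
  unfolding green_char_def by (rule sum.mono_neutral_left) (use assms in \<open>auto simp: in_keys_iff\<close>)

lemma green_char_add: "green_char (a + b) = green_char a + green_char b"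
proof -
  let ?A = "Poly_Mapping.keys a \<union> Poly_Mapping.keys b"
  have A: "finite ?A" by simp
  have "Poly_Mapping.keys (a + b) \<subseteq> ?A" by (rule Poly_Mapping.keys_add)
  then show ?thesis by (simp add: green_char_superset[OF A] lookup_add sum.distrib distrib_right)
qed

lemma green_char_of [simp]: "green_char (frag_of C) = class_char C"
  by (simp add: green_char_def)

lemma green_char_0 [simp]: "green_char 0 = 0"
  by (simp add: green_char_def)

lemma green_char_diff: "green_char (a - b) = green_char a - green_char b"
  using green_char_add[of "a - b" b] by simp

lemma keys_diff_FG: "a \<in> carrier FG \<Longrightarrow> b \<in> carrier FG \<Longrightarrow> a - b \<in> carrier FG"
  using keys_diff[of a b] by auto

lemma keys_add_FG: "a \<in> carrier FG \<Longrightarrow> b \<in> carrier FG \<Longrightarrow> a + b \<in> carrier FG"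
  using Poly_Mapping.keys_add[of a b] by auto

lemma FG_induct [consumes 1, case_names zero of diff]:
  assumes a: "a \<in> carrier FG" and "P 0" and "\<And>M. is_hmod n q M \<Longrightarrow> P (frag_of (cls M))"
    and "\<And>a b. P a \<Longrightarrow> P b \<Longrightarrow> P (a - b)"
  shows "P a"
  by (rule frag_induction[of a "iso_classes n q"]) (use assms in \<open>auto elim: iso_classesE\<close>)

lemma FG_mult:
  assumes "a \<in> carrier FG" "b \<in> carrier FG"
  shows "a \<otimes>\<^bsub>FG\<^esub> b \<in> carrier FG \<and> green_char (a \<otimes>\<^bsub>FG\<^esub> b) = green_char a * green_char b"
proof -
  have inner: "frag_extend (\<lambda>D. frag_of (class_tensor n q C D)) b \<in> carrier FG \<and>
      green_char (frag_extend (\<lambda>D. frag_of (class_tensor n q C D)) b) = class_char C * green_char b"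
    if C: "C \<in> iso_classes n q" for C
    using assms(2)
  proof (induction b rule: FG_induct)
    case (of M)
    then show ?case using class_tensor_in[OF C cls_in] class_char_tensor[OF C cls_in] by simp
  next
    case (diff a b)
    then show ?case using keys_diff_FG by (simp add: frag_extend_diff green_char_diff right_diff_distrib del: FG_simps)
  qed simp
  show ?thesis using assms(1)
  proof (induction a rule: FG_induct)
    case (of M)
    then show ?case using inner[OF cls_in] by simp
  next
    case (diff a a')
    then show ?case using keys_diff_FG
      by (simp add: frag_extend_diff green_char_diff left_diff_distrib del: FG_simps(1))
  qed simp
qed

lemma unit_ok: "is_hmod n q (hmod_unit :: 'k hmod)" "rof hmod_unit = dim1 0"
  using hmod_unit_rep[of n q] is_rep_dim1[of 0] by (simp_all add: rep_unit_eq)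

section \<open>The relations generate the kernel\<close>

abbreviation K_rel :: "('k hmod set \<Rightarrow>\<^sub>0 int) set" where
  "K_rel \<equiv> generate (add_monoid FG) (sum_relations n q)"

lemma sum_relation_ok:
  assumes "r \<in> sum_relations n q"
  shows "r \<in> carrier FG" "green_char r = 0"
proof -
  obtain M N where MN: "is_hmod n q M" "is_hmod n q N"
    and r: "r = frag_of (cls (hmod_sum M N)) - (frag_of (cls M) + frag_of (cls N))"
    using assms by (auto simp: sum_relations_def)
  show "r \<in> carrier FG" unfolding r
    by (intro keys_diff_FG keys_add_FG) (simp_all add: cls_in MN hmod_sum_rep)
  show "green_char r = 0"
    unfolding r by (simp add: green_char_diff green_char_add class_char_cls MN hmod_sum_rep rep_char_sum[OF rof_gens[OF MN(1)] rof_gens[OF MN(2)]])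
qed

lemma inv_FG: "a \<in> carrier FG \<Longrightarrow> inv\<^bsub>add_monoid FG\<^esub> a = - a"
proof -
  assume a: "a \<in> carrier FG"
  have "- a \<in> carrier FG" using keys_diff_FG[of 0 a] a by simp
  then show ?thesis unfolding m_inv_def
    by (intro the_equality) (auto simp: eq_neg_iff_add_eq_0)
qed

lemma K_rel_kernel: "r \<in> K_rel \<Longrightarrow> r \<in> carrier FG \<and> green_char r = 0"
proof (induction rule: generate.induct)
  case one
  show ?case by simp
next
  case (incl h)
  then show ?case using sum_relation_ok by blast
next
  case (inv h)
  then have h: "h \<in> carrier FG" "green_char h = 0" using sum_relation_ok by blast+
  then show ?case using keys_diff_FG[of 0 h] green_char_diff[of 0 h] inv_FG[OF h(1)] by simp
next
  case (eng h1 h2)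
  then show ?case using keys_add_FG[of h1 h2] by (simp add: green_char_add)
qed

lemma K_rel_0: "0 \<in> K_rel"
  using generate.one[of "add_monoid FG" "sum_relations n q"] by simp

lemma K_rel_add: "a \<in> K_rel \<Longrightarrow> b \<in> K_rel \<Longrightarrow> a + b \<in> K_rel"
  using generate.eng[of a "add_monoid FG" "sum_relations n q" b] by simp

lemma K_rel_uminus: "a \<in> K_rel \<Longrightarrow> - a \<in> K_rel"
proof (induction rule: generate.induct)
  case one
  show ?case using K_rel_0 by simp
next
  case (incl h)
  then show ?case using generate.inv[OF incl, of "add_monoid FG"] inv_FG[OF sum_relation_ok(1)[OF incl]] by simp
next
  case (inv h)
  then show ?case using generate.incl[OF inv, of "add_monoid FG"] inv_FG[OF sum_relation_ok(1)[OF inv]] by simp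
next
  case (eng h1 h2)
  then show ?case using K_rel_add[of "- h1" "- h2"] by simp
qed

lemma K_rel_diff: "a \<in> K_rel \<Longrightarrow> b \<in> K_rel \<Longrightarrow> a - b \<in> K_rel"
  using K_rel_add[OF _ K_rel_uminus, of a b] by simp

lemma K_rel_sum:
  "is_hmod n q M \<Longrightarrow> is_hmod n q N \<Longrightarrow> frag_of (cls (hmod_sum M N)) - (frag_of (cls M) + frag_of (cls N)) \<in> K_rel"
  by (rule generate.incl) (unfold sum_relations_def, blast)

definition simple_class :: "nat \<times> nat \<Rightarrow> ('k hmod set \<Rightarrow>\<^sub>0 int)" where
  "simple_class l = frag_of (cls (hmod_of (simple_rep l)))"

lemma simple_class_FG: "simple_class l \<in> carrier FG" and green_char_simple_class: "l \<in> labels \<Longrightarrow> green_char (simple_class l) = simple_char l"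
  by (simp_all add: simple_class_def cls_in is_hmod_hmod_of is_rep_simple_rep class_char_cls rep_char_simple_rep)

definition class_comb :: "(nat \<times> nat \<Rightarrow> int) \<Rightarrow> ('k hmod set \<Rightarrow>\<^sub>0 int)" where
  "class_comb f = (\<Sum>l\<in>labels. frag_cmul (f l) (simple_class l))"

lemma class_comb_diff: "class_comb (\<lambda>l. f l - g l) = class_comb f - class_comb g"
  by (simp add: class_comb_def frag_cmul_diff_distrib sum_subtractf)

lemma class_comb_add: "class_comb (\<lambda>l. f l + g l) = class_comb f + class_comb g"
  by (simp add: class_comb_def frag_cmul_distrib sum.distrib)

lemma class_comb_single: "l \<in> labels \<Longrightarrow> class_comb (\<lambda>l'. if l' = l then 1 else 0) = simple_class l"
proof -
  assume l: "l \<in> labels"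
  have "class_comb (\<lambda>l'. if l' = l then 1 else 0) = (\<Sum>l'\<in>labels. if l' = l then simple_class l else 0)"
    unfolding class_comb_def by (rule sum.cong) auto
  then show ?thesis using l finite_labels by simp
qed

lemma green_char_class_comb: "green_char (class_comb f) = (\<Sum>l\<in>labels. of_int (f l) * simple_char l)"
proof -
  have cmul: "green_char (frag_cmul k a) = of_int k * green_char a" for k a
  proof -
    have nat: "green_char (frag_cmul (int k) a) = of_nat k * green_char a" for k
      by (induction k) (simp_all add: frag_cmul_distrib green_char_add distrib_right)
    have "green_char (frag_cmul (- int k) a) = - (of_nat k * green_char a)" for k
      using green_char_diff[of 0 "frag_cmul (int k) a"] nat[of k] frag_cmul_diff_distrib[of 0 "int k" a] by simp
    then show ?thesis using nat by (cases k rule: int_cases2) simp_all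
  qed
  have sum: "green_char (\<Sum>l\<in>A. g l) = (\<Sum>l\<in>A. green_char (g l))" for A :: "(nat \<times> nat) set" and g
    by (induction A rule: infinite_finite_induct) (simp_all add: green_char_add)
  show ?thesis unfolding class_comb_def sum by (rule sum.cong) (simp_all add: cmul green_char_simple_class)
qed

lemma class_comb_FG: "class_comb f \<in> carrier FG"
proof -
  have c: "frag_cmul k (simple_class l) \<in> carrier FG" for k l
    using keys_cmul[of k "simple_class l"] simple_class_FG[of l] by auto
  have "(\<Sum>l\<in>A. frag_cmul (f l) (simple_class l)) \<in> carrier FG" for A
    by (induction A rule: infinite_finite_induct) (use c keys_add_FG in \<open>auto simp del: FG_simps(1)\<close>, simp_all)
  then show ?thesis by (simp only: class_comb_def)
qed

text \<open>
  Modulo the relations, the class of a module is the sum of the classes of its simple summands.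
  The class of the zero module vanishes because \<open>[0 \<oplus> 0] = [0]\<close>.
\<close>

lemma cls_spanned: "is_rep n q R \<Longrightarrow> \<exists>f. frag_of (cls (hmod_of R)) - class_comb f \<in> K_rel"
proof (induction rule: rep_induct)
  case (zero R)
  let ?M = "hmod_of R"
  have M: "is_hmod n q ?M" "rof ?M = R" using is_hmod_hmod_of[OF zero(1)] by auto
  have S: "is_hmod n q (hmod_sum ?M ?M)" "rof (hmod_sum ?M ?M) = rep_sum R R" using hmod_sum_rep[OF M(1) M(1)] M(2) by simp_all
  have "rep_iso (rep_sum R R) R"
  proof -
    note g = is_rep_gens[OF zero(1)]
    have "dim_row (snd R x) = 0 \<and> dim_col (snd R x) = 0" for x
      using gens_inD[OF g, of x] zero(2) by auto
    then show ?thesis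
      unfolding rep_iso_def using zero(2)
      by (intro bexI[of _ "0\<^sub>m 0 0"]) (auto intro!: eq_matI simp: rep_sum_def)
  qed
  then have "cls (hmod_sum ?M ?M) = cls ?M" using cls_eq[OF S(1) M(1)] S(2) M(2) by simp
  moreover have "frag_of (cls (hmod_sum ?M ?M)) - (frag_of (cls ?M) + frag_of (cls ?M)) \<in> K_rel"
    by (rule K_rel_sum[OF M(1) M(1)])
  ultimately have "- frag_of (cls ?M) \<in> K_rel" by simp
  from K_rel_uminus[OF this] show ?case by (intro exI[of _ "\<lambda>_. 0"]) (simp add: class_comb_def)
next
  case (sum l R)
  let ?M = "hmod_of R" and ?S = "hmod_of (simple_rep l)" and ?N = "hmod_of (rep_sum (simple_rep l) R)"
  obtain f where f: "frag_of (cls ?M) - class_comb f \<in> K_rel" using sum(3) by blast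
  note M = is_hmod_hmod_of[OF sum(2)] and S = is_hmod_hmod_of[OF is_rep_simple_rep[of l]]
    and N = is_hmod_hmod_of[OF is_rep_sum[OF is_rep_simple_rep[of l] sum(2)]]
  note MS = hmod_sum_rep[OF S(1) M(1)]
  have "cls (hmod_sum ?S ?M) = cls ?N"
    by (rule cls_eq[OF MS(1) N(1)]) (simp only: MS(2) N(2) S(2) M(2), rule rep_iso_refl,
        rule is_rep_gens[OF is_rep_sum[OF is_rep_simple_rep sum(2)]])
  moreover have "frag_of (cls (hmod_sum ?S ?M)) - (frag_of (cls ?S) + frag_of (cls ?M)) \<in> K_rel"
    by (rule K_rel_sum[OF S(1) M(1)])
  ultimately have "frag_of (cls ?N) - (simple_class l + frag_of (cls ?M)) \<in> K_rel" by (simp add: simple_class_def)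
  from K_rel_add[OF this f] have "frag_of (cls ?N) - (simple_class l + class_comb f) \<in> K_rel" by (simp add: algebra_simps)
  then have "frag_of (cls ?N) - class_comb (\<lambda>l'. (if l' = l then 1 else 0) + f l') \<in> K_rel"
    unfolding class_comb_add class_comb_single[OF sum(1)] .
  then show ?case by blast
next
  case (iso R R')
  have "cls (hmod_of R) = cls (hmod_of R')"
    using cls_eq[OF is_hmod_hmod_of(1)[OF iso(1)] is_hmod_hmod_of(1)[OF iso(2)]]
      is_hmod_hmod_of(2)[OF iso(1)] is_hmod_hmod_of(2)[OF iso(2)] iso(3) by simp
  then show ?case using iso(4) by simp
qed

lemma FG_spanned: "a \<in> carrier FG \<Longrightarrow> \<exists>f. a - class_comb f \<in> K_rel"
proof (induction rule: FG_induct)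
  case zero
  show ?case using K_rel_0 by (intro exI[of _ "\<lambda>_. 0"]) (simp add: class_comb_def)
next
  case (of M)
  have R: "is_rep n q (rof M)" using of by (rule is_rep_rep_of)
  have "cls (hmod_of (rof M)) = cls M"
    using cls_eq[OF is_hmod_hmod_of(1)[OF R] of] is_hmod_hmod_of(2)[OF R] rep_iso_refl[OF is_rep_gens[OF R]] by simp
  then show ?case using cls_spanned[OF R] by simp
next
  case (diff a b)
  then obtain f g where "a - class_comb f \<in> K_rel" "b - class_comb g \<in> K_rel" by blast
  from K_rel_diff[OF this] have "(a - b) - class_comb (\<lambda>l. f l - g l) \<in> K_rel" by (simp add: class_comb_diff algebra_simps)
  then show ?case by blast
qed

lemma green_char_spanned:
  assumes "a \<in> carrier FG"
  obtains f where "a - class_comb f \<in> K_rel" "green_char a = (\<Sum>l\<in>labels. of_int (f l) * simple_char l)"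
proof -
  obtain f where f: "a - class_comb f \<in> K_rel" using FG_spanned[OF assms] by blast
  have "green_char a = green_char (class_comb f)" using K_rel_kernel[OF f] by (simp add: green_char_diff)
  then show thesis using that f by (simp add: green_char_class_comb)
qed

text \<open>
  The relations lie in the kernel because characters are additive. Conversely an element is,
  modulo the relations, a combination of simple classes, and if its character vanishes then so do
  the coefficients.
\<close>

lemma K_rel_eq: "K_rel = {a \<in> carrier FG. green_char a = 0}"
proof (intro equalityI subsetI)
  fix a assume "a \<in> {a \<in> carrier FG. green_char a = 0}"
  then have a: "a \<in> carrier FG" "green_char a = 0" by auto
  obtain f where f: "a - class_comb f \<in> K_rel" "green_char a = (\<Sum>l\<in>labels. of_int (f l) * simple_char l)" by (rule green_char_spanned[OF a(1)])
  have "f l = 0" if "l \<in> labels" for l using simple_char_independent[of f l] f(2) a(2) that by simp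
  then have "class_comb f = 0" by (simp add: class_comb_def)
  then show "a \<in> K_rel" using f(1) by simp
qed (use K_rel_kernel in auto)

lemma image_green_char: "green_char ` carrier FG = range (\<lambda>f. \<Sum>l\<in>labels. of_int (f l) * simple_char l)"
proof
  show "green_char ` carrier FG \<subseteq> range (\<lambda>f. \<Sum>l\<in>labels. of_int (f l) * simple_char l)" using green_char_spanned by blast
  show "range (\<lambda>f. \<Sum>l\<in>labels. of_int (f l) * simple_char l) \<subseteq> green_char ` carrier FG"
    using class_comb_FG by (auto simp del: FG_simps simp flip: green_char_class_comb)
qed

lemma green_ring_iso: "green_ring n q \<simeq> ring_of_type_algebra Quot rel_ideal"
proof -
  have "green_ring n q \<simeq> image_ring (green_char ` carrier FG)"
    unfolding green_ring_def
  proof (rule quotient_by_kernel_iso)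
    show "\<one>\<^bsub>FG\<^esub> \<in> carrier FG" by (simp add: cls_in unit_ok)
    show "green_char \<one>\<^bsub>FG\<^esub> = 1" by (simp add: class_char_cls unit_ok rep_char_dim1 char1_0)
    show "K_rel = {a \<in> carrier FG. green_char a = 0}" by (rule K_rel_eq)
    show "a + b \<in> carrier FG" "a - b \<in> carrier FG" "a \<otimes>\<^bsub>FG\<^esub> b \<in> carrier FG"
      "green_char (a \<otimes>\<^bsub>FG\<^esub> b) = green_char a * green_char b" if "a \<in> carrier FG" "b \<in> carrier FG" for a b
      using that FG_mult keys_add_FG keys_diff_FG by blast+
  qed (simp_all add: green_char_add)
  moreover have "ring_of_type_algebra Quot rel_ideal \<simeq> image_ring (poly_char ` carrier ring_of_type_algebra)"
    by (rule quotient_by_kernel_iso) (use is_hom_poly_char in \<open>auto simp: is_hom_def poly_char_eq_0_iff\<close>)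
  then have "image_ring (range poly_char) \<simeq> ring_of_type_algebra Quot rel_ideal"
    using ring_iso_sym[OF ideal.quotient_is_ring[OF ideal_I]] by simp
  ultimately show ?thesis
    unfolding image_green_char range_poly_char by (rule ring_iso_trans)
qed

end

theorem theorem4p7:
  fixes n m :: nat and q :: "'k::field" and y z :: "int poly poly"
  assumes "n \<ge> 3" and "odd n" and "m = (n - 1) div 2"
    and "primitive_root_of_unity n q"
    and "\<not> CHAR('k) dvd 2 * n ^ 2"
    and "y = varY" and "z = varZ"
  shows "green_ring n q \<simeq> ring_of_type_algebra Quot (Idl\<^bsub>ring_of_type_algebra\<^esub>
    {y ^ (2 * n) - 1,
     z * y ^ n - z,
     z ^ (m + 1) - z ^ m * y ^ (m + 1)
       + (\<Sum>i = 1..(m + 1) div 2. (-1) ^ i * of_nat ((m + 1 - i) choose i) * y ^ i * z ^ (m + 1 - 2 * i))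
       - (\<Sum>i = 1..m div 2. (-1) ^ i * of_nat ((m - i) choose i) * y ^ (m + 1 + i) * z ^ (m - 2 * i))
       - y ^ (n + 1) * F m + y ^ (m + n + 2) * F (m - 1)})"
proof -
  interpret H_alg n m q
    using assms by unfold_locales
  show ?thesis
    using green_ring_iso unfolding rel_ideal_def rel_gens_def assms(6,7) third_relation .
qed

end
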